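(* Let $A,B$ be finite-dimensional Hilbert spaces, $\rho_{AB}\in \mathrm{S}(A\otimes B)$, $\sigma_A\in\mathrm{S}(A)$, and $\alpha\in[\tfrac12,1)\cup(1,\infty]$. Then, with $\rho_A=\mathrm{tr}_B[\rho_{AB}]$, $$D_{\alpha,\mathbb{M}}(\rho_A\|\sigma_A)\;\le\; D_{\alpha,\mathbb{M}}(\rho_{AB}\|\mathcal{C}^{\sigma_A}_{AB})\;\le\; D_\alpha(\rho_A\|\sigma_A).$$
   Context: $\mathrm{S}(A)$ is the set of density matrices (positive semidefinite, trace one) on the finite-dimensional Hilbert space $A$; $\log$ is to base $2$. $\mathcal{C}^{\sigma_A}_{AB}:=\{\sigma'_{AB}\in\mathrm{S}(A\otimes B):\mathrm{tr}_B[\sigma'_{AB}]=\sigma_A\}$ is the set of extensions of $\sigma_A$. The (sandwiched) Rényi relative entropy for $\alpha\in[\frac12,1)\cup(1,\infty)$ is $D_\alpha(\rho\|\sigma):=\frac{1}{\alpha-1}\log \mathrm{tr}\big[(\sigma^{\frac{1-\alpha}{2\alpha}}\rho\,\sigma^{\frac{1-\alpha}{2\alpha}})^\alpha\big]$ if $\alpha<1$ or $\mathrm{supp}\,\rho\subseteq\mathrm{supp}\,\sigma$, and $+\infty$ otherwise (negative powers are taken on the support; $\log 0=-\infty$). For $\alpha=\infty$, $D_\infty(\rho\|\sigma)=D_{\max}(\rho\|\sigma):=\inf\{\lambda\in\mathbb{R}:\rho\le 2^\lambda\sigma\}$ (with $\inf\emptyset=+\infty$). The measured Rényi relative entropy is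 $D_{\alpha,\mathbb{M}}(\rho\|\sigma):=\sup_{\mathcal{M}}D_\alpha(\mathcal{M}(\rho)\|\mathcal{M}(\sigma))$, the supremum being over all POVM channels $\mathcal{M}(X)=\sum_x\mathrm{tr}[M_xX]\,|x\rangle\langle x|$ with $\{M_x\}$ a (finite) POVM and $\{|x\rangle\}$ orthonormal. For a set $\mathcal{S}$ of density matrices, $D_{\alpha,\mathbb{M}}(\rho\|\mathcal{S}):=\inf_{\sigma\in\mathcal{S}}D_{\alpha,\mathbb{M}}(\rho\|\sigma)$. *)

theory Defs
  imports "Jordan_Normal_Form.Schur_Decomposition" "Jordan_Normal_Form.Matrix_Kernel"
    "HOL-Library.Extended_Real"
begin

text \<open>A finite-dimensional Hilbert space is represented by $\mathbb{C}^d$ and operators by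
  \<open>d \<times> d\<close> complex matrices. The tensor product of $\mathbb{C}^{d_A}$ and $\mathbb{C}^{d_B}$ is
  identified with $\mathbb{C}^{d_A d_B}$ by mapping $e_i \otimes f_k$ to $e_{i d_B + k}$.\<close>

definition mat_trace :: "complex mat \<Rightarrow> complex" where
  "mat_trace A = (\<Sum>i<dim_row A. A $$ (i, i))"

definition psd_mat :: "nat \<Rightarrow> complex mat \<Rightarrow> bool" where
  "psd_mat n A \<longleftrightarrow> A \<in> carrier_mat n n \<and> mat_adjoint A = A \<and>
     (\<forall>v \<in> carrier_vec n. 0 \<le> Re ((A *\<^sub>v v) \<bullet>c v))"

definition density_mats :: "nat \<Rightarrow> complex mat set" where
  "density_mats n = {\<rho>. psd_mat n \<rho> \<and> mat_trace \<rho> = 1}"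

definition ptrace_B :: "nat \<Rightarrow> nat \<Rightarrow> complex mat \<Rightarrow> complex mat" where
  "ptrace_B dA dB \<rho> = mat dA dA (\<lambda>(i, j). \<Sum>k<dB. \<rho> $$ (i * dB + k, j * dB + k))"

definition extensions :: "nat \<Rightarrow> nat \<Rightarrow> complex mat \<Rightarrow> complex mat set" where
  "extensions dA dB \<sigma> = {\<sigma>' \<in> density_mats (dA * dB). ptrace_B dA dB \<sigma>' = \<sigma>}"

definition unitary_mat :: "nat \<Rightarrow> complex mat \<Rightarrow> bool" where
  "unitary_mat n U \<longleftrightarrow> U \<in> carrier_mat n n \<and> mat_adjoint U * U = 1\<^sub>m n"

text \<open>Powers of positive semidefinite matrices by spectral calculus. The result does not depend on
  the chosen diagonalization. Since \<open>0 powr s = 0\<close> for every \<open>s\<close>, all powers (in particular the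
  negative ones) are taken on the support.\<close>

definition mat_powr :: "complex mat \<Rightarrow> real \<Rightarrow> complex mat" where
  "mat_powr A s = (THE B. \<exists>U d. unitary_mat (dim_row A) U \<and>
     A = U * mat_diag (dim_row A) (\<lambda>i. complex_of_real (d i)) * mat_adjoint U \<and>
     B = U * mat_diag (dim_row A) (\<lambda>i. complex_of_real (d i powr s)) * mat_adjoint U)"

text \<open>The support is the orthogonal complement of the kernel.\<close>

definition mat_supp :: "complex mat \<Rightarrow> complex vec set" where
  "mat_supp A = {v \<in> carrier_vec (dim_col A). \<forall>w \<in> mat_kernel A. v \<bullet>c w = 0}"

definition elog2 :: "real \<Rightarrow> ereal" where
  "elog2 x = (if x \<le> 0 then -\<infinity> else ereal (log 2 x))"

definition renyi_real :: "real \<Rightarrow> complex mat \<Rightarrow> complex mat \<Rightarrow> ereal" where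
  "renyi_real \<alpha> \<rho> \<sigma> =
     (if \<alpha> < 1 \<or> mat_supp \<rho> \<subseteq> mat_supp \<sigma>
      then let S = mat_powr \<sigma> ((1 - \<alpha>) / (2 * \<alpha>))
           in ereal (1 / (\<alpha> - 1)) * elog2 (Re (mat_trace (mat_powr (S * \<rho> * S) \<alpha>)))
      else \<infinity>)"

definition D_max :: "complex mat \<Rightarrow> complex mat \<Rightarrow> ereal" where
  "D_max \<rho> \<sigma> = Inf {ereal l | l. psd_mat (dim_row \<sigma>) (complex_of_real (2 powr l) \<cdot>\<^sub>m \<sigma> - \<rho>)}"

definition renyi_div :: "ereal \<Rightarrow> complex mat \<Rightarrow> complex mat \<Rightarrow> ereal" where
  "renyi_div \<alpha> \<rho> \<sigma> = (if \<alpha> = \<infinity> then D_max \<rho> \<sigma> else renyi_real (real_of_ereal \<alpha>) \<rho> \<sigma>)"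

text \<open>A POVM on $\mathbb{C}^d$ with outcomes \<open>0, \<dots>, n - 1\<close>; its channel maps into the \<open>n \<times> n\<close>
  matrices, the orthonormal vectors $|x\rangle$ being the standard basis of $\mathbb{C}^n$.\<close>

definition povm :: "nat \<Rightarrow> nat \<Rightarrow> (nat \<Rightarrow> complex mat) \<Rightarrow> bool" where
  "povm d n M \<longleftrightarrow> (\<forall>x<n. psd_mat d (M x)) \<and>
     mat d d (\<lambda>(i, j). \<Sum>x<n. M x $$ (i, j)) = 1\<^sub>m d"

definition povm_channel :: "nat \<Rightarrow> (nat \<Rightarrow> complex mat) \<Rightarrow> complex mat \<Rightarrow> complex mat" where
  "povm_channel n M X = mat_diag n (\<lambda>x. mat_trace (M x * X))"

definition measured_renyi :: "ereal \<Rightarrow> complex mat \<Rightarrow> complex mat \<Rightarrow> ereal" where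
  "measured_renyi \<alpha> \<rho> \<sigma> =
     Sup {renyi_div \<alpha> (povm_channel n M \<rho>) (povm_channel n M \<sigma>) | n M. povm (dim_row \<rho>) n M}"

definition measured_renyi_set :: "ereal \<Rightarrow> complex mat \<Rightarrow> complex mat set \<Rightarrow> ereal" where
  "measured_renyi_set \<alpha> \<rho> \<S> = (INF \<sigma>\<in>\<S>. measured_renyi \<alpha> \<rho> \<sigma>)"

end

theory Submission
  imports "HOL-Probability.Sinc_Integral" "HOL-Complex_Analysis.Residue_Theorem"
    "HOL-Real_Asymp.Real_Asymp" Defs "Jordan_Normal_Form.Spectral_Radius"
begin

text \<open>A POVM on \<open>A\<close> extends to \<open>A \<otimes> B\<close> by tensoring with the identity, which gives the first
  inequality. For the second one no minimax theorem is needed, since a good extension can be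
  written down.

  If \<open>\<alpha> = \<infinity>\<close> and \<open>\<rho>\<^sub>A \<le> 2\<^sup>\<lambda> \<sigma>\<close>, take \<open>2\<^sup>-\<^sup>\<lambda> \<rho> + (\<sigma> - 2\<^sup>-\<^sup>\<lambda> \<rho>\<^sub>A) \<otimes> 1/d\<^sub>B\<close>. If \<open>\<alpha>\<close> is finite, let
  \<open>r = (\<alpha> - 1)/\<alpha>\<close>, \<open>\<theta> = |r|\<close>, \<open>X = \<sigma>\<^bsup>-r/2\<^esup> \<rho>\<^sub>A \<sigma>\<^bsup>-r/2\<^esup>\<close>, \<open>Q = tr X\<^sup>\<alpha>\<close> and
  \<open>L(z) = \<sigma>\<^bsup>z/2\<^esup> X\<^bsup>(\<alpha>-1)/2-\<alpha>z/2\<^esup> \<sigma>\<^bsup>-r/2\<^esup>\<close>. On the line \<open>Re z = 1\<close> the matrix \<open>L(z) \<rho>\<^sub>A L(z)\<^sup>*\<close> is at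
  most \<open>\<sigma>\<close>, so averaging \<open>(L(z) \<otimes> 1) \<rho> (L(z) \<otimes> 1)\<^sup>*\<close> over this line and completing the marginal as
  above gives an extension \<open>\<tau>\<close>. The average is taken with respect to the harmonic measure of the strip
  \<open>0 < Re z < 1\<close> seen from \<open>\<theta>\<close>. Then Hirschman's three lines theorem, applied for each outcome \<open>x\<close>
  separately, bounds \<open>tr M\<^sub>x (L(\<theta>) \<otimes> 1) \<rho> (L(\<theta>) \<otimes> 1)\<^sup>*\<close> by \<open>a\<^sub>x\<^bsup>1-\<theta>\<^esup> (tr M\<^sub>x \<tau>)\<^bsup>\<theta>\<^esup>\<close>, where
  \<open>\<Sum>\<^sub>x a\<^sub>x = Q\<close>. For \<open>\<alpha> > 1\<close> the left-hand side is \<open>tr M\<^sub>x \<rho>\<close>; for \<open>\<alpha> < 1\<close> one writes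
  \<open>Q = \<Sum>\<^sub>x tr M\<^sub>x (L(\<theta>) \<otimes> 1) \<rho>\<close> and uses the Cauchy-Schwarz inequality.\<close>

text \<open>The obstacle is the order of quantifiers: one extension has to serve all measurements at
  once. The classical three lines theorem would bound the value at \<theta> by a supremum over the
  line \<open>Re z = 1\<close>, taken at heights that depend on the outcome. With harmonic measure
  the supremum becomes an average over the height, and since the trace is linear this is the trace
  against one averaged matrix that no longer depends on the measurement. The exponents of
  \<open>L\<close> meet three demands. Conjugating the marginal by \<open>L z\<close> yields a power
  of \<open>X\<close> with exponent \<open>\<alpha> * (1 - Re z)\<close> between powers of \<sigma>:
  on the left line this is the \<alpha>-th power, whose trace is \<open>Q\<close>; on the right line
  it is the support projection of \<open>X\<close>, which is at most 1. At \<theta> the outer power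
  of \<sigma> is the inverse of \<open>S\<close> if \<alpha> > 1 and \<open>S\<close> itself if
  \<alpha> < 1. All matrix entries of \<open>L\<close> are finite sums of exponentials with real
  frequencies, so the Poisson formula has to be known for a single exponential only, where it is one
  residue.\<close>

no_notation inner (infix "\<bullet>" 70)
no_notation vec_nth (infixl "$" 90)
hide_const (open) Finite_Cartesian_Product.mat Finite_Cartesian_Product.vec

section \<open>Harmonic measure of the strip\<close>

lemma cosh_ge_quadratic: "(1 + x\<^sup>2) / 4 \<le> cosh (x::real)"
proof -
  have *: "(1 + x\<^sup>2) / 4 \<le> cosh x" if "0 \<le> x" for x :: real
  proof -
    have "1 + x + x\<^sup>2 / 2 \<le> exp x" by (rule exp_lower_Taylor_quadratic[OF that])
    then show ?thesis using that exp_gt_zero[of "-x"] by (simp add: cosh_field_def field_simps) (use exp_gt_zero[of "-x"] in linarith)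
  qed
  show ?thesis
    using *[of x] *[of "-x"] by (cases "0 \<le> x") auto
qed

lemma one_less_sinh: "1 < sinh x" if "2 \<le> x" for x :: real
proof -
  have "1 + x + x\<^sup>2 / 2 \<le> exp x" using that by (intro exp_lower_Taylor_quadratic) simp
  moreover have "exp (- x) \<le> 1" using that by simp
  moreover have "4 \<le> x\<^sup>2" using power_mono[OF that, of 2] by simp
  ultimately have "2 < exp x - exp (- x)" using that by linarith
  then show ?thesis by (simp add: sinh_field_def)
qed

text \<open>As cosh is at least 1, the denominator is at least
  \<open>(1 - \<bar>c\<bar>) * cosh (pi * t)\<close>, which in turn dominates a positive multiple of
  \<open>1 + t\<^sup>2\<close>. The comparison function is therefore the Cauchy density up to a
  factor.\<close>

lemma integrable_inverse_cosh_plus: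
  fixes c d :: real
  assumes "\<bar>c\<bar> < 1"
  shows "integrable lborel (\<lambda>t. d / (cosh (pi * t) + c))"
proof (rule Bochner_Integration.integrable_bound)
  have "set_integrable lborel (einterval (-\<infinity>) \<infinity>) (\<lambda>x::real. inverse (1 + x\<^sup>2))"
    by (rule integrable_inverse_1_plus_square)
  then have "integrable lborel (\<lambda>x::real. inverse (1 + x\<^sup>2))"
    by (simp add: set_integrable_def)
  then show "integrable lborel (\<lambda>x::real. 4 * \<bar>d\<bar> / (1 - \<bar>c\<bar>) * inverse (1 + x\<^sup>2))"
    by (rule integrable_mult_right)
  show "(\<lambda>t. d / (cosh (pi * t) + c)) \<in> borel_measurable lborel"
    by (simp, intro borel_measurable_divide borel_measurable_add borel_measurable_const
      borel_measurable_continuous_onI continuous_intros)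
  have "norm (d / (cosh (pi * t) + c)) \<le> norm (4 * \<bar>d\<bar> / (1 - \<bar>c\<bar>) * inverse (1 + t\<^sup>2))" for t :: real
  proof -
    have "t\<^sup>2 * 1 \<le> t\<^sup>2 * pi\<^sup>2"
      using pi_ge_two power_mono[of 1 pi 2] by (intro mult_left_mono) simp_all
    then have "(1 + t\<^sup>2) / 4 \<le> cosh (pi * t)"
      using cosh_ge_quadratic[of "pi * t"] by (simp add: power_mult_distrib mult.commute)
    then have "(1 - \<bar>c\<bar>) * ((1 + t\<^sup>2) / 4) \<le> (1 - \<bar>c\<bar>) * cosh (pi * t)"
      using assms by (intro mult_left_mono) auto
    also have "\<dots> = cosh (pi * t) - \<bar>c\<bar> * cosh (pi * t)" by (simp add: algebra_simps)
    also have "\<dots> \<le> cosh (pi * t) - \<bar>c\<bar> * 1"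
      using cosh_real_ge_1[of "pi * t"] by (intro diff_left_mono mult_left_mono) auto
    also have "\<dots> \<le> cosh (pi * t) + c" by linarith
    finally have le: "(1 - \<bar>c\<bar>) * ((1 + t\<^sup>2) / 4) \<le> cosh (pi * t) + c" .
    have "0 < 1 + t\<^sup>2" by (rule add_pos_nonneg) simp_all
    then have pos: "0 < (1 - \<bar>c\<bar>) * ((1 + t\<^sup>2) / 4)" using assms by simp
    have pos': "0 < cosh (pi * t) + c" by (rule less_le_trans[OF pos le])
    have "\<bar>d\<bar> / (cosh (pi * t) + c) \<le> \<bar>d\<bar> / ((1 - \<bar>c\<bar>) * ((1 + t\<^sup>2) / 4))"
      by (rule frac_le[OF _ _ pos le]) auto
    also have "\<dots> = 4 * \<bar>d\<bar> / (1 - \<bar>c\<bar>) * inverse (1 + t\<^sup>2)"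
    proof -
      have "a / (b * (x / 4)) = 4 * a / b * inverse x" for a b x :: real
        by (simp add: inverse_eq_divide)
      then show ?thesis .
    qed
    finally have 1: "\<bar>d\<bar> / (cosh (pi * t) + c) \<le> 4 * \<bar>d\<bar> / (1 - \<bar>c\<bar>) * inverse (1 + t\<^sup>2)" .
    have "norm (d / (cosh (pi * t) + c)) = \<bar>d\<bar> / (cosh (pi * t) + c)"
      using pos' by (simp add: abs_divide)
    also have "\<dots> \<le> norm (4 * \<bar>d\<bar> / (1 - \<bar>c\<bar>) * inverse (1 + t\<^sup>2))"
      unfolding real_norm_def by (rule order.trans[OF 1 abs_ge_self])
    finally show ?thesis .
  qed
  then show "AE t in lborel. norm (d / (cosh (pi * t) + c)) \<le> norm (4 * \<bar>d\<bar> / (1 - \<bar>c\<bar>) * inverse (1 + t\<^sup>2))"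
    by simp
qed

lemma integral_symmetric_interval_tendsto:
  fixes F :: "real \<Rightarrow> complex"
  assumes "integrable lborel F"
  shows "(\<lambda>n. integral {-real n..real n} F) \<longlonglongrightarrow> (LINT t|lborel. F t)"
proof -
  have eq: "integral {-real n..real n} F = (LINT t|lborel. indicator {-real n..real n} t *\<^sub>R F t)" for n
  proof -
    have "set_integrable lborel {-real n..real n} F"
      unfolding set_integrable_def by (rule integrable_mult_indicator) (use assms in auto)
    from set_borel_integral_eq_integral(2)[OF this] show ?thesis
      by (simp add: set_lebesgue_integral_def)
  qed
  have "(\<lambda>n. LINT t|lborel. indicator {-real n..real n} t *\<^sub>R F t) \<longlonglongrightarrow> (LINT t|lborel. F t)"
  proof (rule integral_dominated_convergence[where w = "\<lambda>t. norm (F t)"])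
    show "AE t in lborel. (\<lambda>n. indicator {-real n..real n} t *\<^sub>R F t) \<longlonglongrightarrow> F t"
    proof (rule AE_I2)
      fix t :: real
      obtain N where "\<bar>t\<bar> \<le> real N" using real_arch_simple by blast
      then have "\<forall>\<^sub>F n in sequentially. indicator {-real n..real n} t *\<^sub>R F t = F t"
        unfolding eventually_sequentially by (intro exI[of _ N]) (auto simp: indicator_def)
      then show "(\<lambda>n. indicator {-real n..real n} t *\<^sub>R F t) \<longlonglongrightarrow> F t"
        by (rule tendsto_eventually)
    qed
    show "AE t in lborel. norm (indicator {-real n..real n} t *\<^sub>R F t) \<le> norm (F t)" for n
      by (auto simp: indicator_def)
  qed (use assms in auto)
  then show ?thesis by (simp add: eq)
qed

text \<open>The Poisson formula of the strip for the exponential with frequency \<open>l\<close>,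
  obtained by integrating \<open>k\<close> around growing rectangles with vertical sides on
  \<open>Re z = 0\<close> and \<open>Re z = 1\<close>. There cos(pi z) equals cosh(pi t) and
  -cosh(pi t), so the vertical sides give the two integrals; the right-hand side is the residue at
  \<theta>.\<close>

lemma strip_exp_integral:
  fixes \<theta> l :: real
  assumes "0 < \<theta>" "\<theta> < 1"
  shows "(LINT t|lborel. of_real (sin (pi * \<theta>) / 2 / (cosh (pi * t) + - cos (pi * \<theta>))) * exp (\<i> * of_real (l * t)))
     + exp (of_real l) * (LINT t|lborel. of_real (sin (pi * \<theta>) / 2 / (cosh (pi * t) + cos (pi * \<theta>))) * exp (\<i> * of_real (l * t)))
     = exp (of_real (l * \<theta>))"
proof -
  define c where "c = cos (pi * \<theta>)"
  define d where "d = sin (pi * \<theta>)"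
  \<comment> \<open>The factor \<open>pi * d\<close> is the derivative of the denominator at
    \<theta>; it makes the residue there exactly \<open>exp (l * \<theta>)\<close>.\<close>
  define k where "k = (\<lambda>z::complex. of_real (pi * d) * exp (of_real l * z) / (of_real c - cos (of_real pi * z)))"
  \<comment> \<open>The zeros of the denominator are \<theta> and -\<theta> shifted by even
    integers, so this is the widest open vertical strip around \<theta> that contains no other
    zero.\<close>
  define S where "S = {z. - \<theta> < Re z \<and> Re z < 2 - \<theta>}"
  have d_pos: "0 < d" unfolding d_def using assms by (intro sin_gt_zero) auto
  have c_less: "\<bar>c\<bar> < 1"
    using d_pos sin_cos_squared_add[of "pi * \<theta>"] unfolding c_def d_def
    by (metis abs_cos_le_one abs_eq_iff' add_cancel_left_left less_eq_real_def less_irrefl one_power2 power2_abs power_eq_0_iff)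
  have "S = {z. Re z > - \<theta>} \<inter> {z. Re z < 2 - \<theta>}" by (auto simp: S_def)
  then have open_S: "open S" and convex_S: "convex S"
    by (auto intro!: open_Int convex_Int open_halfspace_Re_gt open_halfspace_Re_lt convex_halfspace_Re_gt convex_halfspace_Re_lt)
  have zero: "z = of_real \<theta>" if "z \<in> S" "of_real c - cos (of_real pi * z) = 0" for z
  proof -
    have "cos (of_real pi * z) = cos (of_real (pi * \<theta>))"
      using that(2) by (simp add: c_def flip: cos_of_real)
    then obtain n where n: "n \<in> \<int>" "of_real pi * z = of_real (pi * \<theta>) + of_real (2 * n * pi) \<or> of_real pi * z = - of_real (pi * \<theta>) + of_real (2 * n * pi)"
      unfolding complex_cos_eq by blast
    then have "z = of_real (\<theta> + 2 * n) \<or> z = of_real (- \<theta> + 2 * n)"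
    proof (elim disjE)
      assume "of_real pi * z = of_real (pi * \<theta>) + of_real (2 * n * pi)"
      then have "of_real pi * z = of_real pi * of_real (\<theta> + 2 * n)" by (simp add: algebra_simps)
      then show ?thesis by (subst (asm) mult_cancel_left) auto
    next
      assume "of_real pi * z = - of_real (pi * \<theta>) + of_real (2 * n * pi)"
      then have "of_real pi * z = of_real pi * of_real (- \<theta> + 2 * n)" by (simp add: algebra_simps)
      then show ?thesis by (subst (asm) mult_cancel_left) auto
    qed
    moreover obtain m :: int where m: "n = of_int m" using n(1) by (auto elim: Ints_cases)
    moreover have "- \<theta> < Re z" "Re z < 2 - \<theta>" using that(1) by (auto simp: S_def)
    ultimately show ?thesis
    proof (elim disjE)
      assume z: "z = of_real (\<theta> + 2 * n)"
      then have "- 1 < real_of_int m" "real_of_int m < 1"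
        using \<open>- \<theta> < Re z\<close> \<open>Re z < 2 - \<theta>\<close> assms m by auto
      then have "m = 0" by linarith
      then show ?thesis using z m by simp
    next
      assume z: "z = of_real (- \<theta> + 2 * n)"
      then have "0 < real_of_int m" "real_of_int m < 1"
        using \<open>- \<theta> < Re z\<close> \<open>Re z < 2 - \<theta>\<close> assms m by auto
      then have "0 < m" "m < 1" by simp_all
      then show ?thesis by simp
    qed
  qed
  have th_S: "of_real \<theta> \<in> S" using assms by (auto simp: S_def)
  have holo: "k holomorphic_on S - {of_real \<theta>}"
    unfolding k_def using zero by (auto intro!: holomorphic_intros)
  have trig: "sin (of_real pi * of_real \<theta>) = (of_real d :: complex)" "cos (of_real pi * of_real \<theta>) = (of_real c :: complex)"
    unfolding d_def c_def by (metis of_real_mult sin_of_real, metis of_real_mult cos_of_real)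
  have res: "residue k (of_real \<theta>) = exp (of_real (l * \<theta>))"
  proof -
    have "residue k (of_real \<theta>) = of_real (pi * d) * exp (of_real l * of_real \<theta>) / of_real (pi * d)"
      unfolding k_def
    proof (rule residue_simple_pole_deriv[where s = S])
      show "((\<lambda>z::complex. of_real c - cos (of_real pi * z)) has_field_derivative of_real (pi * d)) (at (of_real \<theta>))"
        by (rule derivative_eq_intros refl)+ (simp add: trig)
      show "(\<lambda>z. of_real (pi * d) * exp (of_real l * z)) holomorphic_on S"
        "(\<lambda>z. of_real c - cos (of_real pi * z)) holomorphic_on S"
        by (intro holomorphic_intros)+
      show "connected S" by (rule convex_connected[OF convex_S])
    qed (use open_S th_S d_pos trig in simp_all)
    then show ?thesis using d_pos by simp
  qed
  have cos_it: "cos (of_real pi * (\<i> * of_real t)) = of_real (cosh (pi * t))" for t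
  proof -
    have "cos (of_real pi * (\<i> * of_real t)) = cos (\<i> * of_real (pi * t))" by (simp add: mult_ac)
    also have "\<dots> = cosh (of_real (pi * t))" by (rule cosh_conv_cos[symmetric])
    finally show ?thesis
      by (simp add: cosh_field_def exp_minus flip: exp_of_real)
  qed
  have cos_1it: "cos (of_real pi * (1 + \<i> * of_real t)) = - of_real (cosh (pi * t))" for t
  proof -
    have "cos (of_real pi * (1 + \<i> * of_real t)) = cos (of_real pi + of_real pi * (\<i> * of_real t))"
      by (simp add: algebra_simps)
    also have "\<dots> = - cos (of_real pi * (\<i> * of_real t))"
      by (simp add: cos_add sin_of_real cos_of_real)
    finally show ?thesis by (simp only: cos_it)
  qed
  define F0 where "F0 = (\<lambda>t. of_real (d / 2 / (cosh (pi * t) + - c)) * exp (\<i> * of_real (l * t)))"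
  define F1 where "F1 = (\<lambda>t. of_real (d / 2 / (cosh (pi * t) + c)) * exp (\<i> * of_real (l * t)))"
  have nz: "cosh (pi * t) + - c \<noteq> 0" "cosh (pi * t) + c \<noteq> 0" for t
    using cosh_real_ge_1[of "pi * t"] c_less by linarith+
  \<comment> \<open>The minus sign comes from the denominator \<open>c - cosh (pi * t)\<close>; it
    is undone below, because the left side of the rectangle is traversed downwards.\<close>
  have k0: "k (Complex 0 t) = - of_real (2 * pi) * F0 t" for t
  proof -
    have "of_real c - of_real (cosh (pi * t)) = (of_real (c - cosh (pi * t)) :: complex)" by simp
    then show ?thesis using nz[of t] unfolding k_def F0_def Complex_eq
      by (simp only: cos_it of_real_0 add_0_left) (simp add: field_simps)
  qed
  have k1: "k (Complex 1 t) = of_real (2 * pi) * (exp (of_real l) * F1 t)" for t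
  proof -
    have "of_real c - - of_real (cosh (pi * t)) = (of_real (c + cosh (pi * t)) :: complex)" by simp
    moreover have "exp (of_real l * (1 + \<i> * of_real t)) = exp (of_real l) * exp (\<i> * of_real (l * t))"
      by (simp add: exp_add[symmetric] algebra_simps)
    ultimately have "k (Complex 1 t) = of_real (pi * d) * (exp (of_real l) * exp (\<i> * of_real (l * t))) / of_real (c + cosh (pi * t))"
      unfolding k_def Complex_eq by (simp only: cos_1it of_real_1)
    also have "of_real (pi * d) * (exp (of_real l) * exp (\<i> * of_real (l * t))) / of_real (c + cosh (pi * t))
        = of_real (pi * d / (cosh (pi * t) + c)) * (exp (of_real l) * exp (\<i> * of_real (l * t)))"
      by (simp add: add.commute)
    also have "pi * d / (cosh (pi * t) + c) = 2 * pi * (d / 2 / (cosh (pi * t) + c))"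
    proof -
      have "pi * d / x = 2 * pi * (d / 2 / x)" for x by simp
      then show ?thesis .
    qed
    finally show ?thesis unfolding F1_def by (simp only: of_real_mult mult_ac)
  qed
  have int: "integrable lborel F0" "integrable lborel F1"
  proof -
    have meas: "(\<lambda>t. of_real (d / 2 / (cosh (pi * t) + b)) * exp (\<i> * of_real (l * t)) :: complex) \<in> borel_measurable lborel" for b
    proof -
      have [measurable]: "(\<lambda>t. d / 2 / (cosh (pi * t) + b)) \<in> borel_measurable borel"
        by (intro borel_measurable_divide borel_measurable_add borel_measurable_const
            borel_measurable_continuous_onI continuous_intros)
      have [measurable]: "(\<lambda>t. exp (\<i> * of_real (l * t)) :: complex) \<in> borel_measurable borel"
        by (intro borel_measurable_continuous_onI continuous_intros)
      show ?thesis unfolding measurable_lborel2 by measurable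
    qed
    have norm_eq: "norm (complex_of_real x * exp (\<i> * of_real y)) = norm x" for x y :: real
      by (simp add: norm_mult)
    show "integrable lborel F0" unfolding F0_def
      by (rule Bochner_Integration.integrable_bound[OF integrable_inverse_cosh_plus[of "- c" "d / 2"] meas])
         (use c_less in \<open>simp_all only: norm_eq order.refl AE_I2 abs_minus_cancel\<close>)
    show "integrable lborel F1" unfolding F1_def
      by (rule Bochner_Integration.integrable_bound[OF integrable_inverse_cosh_plus[of c "d / 2"] meas])
         (use c_less in \<open>simp_all only: norm_eq order.refl AE_I2 abs_minus_cancel\<close>)
  qed
  define R where "R = (\<lambda>n::nat. contour_integral (linepath (Complex 0 (- real n)) (Complex 1 (- real n))) k
     + contour_integral (linepath (Complex 1 (real n)) (Complex 0 (real n))) k)"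
  have eq: "of_real (2 * pi) * \<i> * exp (of_real (l * \<theta>)) = R n + of_real (2 * pi) * \<i> * (integral {-real n..real n} F0 + exp (of_real l) * integral {-real n..real n} F1)"
    if "0 < n" for n
  proof -
    define a1 a3 where "a1 = Complex 0 (- real n)" and "a3 = Complex 1 (real n)"
    have le: "Re a1 \<le> Re a3" "Im a1 \<le> Im a3" by (auto simp: a1_def a3_def)
    have box: "of_real \<theta> \<in> box a1 a3" using assms that by (auto simp: a1_def a3_def in_box_complex_iff)
    have cb: "cbox a1 a3 \<subseteq> S" using assms by (auto simp: S_def a1_def a3_def in_cbox_complex_iff)
    have img: "path_image (rectpath a1 a3) \<subseteq> S - {of_real \<theta>}"
      using cb box le by (auto simp: path_image_rectpath_cbox_minus_box)
    have "contour_integral (rectpath a1 a3) k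
        = of_real (2 * pi) * \<i> * (\<Sum>p\<in>{of_real \<theta>}. winding_number (rectpath a1 a3) p * residue k p)"
    proof (rule Residue_theorem)
      show "\<forall>z. z \<notin> S \<longrightarrow> winding_number (rectpath a1 a3) z = 0"
        using cb le by (auto intro!: winding_number_rectpath_outside)
      show "connected S" by (rule convex_connected[OF convex_S])
    qed (use open_S holo img in simp_all)
    also have "\<dots> = of_real (2 * pi) * \<i> * exp (of_real (l * \<theta>))"
      using winding_number_rectpath[OF box] res by simp
    finally have 1: "contour_integral (rectpath a1 a3) k = of_real (2 * pi) * \<i> * exp (of_real (l * \<theta>))" .
    have cont: "continuous_on (path_image (rectpath a1 a3)) k"
      by (rule continuous_on_subset[OF holomorphic_on_imp_continuous_on[OF holo] img])
    have "path_image (rectpath a1 a3) = closed_segment a1 (Complex 1 (- real n)) \<union> closed_segment (Complex 1 (- real n)) a3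
        \<union> closed_segment a3 (Complex 0 (real n)) \<union> closed_segment (Complex 0 (real n)) a1"
      by (simp add: rectpath_def Let_def path_image_join Un_assoc a1_def a3_def)
    with cont have ci: "k contour_integrable_on linepath a1 (Complex 1 (- real n))"
      "k contour_integrable_on linepath (Complex 1 (- real n)) a3"
      "k contour_integrable_on linepath a3 (Complex 0 (real n))"
      "k contour_integrable_on linepath (Complex 0 (real n)) a1"
      by (intro contour_integrable_continuous_linepath; elim continuous_on_subset; blast)+
    have 2: "contour_integral (rectpath a1 a3) k = contour_integral (linepath a1 (Complex 1 (- real n))) k
      + (contour_integral (linepath (Complex 1 (- real n)) a3) k + (contour_integral (linepath a3 (Complex 0 (real n))) k
      + contour_integral (linepath (Complex 0 (real n)) a1) k))"
      using ci by (simp add: rectpath_def Let_def a1_def a3_def valid_path_join)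
    have 3: "contour_integral (linepath (Complex 1 (- real n)) a3) k = of_real (2 * pi) * \<i> * (exp (of_real l) * integral {-real n..real n} F1)"
      using that by (subst contour_integral_linepath_same_Re[of _ 1 _ "- real n" "real n"]) (auto simp: a3_def k1 mult_ac)
    have "contour_integral (linepath (Complex 0 (real n)) a1) k = - contour_integral (linepath a1 (Complex 0 (real n))) k"
      using contour_integral_reversepath[of "linepath a1 (Complex 0 (real n))" k] by simp
    also have "\<dots> = of_real (2 * pi) * \<i> * integral {-real n..real n} F0"
      using that by (subst contour_integral_linepath_same_Re[of _ 0 _ "- real n" "real n"]) (auto simp: a1_def k0 mult_ac)
    finally show ?thesis using 1 2 3 unfolding R_def a1_def a3_def by (simp add: algebra_simps)
  qed
  have "R \<longlonglongrightarrow> 0"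
  proof -
    define b where "b = (\<lambda>n::nat. pi * d * exp \<bar>l\<bar> / (sinh (pi * real n) - \<bar>c\<bar>))"
    have bnd: "norm (k z) \<le> b n" if z: "0 \<le> Re z" "Re z \<le> 1" "\<bar>Im z\<bar> = real n" "0 < n" for z n
    proof -
      have s: "1 < sinh (pi * real n)"
      proof -
        have "1 \<le> real n" using z(4) by simp
        then have "2 * 1 \<le> pi * real n" using pi_ge_two by (intro mult_mono) auto
        then show ?thesis by (intro one_less_sinh) simp
      qed
      \<comment> \<open>The squared modulus of cos w is cos(Re w)^2 + sinh(Im w)^2, so on the
        horizontal sides the denominator grows exponentially in \<open>n\<close>.\<close>
      have "sinh (pi * real n) \<le> norm (cos (of_real pi * z))"
      proof -
        have "Im z = real n \<or> Im z = - real n" using z(3) by linarith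
        then have "sinh (pi * real n) = \<bar>sinh (pi * Im z)\<bar>"
          by (elim disjE) simp_all
        also have "\<dots> \<le> norm (cos (of_real pi * z))"
          by (rule abs_le_square_iff[THEN iffD2, of _ "norm _", simplified])
             (simp add: norm_cos_squared sinh_def exp_minus power_divide)
        finally show ?thesis .
      qed
      moreover have "norm (cos (of_real pi * z)) - norm (of_real c :: complex) \<le> norm (of_real c - cos (of_real pi * z))"
        by (metis norm_minus_commute norm_triangle_ineq2)
      ultimately have "sinh (pi * real n) - \<bar>c\<bar> \<le> norm (of_real c - cos (of_real pi * z))" by simp
      moreover have "norm (exp (of_real l * z)) \<le> exp \<bar>l\<bar>"
      proof -
        have "l * Re z \<le> \<bar>l\<bar> * 1" using z by (meson abs_ge_self abs_ge_zero mult_mono)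
        then show ?thesis by simp
      qed
      ultimately show ?thesis using d_pos s c_less unfolding k_def b_def norm_divide norm_mult
        by (intro frac_le mult_mono) (auto simp: norm_mult)
    qed
    have seg: "norm (contour_integral (linepath (Complex x y) (Complex x' y)) k) \<le> b n"
      if "x \<in> {0..1}" "x' \<in> {0..1}" "\<bar>x' - x\<bar> = 1" "\<bar>y\<bar> = real n" "0 < n" for x x' y n
    proof (rule order.trans[OF contour_integral_bound_linepath[where B = "b n"]])
      have sub: "0 \<le> Re z \<and> Re z \<le> 1 \<and> Im z = y" if "z \<in> closed_segment (Complex x y) (Complex x' y)" for z
      proof -
        from that obtain u where u: "0 \<le> u" "u \<le> 1" "z = (1 - u) *\<^sub>R Complex x y + u *\<^sub>R Complex x' y"
          by (auto simp: closed_segment_def)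
        have "(1 - u) * x + u * x' \<le> (1 - u) * 1 + u * 1"
          using u \<open>x \<in> {0..1}\<close> \<open>x' \<in> {0..1}\<close> by (intro add_mono mult_left_mono) auto
        moreover have "0 \<le> (1 - u) * x + u * x'"
          using u \<open>x \<in> {0..1}\<close> \<open>x' \<in> {0..1}\<close> by simp
        moreover have "Re z = (1 - u) * x + u * x'" "Im z = (1 - u) * y + u * y"
          unfolding u(3) by simp_all
        ultimately show ?thesis by (simp add: algebra_simps)
      qed
      then show "norm (k z) \<le> b n" if "z \<in> closed_segment (Complex x y) (Complex x' y)" for z
        using bnd[of z n] that \<open>\<bar>y\<bar> = real n\<close> \<open>0 < n\<close> by auto
      have "closed_segment (Complex x y) (Complex x' y) \<subseteq> S - {of_real \<theta>}"
        using sub \<open>\<bar>y\<bar> = real n\<close> \<open>0 < n\<close> assms by (fastforce simp: S_def)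
      then show "k contour_integrable_on linepath (Complex x y) (Complex x' y)"
        using holomorphic_on_imp_continuous_on[OF holo]
        by (intro contour_integrable_continuous_linepath) (rule continuous_on_subset)
      show "0 \<le> b n"
        using order.trans[OF norm_ge_zero bnd[of "Complex 0 y" n]] \<open>\<bar>y\<bar> = real n\<close> \<open>0 < n\<close> by simp
      have "norm (Complex x' y - Complex x y) = 1"
        using \<open>\<bar>x' - x\<bar> = 1\<close> by (simp add: cmod_def)
      then show "b n * norm (Complex x' y - Complex x y) \<le> b n" by simp
    qed
    have "norm (R n) \<le> 2 * b n" if "0 < n" for n
      unfolding R_def
      by (rule order.trans[OF norm_triangle_ineq], rule order.trans[OF add_mono[OF seg[of _ _ _ n] seg[of _ _ _ n]]])
         (use that in auto)
    then have "\<forall>\<^sub>F n in sequentially. norm (R n) \<le> 2 * b n"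
      unfolding eventually_sequentially by (intro exI[of _ 1]) auto
    moreover have "(\<lambda>n. 2 * b n) \<longlonglongrightarrow> 0"
      unfolding b_def sinh_field_def by real_asymp
    ultimately show ?thesis by (rule Lim_null_comparison)
  qed
  define G where "G = (\<lambda>n. R n + of_real (2 * pi) * \<i> * (integral {-real n..real n} F0 + exp (of_real l) * integral {-real n..real n} F1))"
  have lim: "G \<longlonglongrightarrow> 0 + of_real (2 * pi) * \<i> * ((LINT t|lborel. F0 t) + exp (of_real l) * (LINT t|lborel. F1 t))"
    unfolding G_def by (intro tendsto_intros \<open>R \<longlonglongrightarrow> 0\<close> integral_symmetric_interval_tendsto int)
  have "G n = of_real (2 * pi) * \<i> * exp (of_real (l * \<theta>))" if "1 \<le> n" for n
    unfolding G_def using eq[of n] that by simp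
  then have "G \<longlonglongrightarrow> of_real (2 * pi) * \<i> * exp (of_real (l * \<theta>))"
    by (intro tendsto_eventually) (auto simp: eventually_sequentially)
  from LIMSEQ_unique[OF lim this]
  have "of_real (2 * pi) * \<i> * ((LINT t|lborel. F0 t) + exp (of_real l) * (LINT t|lborel. F1 t)) = of_real (2 * pi) * \<i> * exp (of_real (l * \<theta>))"
    by simp
  then have "(LINT t|lborel. F0 t) + exp (of_real l) * (LINT t|lborel. F1 t) = exp (of_real (l * \<theta>))"
    by (subst (asm) mult_cancel_left) auto
  then show ?thesis by (simp only: F0_def F1_def c_def d_def)
qed

section \<open>Exponential polynomials and the three lines theorem\<close>

text \<open>Real frequencies give each term a constant modulus on every vertical line. The class
  contains the entries of complex matrix powers, is closed under sums and products, and inherits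
  linear identities from a single exponential.\<close>

inductive exp_poly :: "(complex \<Rightarrow> complex) \<Rightarrow> bool" where
  exp_poly_monom: "exp_poly (\<lambda>z. c * exp (of_real l * z))"
| exp_poly_add: "exp_poly f \<Longrightarrow> exp_poly g \<Longrightarrow> exp_poly (\<lambda>z. f z + g z)"

lemma exp_poly_const: "exp_poly (\<lambda>z. c)"
  using exp_poly_monom[of c 0] by simp

lemma exp_poly_sum: "(\<And>i. i \<in> I \<Longrightarrow> exp_poly (f i)) \<Longrightarrow> exp_poly (\<lambda>z. \<Sum>i\<in>I. f i z)"
  by (induction I rule: infinite_finite_induct) (auto intro: exp_poly_const exp_poly_add)

lemma exp_poly_mult:
  assumes "exp_poly f" "exp_poly g"
  shows "exp_poly (\<lambda>z. f z * g z)"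
  using assms(1)
proof induction
  case (exp_poly_monom c l)
  from assms(2) show ?case
  proof induction
    case (exp_poly_monom c' l')
    have "(\<lambda>z. c * exp (of_real l * z) * (c' * exp (of_real l' * z))) = (\<lambda>z. c * c' * exp (of_real (l + l') * z))"
      by (simp add: exp_add algebra_simps)
    then show ?case by (metis exp_poly.exp_poly_monom)
  next
    case (exp_poly_add f g)
    then show ?case by (simp add: distrib_left exp_poly.exp_poly_add)
  qed
next
  case (exp_poly_add f g)
  then show ?case by (simp add: distrib_right exp_poly.exp_poly_add)
qed

text \<open>The class in which integrands live: restrictions of exponential polynomials to vertical
  lines belong to it, and it is also closed under conjugation, which destroys holomorphy. Its
  members are integrable against every Borel probability measure on the line.\<close>

definition bounded_cont :: "(real \<Rightarrow> complex) \<Rightarrow> bool" where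
  "bounded_cont f \<longleftrightarrow> continuous_on UNIV f \<and> bounded (range f)"

lemma bounded_contI:
  assumes "continuous_on UNIV f" "\<And>t. norm (f t) \<le> C"
  shows "bounded_cont f"
  using assms by (auto simp: bounded_cont_def bounded_iff)

lemma bounded_cont_const: "bounded_cont (\<lambda>t. c)"
  by (rule bounded_contI[of _ "norm c"]) auto

lemma bounded_cont_add: "bounded_cont f \<Longrightarrow> bounded_cont g \<Longrightarrow> bounded_cont (\<lambda>t. f t + g t)"
  unfolding bounded_cont_def by (auto intro!: continuous_intros bounded_plus_comp)

lemma bounded_cont_mult:
  assumes "bounded_cont f" "bounded_cont g"
  shows "bounded_cont (\<lambda>t. f t * g t)"
proof -
  from assms obtain a b where ab: "\<And>t. norm (f t) \<le> a" "\<And>t. norm (g t) \<le> b"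
    unfolding bounded_cont_def bounded_iff by blast
  then have "norm (f t * g t) \<le> a * b" for t
    unfolding norm_mult by (intro mult_mono) (auto intro: order.trans[OF norm_ge_zero])
  then show ?thesis using assms unfolding bounded_cont_def
    by (intro bounded_contI[unfolded bounded_cont_def] continuous_intros) auto
qed

lemma bounded_cont_cnj: "bounded_cont f \<Longrightarrow> bounded_cont (\<lambda>t. cnj (f t))"
  unfolding bounded_cont_def bounded_iff by (auto intro!: continuous_intros)

lemma bounded_cont_sum: "(\<And>i. i \<in> I \<Longrightarrow> bounded_cont (f i)) \<Longrightarrow> bounded_cont (\<lambda>t. \<Sum>i\<in>I. f i t)"
  by (induction I rule: infinite_finite_induct) (auto intro: bounded_cont_const bounded_cont_add)

lemma bounded_cont_exp_poly:
  assumes "exp_poly h"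
  shows "bounded_cont (\<lambda>t. h (of_real x + \<i> * of_real t))"
  using assms
proof induction
  case (exp_poly_monom c l)
  show ?case
    by (rule bounded_contI[of _ "norm c * exp (l * x)"]) (auto intro!: continuous_intros simp: norm_mult)
next
  case (exp_poly_add f g)
  show ?case by (intro bounded_cont_add exp_poly_add.IH)
qed

lemma integrable_bounded_cont:
  assumes "prob_space M" "sets M = sets borel" "bounded_cont f"
  shows "integrable M f"
proof -
  interpret prob_space M by fact
  from assms(3) obtain C where C: "\<And>t. norm (f t) \<le> C"
    unfolding bounded_cont_def bounded_iff by blast
  have "f \<in> borel_measurable borel"
    using assms(3) unfolding bounded_cont_def by (auto intro: borel_measurable_continuous_onI)
  then have "f \<in> borel_measurable M" using measurable_cong_sets[OF assms(2) refl] by blast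
  then show ?thesis by (rule integrable_const_bound[of _ C, rotated]) (use C in auto)
qed

lemma (in prob_space) square_integral_le:
  fixes X :: "'a \<Rightarrow> real"
  assumes "integrable M X" "integrable M (\<lambda>x. (X x)\<^sup>2)"
  shows "(integral\<^sup>L M X)\<^sup>2 \<le> (LINT x|M. (X x)\<^sup>2)"
  using variance_eq[OF assms] variance_positive[of X] by simp

text \<open>The two normalised pieces of the harmonic measure of the strip \<open>0 < Re z < 1\<close> seen from \<open>\<theta>\<close>,
  characterised by their Fourier transforms.\<close>

definition strip_measures :: "real \<Rightarrow> real measure \<Rightarrow> real measure \<Rightarrow> bool" where
  "strip_measures \<theta> \<mu>0 \<mu>1 \<longleftrightarrow> prob_space \<mu>0 \<and> prob_space \<mu>1 \<and> sets \<mu>0 = sets borel \<and> sets \<mu>1 = sets borel \<and>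
    (\<forall>l::real. exp (complex_of_real (l * \<theta>)) =
      of_real (1 - \<theta>) * (LINT t|\<mu>0. exp (\<i> * of_real (l * t))) +
      of_real \<theta> * exp (of_real l) * (LINT t|\<mu>1. exp (\<i> * of_real (l * t))))"

text \<open>The densities are the kernels of \<open>strip_exp_integral\<close> divided by their
  masses. The masses follow without computing an integral: the frequency 0 gives their sum, and
  comparing moduli for all frequencies gives the second one.\<close>

lemma ex_strip_measures:
  assumes "0 < \<theta>" "\<theta> \<le> 1"
  shows "\<exists>\<mu>0 \<mu>1. strip_measures \<theta> \<mu>0 \<mu>1"
proof (cases "\<theta> = 1")
  case True
  \<comment> \<open>For \<theta> = 1 the first measure has weight 0 and harmonic measure degenerates
    to a point mass on the right line. This case is reached at \<alpha> = 1/2.\<close>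
  have "prob_space (return borel (0::real))" by (rule prob_space_return) simp
  then have "strip_measures \<theta> (return borel 0) (return borel 0)"
    unfolding strip_measures_def using True by (auto simp: integral_return)
  then show ?thesis by blast
next
  case False
  with assms have th: "0 < \<theta>" "\<theta> < 1" by auto
  define c d where "c = cos (pi * \<theta>)" and "d = sin (pi * \<theta>) / 2"
  define P0 P1 where "P0 = (\<lambda>t. d / (cosh (pi * t) + - c))" and "P1 = (\<lambda>t. d / (cosh (pi * t) + c))"
  have d_pos: "0 < d" unfolding d_def using th by (auto intro!: sin_gt_zero)
  have "c\<^sup>2 < 1" using d_pos sin_cos_squared_add[of "pi * \<theta>"] unfolding c_def d_def
    by (smt (verit) half_gt_zero_iff zero_less_power)
  then have c_less: "\<bar>c\<bar> < 1" by (simp add: abs_square_less_1)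
  have int: "integrable lborel P0" "integrable lborel P1"
    unfolding P0_def P1_def by (rule integrable_inverse_cosh_plus, use c_less in simp)+
  have nonneg: "0 \<le> P0 t" "0 \<le> P1 t" for t
    using cosh_real_ge_1[of "pi * t"] c_less d_pos unfolding P0_def P1_def by (auto intro!: divide_nonneg_nonneg)
  define m0 m1 where "m0 = (LINT t|lborel. P0 t)" and "m1 = (LINT t|lborel. P1 t)"
  have poisson: "(LINT t|lborel. of_real (P0 t) * exp (\<i> * of_real (l * t)))
     + exp (of_real l) * (LINT t|lborel. of_real (P1 t) * exp (\<i> * of_real (l * t))) = exp (of_real (l * \<theta>))" for l
    using strip_exp_integral[OF th, of l] unfolding P0_def P1_def c_def d_def .
  have m_add: "m0 + m1 = 1"
  proof -
    have "complex_of_real (m0 + m1) = 1"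
      using poisson[of 0] unfolding m0_def m1_def by simp
    then show ?thesis using of_real_eq_1_iff by blast
  qed
  have ineq: "exp (l * \<theta>) \<le> m0 + exp l * m1" for l
  proof -
    have b: "norm (LINT t|lborel. of_real (P t) * exp (\<i> * of_real (l * t)) :: complex) \<le> (LINT t|lborel. P t)"
      if "\<And>t. 0 \<le> P t" for P
    proof -
      have "norm (LINT t|lborel. of_real (P t) * exp (\<i> * of_real (l * t)) :: complex)
        \<le> (LINT t|lborel. norm (of_real (P t) * exp (\<i> * of_real (l * t)) :: complex))"
        by (rule integral_norm_bound)
      also have "\<dots> = (LINT t|lborel. P t)"
        using that by (simp add: norm_mult)
      finally show ?thesis .
    qed
    have "exp (l * \<theta>) = norm (exp (complex_of_real (l * \<theta>)))" by (simp del: of_real_mult)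
    also have "\<dots> \<le> norm (LINT t|lborel. of_real (P0 t) * exp (\<i> * of_real (l * t)) :: complex)
       + norm (exp (complex_of_real l) * (LINT t|lborel. of_real (P1 t) * exp (\<i> * of_real (l * t))))"
      unfolding poisson[symmetric] by (rule norm_triangle_ineq)
    also have "\<dots> \<le> m0 + exp l * m1"
      unfolding norm_mult m0_def m1_def using b[OF nonneg(1)] b[OF nonneg(2)] by (intro add_mono) (auto intro!: mult_mono)
    finally show ?thesis .
  qed
  have m1: "m1 = \<theta>"
  proof -
    have one_pos: "0 < (1 :: real)" by simp
    \<comment> \<open>By \<open>ineq\<close> this function is nonnegative, and it vanishes at 0
      because the masses add up to 1. So 0 is a minimum and the derivative
      \<open>m1 - \<theta>\<close> is zero there.\<close>
    define \<phi> where "\<phi> = (\<lambda>l. m0 + exp l * m1 - exp (l * \<theta>))"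
    have "(\<phi> has_real_derivative (m1 - \<theta>)) (at 0)"
      unfolding \<phi>_def by (auto intro!: derivative_eq_intros)
    moreover have "\<forall>y. \<bar>0 - y\<bar> < 1 \<longrightarrow> \<phi> 0 \<le> \<phi> y"
      using ineq m_add by (simp add: \<phi>_def)
    ultimately have "m1 - \<theta> = 0" by (rule DERIV_local_min[OF _ one_pos])
    then show ?thesis by simp
  qed
  then have m0: "m0 = 1 - \<theta>" using m_add by simp
  define D where "D = (\<lambda>P (m::real). density lborel (\<lambda>t::real. ennreal (P t / m)))"
  have D: "prob_space (D P m)" "sets (D P m) = sets borel"
    "of_real m * (LINT t|D P m. exp (\<i> * of_real (l * t))) = (LINT t|lborel. of_real (P t) * exp (\<i> * of_real (l * t)) :: complex)"
    if P: "integrable lborel P" "\<And>t. 0 \<le> P t" "(LINT t|lborel. P t) = m" "0 < m" for P m l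
  proof -
    have [measurable]: "P \<in> borel_measurable borel" using P(1) by auto
    have "(\<integral>\<^sup>+ t. ennreal (P t / m) \<partial>lborel) = ennreal (LINT t|lborel. P t / m)"
      using P by (intro nn_integral_eq_integral) auto
    also have "(LINT t|lborel. P t / m) = 1" using P by simp
    finally show "prob_space (D P m)" unfolding D_def
      by (intro prob_spaceI) (simp add: emeasure_density)
    show "sets (D P m) = sets borel" by (simp add: D_def)
    have "(LINT t|D P m. exp (\<i> * of_real (l * t))) = (LINT t|lborel. (P t / m) *\<^sub>R exp (\<i> * of_real (l * t)) :: complex)"
      unfolding D_def using P by (intro integral_density) (auto intro!: borel_measurable_continuous_onI continuous_intros)
    also have "\<dots> = (LINT t|lborel. of_real (1 / m) * (of_real (P t) * exp (\<i> * of_real (l * t))))"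
      by (rule Bochner_Integration.integral_cong) (simp_all add: scaleR_conv_of_real)
    also have "\<dots> = of_real (1 / m) * (LINT t|lborel. of_real (P t) * exp (\<i> * of_real (l * t)))"
      by (rule integral_mult_right_zero)
    finally show "of_real m * (LINT t|D P m. exp (\<i> * of_real (l * t))) = (LINT t|lborel. of_real (P t) * exp (\<i> * of_real (l * t)) :: complex)"
      using P(4) by simp
  qed
  have 0: "(LINT t|lborel. P0 t) = 1 - \<theta>" "0 < 1 - \<theta>" and 1: "(LINT t|lborel. P1 t) = \<theta>"
    using m0 m1 th by (simp_all add: m0_def m1_def)
  note D0 = D[OF int(1) nonneg(1) 0] and D1 = D[OF int(2) nonneg(2) 1 th(1)]
  have "strip_measures \<theta> (D P0 (1 - \<theta>)) (D P1 \<theta>)"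
    unfolding strip_measures_def
  proof (intro conjI allI)
    fix l :: real
    have "of_real \<theta> * exp (of_real l) * (LINT t|D P1 \<theta>. exp (\<i> * of_real (l * t)))
      = exp (complex_of_real l) * (of_real \<theta> * (LINT t|D P1 \<theta>. exp (\<i> * of_real (l * t))))"
      by (simp only: mult_ac)
    then show "exp (complex_of_real (l * \<theta>)) =
      of_real (1 - \<theta>) * (LINT t|D P0 (1 - \<theta>). exp (\<i> * of_real (l * t))) +
      of_real \<theta> * exp (of_real l) * (LINT t|D P1 \<theta>. exp (\<i> * of_real (l * t)))"
      by (simp only: D0(3) D1(3) poisson)
  qed (use D0 D1 in auto)
  then show ?thesis by blast
qed

lemma strip_measures_exp_poly:
  assumes "strip_measures \<theta> \<mu>0 \<mu>1" "exp_poly h"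
  shows "h (of_real \<theta>) = of_real (1 - \<theta>) * (LINT t|\<mu>0. h (of_real 0 + \<i> * of_real t))
    + of_real \<theta> * (LINT t|\<mu>1. h (of_real 1 + \<i> * of_real t))"
  using assms(2)
proof induction
  case (exp_poly_monom c l)
  have 0: "(LINT t|\<mu>0. c * exp (of_real l * (of_real 0 + \<i> * of_real t))) = c * (LINT t|\<mu>0. exp (\<i> * of_real (l * t)))"
    by (simp add: mult_ac)
  have "(LINT t|\<mu>1. c * exp (of_real l * (of_real 1 + \<i> * of_real t)))
     = (LINT t|\<mu>1. c * exp (of_real l) * exp (\<i> * of_real (l * t)))"
    by (rule Bochner_Integration.integral_cong) (simp_all add: exp_add distrib_left mult_ac)
  then have 1: "(LINT t|\<mu>1. c * exp (of_real l * (of_real 1 + \<i> * of_real t)))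
     = c * exp (of_real l) * (LINT t|\<mu>1. exp (\<i> * of_real (l * t)))"
    by simp
  have "exp (of_real l * complex_of_real \<theta>) = of_real (1 - \<theta>) * (LINT t|\<mu>0. exp (\<i> * of_real (l * t))) +
      of_real \<theta> * exp (of_real l) * (LINT t|\<mu>1. exp (\<i> * of_real (l * t)))"
    using assms(1) unfolding strip_measures_def by (simp flip: of_real_mult)
  from arg_cong[OF this, of "\<lambda>x. c * x"] show ?case
    unfolding 0 1 by (simp add: algebra_simps)
next
  case (exp_poly_add f g)
  have prob: "prob_space \<mu>0" "prob_space \<mu>1" using assms(1) by (auto simp: strip_measures_def)
  have sets: "sets \<mu>0 = sets borel" "sets \<mu>1 = sets borel" using assms(1) by (auto simp: strip_measures_def)
  have "integrable \<mu>0 (\<lambda>t. h (of_real 0 + \<i> * of_real t))" "integrable \<mu>1 (\<lambda>t. h (of_real 1 + \<i> * of_real t))"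
    if "exp_poly h" for h
    by (intro integrable_bounded_cont prob sets bounded_cont_exp_poly that)+
  then show ?case using exp_poly_add
    by (subst (1 2) Bochner_Integration.integral_add) (auto simp only: algebra_simps)
qed

text \<open>Applied to \<open>z \<mapsto> exp (m * z) * (\<Sum>i\<in>I. cnj (h i \<theta>) * h i z)\<close>; the free scale \<open>m\<close> replaces the
  subharmonicity of the logarithm.\<close>

lemma three_lines_scaled:
  fixes h :: "'i \<Rightarrow> complex \<Rightarrow> complex" and m :: real
  assumes \<mu>: "strip_measures \<theta> \<mu>0 \<mu>1" and h: "\<And>i. i \<in> I \<Longrightarrow> exp_poly (h i)" and \<theta>: "0 \<le> \<theta>" "\<theta> \<le> 1"
  shows "exp (m * \<theta>) * sqrt (\<Sum>i\<in>I. (norm (h i (of_real \<theta>)))\<^sup>2)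
    \<le> (1 - \<theta>) * sqrt (LINT t|\<mu>0. (\<Sum>i\<in>I. (norm (h i (of_real 0 + \<i> * of_real t)))\<^sup>2))
     + \<theta> * exp m * sqrt (LINT t|\<mu>1. (\<Sum>i\<in>I. (norm (h i (of_real 1 + \<i> * of_real t)))\<^sup>2))"
proof -
  define w where "w = (\<lambda>x (t::real). complex_of_real x + \<i> * of_real t)"
  define v where "v = (\<lambda>z. L2_set (\<lambda>i. norm (h i z)) I)"
  define N where "N = v (of_real \<theta>)"
  \<comment> \<open>The conjugated coefficients are frozen at \<theta>, which keeps \<open>g\<close>
    holomorphic although its value at \<theta> is a squared length. Elsewhere Cauchy-Schwarz bounds
    it by \<open>N\<close> times the length of \<open>h\<close>, so one factor \<open>N\<close> can
    be cancelled at the end.\<close>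
  define g where "g = (\<lambda>z. exp (of_real m * z) * (\<Sum>i\<in>I. cnj (h i (of_real \<theta>)) * h i z))"
  have v_sq: "(v z)\<^sup>2 = (\<Sum>i\<in>I. (norm (h i z))\<^sup>2)" for z
    unfolding v_def L2_set_def by (simp add: sum_nonneg)
  have v_nonneg: "0 \<le> v z" for z by (simp add: v_def)
  have prob: "prob_space \<mu>0" "prob_space \<mu>1" and sets: "sets \<mu>0 = sets borel" "sets \<mu>1 = sets borel"
    using \<mu> by (auto simp: strip_measures_def)
  have g: "exp_poly g" unfolding g_def
    using exp_poly_monom[of 1 m] h by (auto intro!: exp_poly_mult exp_poly_sum exp_poly_const)
  have v_sq_int: "integrable M (\<lambda>t. (v (w x t))\<^sup>2)" if M: "prob_space M" "sets M = sets borel" for M x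
  proof -
    have "integrable M (\<lambda>t. \<Sum>i\<in>I. h i (w x t) * cnj (h i (w x t)))"
      unfolding w_def using h M by (intro integrable_bounded_cont bounded_cont_sum bounded_cont_mult bounded_cont_cnj bounded_cont_exp_poly)
    then have "integrable M (\<lambda>t. complex_of_real ((v (w x t))\<^sup>2))"
      by (simp only: v_sq of_real_sum complex_norm_square)
    then show ?thesis by (simp only: complex_of_real_integrable_eq)
  qed
  have bound: "norm (LINT t|M. g (w x t)) \<le> exp (m * x) * N * sqrt (LINT t|M. (v (w x t))\<^sup>2)"
    if M: "prob_space M" "sets M = sets borel" for M x
  proof -
    interpret prob_space M by fact
    have meas: "(\<lambda>t. v (w x t)) \<in> borel_measurable M"
    proof -
      have "(\<lambda>t. sqrt ((v (w x t))\<^sup>2)) \<in> borel_measurable M"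
        using v_sq_int[OF M, of x] by measurable
      then show ?thesis using v_nonneg by simp
    qed
    have int: "integrable M (\<lambda>t. v (w x t))"
    proof (rule Bochner_Integration.integrable_bound[OF _ meas])
      show "integrable M (\<lambda>t. 1 + (v (w x t))\<^sup>2)" using v_sq_int[OF M] by simp
      have "v z \<le> 1 + (v z)\<^sup>2" for z
        using zero_le_power2[of "v z - 1"] v_nonneg[of z] unfolding power2_diff by simp
      then show "AE t in M. norm (v (w x t)) \<le> norm (1 + (v (w x t))\<^sup>2)"
        using v_nonneg by simp
    qed
    have g_le: "norm (g (w x t)) \<le> exp (m * x) * N * v (w x t)" for t
    proof -
      have "norm (\<Sum>i\<in>I. cnj (h i (of_real \<theta>)) * h i (w x t)) \<le> (\<Sum>i\<in>I. \<bar>norm (h i (of_real \<theta>))\<bar> * \<bar>norm (h i (w x t))\<bar>)"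
        by (rule order.trans[OF norm_sum]) (simp add: norm_mult)
      also have "\<dots> \<le> N * v (w x t)" unfolding N_def v_def by (rule L2_set_mult_ineq)
      finally show ?thesis unfolding g_def norm_mult by (simp add: w_def mult.assoc)
    qed
    have "norm (LINT t|M. g (w x t)) \<le> (LINT t|M. exp (m * x) * N * v (w x t))"
    proof (rule Bochner_Integration.integral_norm_bound_integral)
      show "integrable M (\<lambda>t. g (w x t))"
        unfolding w_def by (rule integrable_bounded_cont[OF M bounded_cont_exp_poly[OF g]])
    qed (use g_le int in auto)
    also have "\<dots> = exp (m * x) * N * (LINT t|M. v (w x t))" by simp
    \<comment> \<open>Jensen's inequality for the square. Squared lengths are the right quantity to
      average, since they will be traces and hence linear in the averaged matrix.\<close>
    also have "\<dots> \<le> exp (m * x) * N * sqrt (LINT t|M. (v (w x t))\<^sup>2)"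
      using square_integral_le[OF int v_sq_int[OF M]] v_nonneg
      by (intro mult_left_mono real_le_rsqrt) (auto simp: N_def)
    finally show ?thesis .
  qed
  have "exp (m * \<theta>) * N\<^sup>2 = norm (g (of_real \<theta>))"
  proof -
    have "complex_of_real (N\<^sup>2) = (\<Sum>i\<in>I. cnj (h i (of_real \<theta>)) * h i (of_real \<theta>))"
      unfolding N_def v_sq of_real_sum complex_norm_square by (simp only: mult.commute)
    then have "g (of_real \<theta>) = of_real (exp (m * \<theta>) * N\<^sup>2)"
      unfolding g_def by (simp flip: exp_of_real)
    then show ?thesis by (simp del: of_real_mult)
  qed
  also have "g (of_real \<theta>) = of_real (1 - \<theta>) * (LINT t|\<mu>0. g (w 0 t)) + of_real \<theta> * (LINT t|\<mu>1. g (w 1 t))"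
    unfolding w_def by (rule strip_measures_exp_poly[OF \<mu> g])
  also have "norm \<dots> \<le> (1 - \<theta>) * norm (LINT t|\<mu>0. g (w 0 t)) + \<theta> * norm (LINT t|\<mu>1. g (w 1 t))"
    using \<theta> by (intro order.trans[OF norm_triangle_ineq]) (simp add: norm_mult del: of_real_diff)
  also have "\<dots> \<le> (1 - \<theta>) * (exp (m * 0) * N * sqrt (LINT t|\<mu>0. (v (w 0 t))\<^sup>2))
     + \<theta> * (exp (m * 1) * N * sqrt (LINT t|\<mu>1. (v (w 1 t))\<^sup>2))"
    using \<theta> by (intro add_mono mult_left_mono bound prob sets) auto
  also have "\<dots> = ((1 - \<theta>) * sqrt (LINT t|\<mu>0. (v (w 0 t))\<^sup>2) + \<theta> * exp m * sqrt (LINT t|\<mu>1. (v (w 1 t))\<^sup>2)) * N"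
    by (simp add: algebra_simps)
  finally have le: "(exp (m * \<theta>) * N) * N \<le> ((1 - \<theta>) * sqrt (LINT t|\<mu>0. (v (w 0 t))\<^sup>2) + \<theta> * exp m * sqrt (LINT t|\<mu>1. (v (w 1 t))\<^sup>2)) * N"
    by (simp add: power2_eq_square mult.assoc)
  have "exp (m * \<theta>) * N \<le> (1 - \<theta>) * sqrt (LINT t|\<mu>0. (v (w 0 t))\<^sup>2) + \<theta> * exp m * sqrt (LINT t|\<mu>1. (v (w 1 t))\<^sup>2)"
  proof (cases "N = 0")
    case True
    then show ?thesis using \<theta> by (simp add: integral_nonneg_AE)
  next
    case False
    then have "0 < N" using v_nonneg by (simp add: N_def less_le)
    with le show ?thesis by simp
  qed
  moreover have "N = sqrt (\<Sum>i\<in>I. (norm (h i (of_real \<theta>)))\<^sup>2)"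
    by (simp add: N_def v_def L2_set_def)
  ultimately show ?thesis unfolding v_sq w_def by simp
qed

text \<open>The scale \<open>m = ln (A / B)\<close> balances the two terms, and dividing by
  \<open>(A / B) powr \<theta>\<close> leaves the product. If \<open>A\<close> or \<open>B\<close>
  is 0 there is no such scale, so the bound is first proved for larger positive \<open>x\<close> and
  \<open>y\<close>, which then decrease to \<open>A\<close> and \<open>B\<close>; both exponents are
  positive, so \<open>powr\<close> is continuous there.\<close>

lemma le_powr_mult_powr_of_scaled:
  fixes A B N \<theta> :: real
  assumes \<theta>: "0 < \<theta>" "\<theta> < 1" and nonneg: "0 \<le> A" "0 \<le> B"
    and le: "\<And>m. exp (m * \<theta>) * N \<le> (1 - \<theta>) * A + \<theta> * exp m * B"
  shows "N \<le> A powr (1 - \<theta>) * B powr \<theta>"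
proof -
  have *: "N \<le> x powr (1 - \<theta>) * y powr \<theta>" if "0 < x" "0 < y" "A \<le> x" "B \<le> y" for x y
  proof -
    have "(x / y) powr \<theta> * N = exp (ln (x / y) * \<theta>) * N"
      using that by (simp add: powr_def mult.commute)
    also have "\<dots> \<le> (1 - \<theta>) * A + \<theta> * exp (ln (x / y)) * B" by (rule le)
    also have "\<dots> \<le> (1 - \<theta>) * x + \<theta> * exp (ln (x / y)) * y"
      using that \<theta> by (intro add_mono mult_left_mono) auto
    also have "\<dots> = x" using that by (simp add: algebra_simps)
    finally have "N \<le> x / (x / y) powr \<theta>" using that by (simp add: field_simps)
    also have "\<dots> = x powr (1 - \<theta>) * y powr \<theta>"
      using that by (simp add: powr_divide powr_diff)
    finally show ?thesis .
  qed
  have "(\<lambda>n. (A + 1 / real (Suc n)) powr (1 - \<theta>) * (B + 1 / real (Suc n)) powr \<theta>)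
      \<longlonglongrightarrow> (A + 0) powr (1 - \<theta>) * (B + 0) powr \<theta>"
    using \<theta> nonneg
    by (intro tendsto_mult tendsto_powr' tendsto_add tendsto_const LIMSEQ_Suc[OF lim_1_over_n])
       (auto intro!: always_eventually add_nonneg_nonneg)
  moreover have "N \<le> (A + 1 / real (Suc n)) powr (1 - \<theta>) * (B + 1 / real (Suc n)) powr \<theta>" for n
    using nonneg by (intro *) (auto intro: add_nonneg_pos)
  ultimately show ?thesis by (intro LIMSEQ_le_const) auto
qed

text \<open>The case distinction is forced by \<open>0 powr 0 = 0\<close>: for \<theta> = 1 and
  \<open>A = 0\<close> the product would be 0 instead of \<open>B\<close>.\<close>

lemma three_lines:
  fixes h :: "'i \<Rightarrow> complex \<Rightarrow> complex"
  assumes "strip_measures \<theta> \<mu>0 \<mu>1" "\<And>i. i \<in> I \<Longrightarrow> exp_poly (h i)" "0 < \<theta>" "\<theta> \<le> 1"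
  defines "A \<equiv> LINT t|\<mu>0. (\<Sum>i\<in>I. (norm (h i (of_real 0 + \<i> * of_real t)))\<^sup>2)"
    and "B \<equiv> LINT t|\<mu>1. (\<Sum>i\<in>I. (norm (h i (of_real 1 + \<i> * of_real t)))\<^sup>2)"
  shows "(\<Sum>i\<in>I. (norm (h i (of_real \<theta>)))\<^sup>2) \<le> (if \<theta> = 1 then B else A powr (1 - \<theta>) * B powr \<theta>)"
proof -
  let ?N = "\<Sum>i\<in>I. (norm (h i (of_real \<theta>)))\<^sup>2"
  have nonneg: "0 \<le> A" "0 \<le> B" "0 \<le> ?N"
    unfolding A_def B_def by (auto intro!: integral_nonneg_AE sum_nonneg)
  have scaled: "exp (m * \<theta>) * sqrt ?N \<le> (1 - \<theta>) * sqrt A + \<theta> * exp m * sqrt B" for m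
    unfolding A_def B_def using assms by (intro three_lines_scaled) auto
  show ?thesis
  proof (cases "\<theta> = 1")
    case True
    then show ?thesis using scaled[of 0] by simp
  next
    case False
    have "sqrt ?N \<le> sqrt A powr (1 - \<theta>) * sqrt B powr \<theta>"
      by (rule le_powr_mult_powr_of_scaled) (use False assms(3,4) nonneg scaled in auto)
    then have "(sqrt ?N)\<^sup>2 \<le> (sqrt A powr (1 - \<theta>) * sqrt B powr \<theta>)\<^sup>2"
      using nonneg by (intro power_mono) auto
    also have "\<dots> = (sqrt A powr 2) powr (1 - \<theta>) * (sqrt B powr 2) powr \<theta>"
      by (simp add: power_mult_distrib powr_powr mult.commute flip: powr_numeral powr_realpow')
    also have "\<dots> = A powr (1 - \<theta>) * B powr \<theta>"
      using nonneg by (simp add: powr_numeral)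
    finally show ?thesis using nonneg False by simp
  qed
qed

section \<open>Spectral calculus\<close>

declare assoc_mult_mat[simp del] mult_carrier_mat[simp del]

lemma adjoint_dim[simp]: "dim_row (mat_adjoint A) = dim_col A" "dim_col (mat_adjoint A) = dim_row A"
  by (simp_all add: mat_adjoint_def)

lemma adjoint_carrier[simp]: "A \<in> carrier_mat n m \<Longrightarrow> mat_adjoint A \<in> carrier_mat m n"
  unfolding carrier_mat_def by simp

lemma adjoint_index[simp]:
  "i < dim_col A \<Longrightarrow> j < dim_row A \<Longrightarrow> mat_adjoint A $$ (i, j) = cnj (A $$ (j, i))"
  by (simp add: mat_adjoint_def mat_of_rows_def)

lemma adjoint_adjoint[simp]: "mat_adjoint (mat_adjoint A) = (A :: complex mat)"
  by (rule eq_matI) simp_all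

lemma mult_index_sum:
  assumes "A \<in> carrier_mat n m" "B \<in> carrier_mat m p" "i < n" "j < p"
  shows "(A * B) $$ (i, j) = (\<Sum>k<m. A $$ (i, k) * B $$ (k, j))"
  using assms by (simp add: scalar_prod_def atLeast0LessThan)

lemma adjoint_mult:
  assumes "A \<in> carrier_mat n m" "B \<in> carrier_mat m p"
  shows "mat_adjoint (A * B) = mat_adjoint B * mat_adjoint (A :: complex mat)"
proof (rule eq_matI)
  fix i j assume "i < dim_row (mat_adjoint B * mat_adjoint A)" "j < dim_col (mat_adjoint B * mat_adjoint A)"
  then have ij: "i < p" "j < n" using assms by auto
  have "mat_adjoint (A * B) $$ (i, j) = cnj ((A * B) $$ (j, i))"
    using ij assms by (intro adjoint_index) auto
  also have "\<dots> = (\<Sum>k<m. mat_adjoint B $$ (i, k) * mat_adjoint A $$ (k, j))"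
    using ij assms by (subst mult_index_sum[OF assms ij(2,1)]) (auto intro!: sum.cong)
  also have "\<dots> = (mat_adjoint B * mat_adjoint A) $$ (i, j)"
    using ij assms by (intro mult_index_sum[symmetric]) auto
  finally show "mat_adjoint (A * B) $$ (i, j) = (mat_adjoint B * mat_adjoint A) $$ (i, j)" .
qed (use assms in auto)

lemma adjoint_one[simp]: "mat_adjoint (1\<^sub>m n) = (1\<^sub>m n :: complex mat)"
  by (rule eq_matI) auto

lemma adjoint_diag[simp]: "mat_adjoint (mat_diag n f) = mat_diag n (\<lambda>i. cnj (f i))"
  by (rule eq_matI) (auto simp: mat_diag_def)

lemma adjoint_minus:
  "A \<in> carrier_mat n m \<Longrightarrow> B \<in> carrier_mat n m \<Longrightarrow> mat_adjoint (A - B) = mat_adjoint A - mat_adjoint (B :: complex mat)"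
  by (rule eq_matI) auto

lemma adjoint_add:
  "A \<in> carrier_mat n m \<Longrightarrow> B \<in> carrier_mat n m \<Longrightarrow> mat_adjoint (A + B) = mat_adjoint A + mat_adjoint (B :: complex mat)"
  by (rule eq_matI) auto

lemma adjoint_smult: "mat_adjoint (c \<cdot>\<^sub>m A) = cnj c \<cdot>\<^sub>m mat_adjoint (A :: complex mat)"
  by (rule eq_matI) auto

lemma diag_dims[simp]: "dim_row (mat_diag n f) = n" "dim_col (mat_diag n f) = n"
  by (simp_all add: mat_diag_def)

lemma square_mult_carrier[simp]:
  "A \<in> carrier_mat n n \<Longrightarrow> B \<in> carrier_mat n n \<Longrightarrow> A * B \<in> carrier_mat n n"
  by (rule mult_carrier_mat)

lemma square_assoc:
  "A \<in> carrier_mat n n \<Longrightarrow> B \<in> carrier_mat n n \<Longrightarrow> C \<in> carrier_mat n n \<Longrightarrow> (A * B) * C = A * (B * C)"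
  by (rule assoc_mult_mat)

lemma square_adjoint_mult:
  "A \<in> carrier_mat n n \<Longrightarrow> B \<in> carrier_mat n n \<Longrightarrow> mat_adjoint (A * B) = mat_adjoint B * mat_adjoint (A :: complex mat)"
  by (rule adjoint_mult)

lemma unitary_mat_adjoint:
  assumes "unitary_mat n U"
  shows "U * mat_adjoint U = 1\<^sub>m n"
  using assms mat_mult_left_right_inverse[of "mat_adjoint U" n U] by (auto simp: unitary_mat_def)

lemma unitary_mat_mult:
  assumes "unitary_mat n U" "unitary_mat n V"
  shows "unitary_mat n (U * V)"
proof -
  have c: "U \<in> carrier_mat n n" "V \<in> carrier_mat n n" using assms by (auto simp: unitary_mat_def)
  have "mat_adjoint (U * V) * (U * V) = mat_adjoint V * ((mat_adjoint U * U) * V)"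
    using c by (simp add: square_adjoint_mult[OF c] square_assoc[of _ n])
  also have "\<dots> = 1\<^sub>m n" using assms c by (simp add: unitary_mat_def)
  finally show ?thesis using c by (simp add: unitary_mat_def)
qed

text \<open>Gram-Schmidt keeps the first vector of a basis that starts with \<open>v\<close>, so
  normalising the columns changes \<open>v\<close> only by a scalar. An eigenvector can thus be made
  the first column of a unitary.\<close>

lemma unitary_mat_extending:
  assumes v: "v \<in> carrier_vec n" "v \<noteq> 0\<^sub>v n"
  obtains U c where "unitary_mat n U" "col U 0 = c \<cdot>\<^sub>v v" "c \<noteq> (0::complex)"
proof -
  interpret cof_vec_space n "TYPE(complex)" .
  define b where "b = basis_completion v"
  from basis_completion[OF v, folded b_def]
  have dist_b: "distinct b" and indep: "\<not> lin_dep (set b)" and b: "set b \<subseteq> carrier_vec n"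
    and hdb: "hd b = v" and len_b: "length b = n" by auto
  have n: "0 < n" using v by (cases n) auto
  from hdb len_b n obtain vs where bv: "b = v # vs" by (cases b) auto
  define ws where "ws = gram_schmidt n b"
  from gram_schmidt_result[OF b dist_b indep refl, folded ws_def]
  have ws: "set ws \<subseteq> carrier_vec n" "corthogonal ws" "length ws = n" by (auto simp: len_b)
  from gram_schmidt_hd[OF v(1), of vs, folded bv] have hdws: "hd ws = v" unfolding ws_def .
  have ws_i: "ws ! i \<in> carrier_vec n" if "i < n" for i using ws that by auto
  have orth: "(ws ! i \<bullet>c ws ! j = 0) \<longleftrightarrow> i \<noteq> j" if "i < n" "j < n" for i j
    using corthogonalD[OF ws(2)] that ws(3) by auto
  define l where "l = (\<lambda>i. sqrt (Re (ws ! i \<bullet>c ws ! i)))"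
  have l_sq: "complex_of_real (l i) * of_real (l i) = ws ! i \<bullet>c ws ! i" and l_nz: "l i \<noteq> 0" if "i < n" for i
  proof -
    have "0 \<le> ws ! i \<bullet>c ws ! i" using conjugate_square_ge_0_vec by blast
    then have ge: "0 \<le> Re (ws ! i \<bullet>c ws ! i)" and im: "Im (ws ! i \<bullet>c ws ! i) = 0"
      by (auto simp: less_eq_complex_def)
    then show "complex_of_real (l i) * of_real (l i) = ws ! i \<bullet>c ws ! i"
      by (simp add: l_def complex_eq_iff flip: of_real_mult)
    then show "l i \<noteq> 0" using orth[OF that that] by auto
  qed
  define U where "U = mat n n (\<lambda>(i, j). (ws ! j) $ i / of_real (l j))"
  have U: "U \<in> carrier_mat n n" by (simp add: U_def)
  have "mat_adjoint U * U = 1\<^sub>m n"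
  proof (rule eq_matI)
    fix i j assume "i < dim_row (1\<^sub>m n)" "j < dim_col (1\<^sub>m n)"
    then have ij: "i < n" "j < n" by auto
    have "(mat_adjoint U * U) $$ (i, j) = (\<Sum>k<n. mat_adjoint U $$ (i, k) * U $$ (k, j))"
      by (rule mult_index_sum) (use U ij in auto)
    also have "\<dots> = (\<Sum>k<n. (ws ! j) $ k * cnj ((ws ! i) $ k)) / (of_real (l i) * of_real (l j))"
      unfolding sum_divide_distrib using ij by (intro sum.cong) (auto simp: U_def)
    also have "(\<Sum>k<n. (ws ! j) $ k * cnj ((ws ! i) $ k)) = ws ! j \<bullet>c ws ! i"
      using ws_i[OF ij(1)] ws_i[OF ij(2)] by (simp add: scalar_prod_def atLeast0LessThan)
    finally have eq: "(mat_adjoint U * U) $$ (i, j) = (ws ! j \<bullet>c ws ! i) / (of_real (l i) * of_real (l j))" .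
    show "(mat_adjoint U * U) $$ (i, j) = 1\<^sub>m n $$ (i, j)"
    proof (cases "i = j")
      case True
      then show ?thesis
        using l_nz[OF ij(1)] ij unfolding eq unfolding True[symmetric] l_sq[OF ij(1), symmetric] by simp
    next
      case False
      then have "ws ! j \<bullet>c ws ! i = 0" using orth[OF ij(2,1)] by simp
      then show ?thesis using False ij unfolding eq by simp
    qed
  qed (use U in auto)
  moreover have "col U 0 = (1 / of_real (l 0)) \<cdot>\<^sub>v v"
  proof -
    have "ws ! 0 = v" using hdws hd_conv_nth[of ws] n ws(3) by auto
    then show ?thesis using n v(1) by (intro eq_vecI) (auto simp: U_def)
  qed
  moreover have "1 / complex_of_real (l 0) \<noteq> 0" using l_nz[OF n] by simp
  ultimately show ?thesis using that U unfolding unitary_mat_def by blast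
qed

section \<open>Spectral theorem and functional calculus\<close>

definition spectral_mat :: "nat \<Rightarrow> complex mat \<Rightarrow> (nat \<Rightarrow> complex) \<Rightarrow> complex mat" where
  "spectral_mat n U f = U * mat_diag n f * mat_adjoint U"

lemma spectral_mat_carrier[simp]: "U \<in> carrier_mat n n \<Longrightarrow> spectral_mat n U f \<in> carrier_mat n n"
  by (simp add: spectral_mat_def)

lemma spectral_mat_mult:
  assumes "unitary_mat n U"
  shows "spectral_mat n U f * spectral_mat n U g = spectral_mat n U (\<lambda>i. f i * g i)"
proof -
  have c: "U \<in> carrier_mat n n" using assms by (simp add: unitary_mat_def)
  have "spectral_mat n U f * spectral_mat n U g
    = U * (mat_diag n f * ((mat_adjoint U * U) * (mat_diag n g * mat_adjoint U)))"
    unfolding spectral_mat_def using c by (simp add: square_assoc[of _ n])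
  also have "\<dots> = U * ((mat_diag n f * mat_diag n g) * mat_adjoint U)"
    using c assms by (simp add: unitary_mat_def square_assoc[of _ n] del: mat_diag_diag)
  also have "\<dots> = spectral_mat n U (\<lambda>i. f i * g i)"
    unfolding spectral_mat_def using c by (simp add: square_assoc[of _ n])
  finally show ?thesis .
qed

lemma spectral_mat_adjoint:
  assumes "U \<in> carrier_mat n n"
  shows "mat_adjoint (spectral_mat n U f) = spectral_mat n U (\<lambda>i. cnj (f i))"
  using assms by (simp add: spectral_mat_def square_adjoint_mult[of _ n] square_assoc[of _ n])

lemma spectral_mat_index:
  assumes "U \<in> carrier_mat n n" "i < n" "j < n"
  shows "spectral_mat n U f $$ (i, j) = (\<Sum>k<n. U $$ (i, k) * f k * cnj (U $$ (j, k)))"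
proof -
  have "spectral_mat n U f $$ (i, j) = (\<Sum>k<n. (U * mat_diag n f) $$ (i, k) * mat_adjoint U $$ (k, j))"
    unfolding spectral_mat_def by (rule mult_index_sum) (use assms in auto)
  also have "\<dots> = (\<Sum>k<n. U $$ (i, k) * f k * cnj (U $$ (j, k)))"
    using assms by (intro sum.cong) (auto simp: mat_diag_mult_right[of _ n])
  finally show ?thesis .
qed

lemma mult_block_diag:
  fixes a b P Q :: "'a :: comm_ring_1 mat"
  assumes a: "a \<in> carrier_mat 1 1" and b: "b \<in> carrier_mat 1 1"
    and P: "P \<in> carrier_mat n n" and Q: "Q \<in> carrier_mat n n"
  shows "four_block_mat a (0\<^sub>m 1 n) (0\<^sub>m n 1) P * four_block_mat b (0\<^sub>m 1 n) (0\<^sub>m n 1) Q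
    = four_block_mat (a * b) (0\<^sub>m 1 n) (0\<^sub>m n 1) (P * Q)"
  unfolding mult_four_block_mat[OF a zero_carrier_mat zero_carrier_mat P b zero_carrier_mat zero_carrier_mat Q]
  using assms by (intro cong_four_block_mat) (auto simp: left_add_zero_mat[of _ n n] right_add_zero_mat[of _ 1 1])

text \<open>Deflation: in a unitary basis that starts with an eigenvector the first column is zero
  below the diagonal, self-adjointness clears the first row as well, and the remaining block is
  self-adjoint of smaller size. Eigenvalues are left complex here; \<open>psd_mat_spectral\<close>
  shows that they are real and nonnegative in the case of interest.\<close>

lemma hermitian_spectral:
  assumes "A \<in> carrier_mat n n" "mat_adjoint A = (A :: complex mat)"
  shows "\<exists>U (d :: nat \<Rightarrow> complex). unitary_mat n U \<and> A = spectral_mat n U d"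
  using assms
proof (induction n arbitrary: A)
  case 0
  then show ?case by (intro exI[of _ "1\<^sub>m 0"] exI) (auto simp: unitary_mat_def spectral_mat_def intro!: eq_matI)
next
  case (Suc n)
  let ?N = "Suc n"
  obtain e where "e \<in> spectrum A" using spectrum_non_empty[OF Suc.prems(1)] by auto
  then have "eigenvalue A e" by (simp add: spectrum_def)
  then obtain v where v: "v \<in> carrier_vec ?N" "v \<noteq> 0\<^sub>v ?N" "A *\<^sub>v v = e \<cdot>\<^sub>v v"
    using Suc.prems(1) by (auto simp: eigenvalue_def eigenvector_def)
  obtain U c where U: "unitary_mat ?N U" "col U 0 = c \<cdot>\<^sub>v v" "c \<noteq> 0"
    using unitary_mat_extending[OF v(1,2)] .
  have Uc: "U \<in> carrier_mat ?N ?N" and UU: "mat_adjoint U * U = 1\<^sub>m ?N" using U(1) by (auto simp: unitary_mat_def)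
  note UU' = unitary_mat_adjoint[OF U(1)]
  note Ac = Suc.prems(1)
  define A' where "A' = mat_adjoint U * (A * U)"
  have A'c: "A' \<in> carrier_mat ?N ?N" using Uc Ac by (simp add: A'_def)
  have A'h: "mat_adjoint A' = A'"
    using Uc Ac Suc.prems(2) by (simp add: A'_def square_adjoint_mult[of _ ?N] square_assoc[of _ ?N])
  have A: "A = U * (A' * mat_adjoint U)"
  proof -
    have "U * (A' * mat_adjoint U) = (U * mat_adjoint U) * (A * (U * mat_adjoint U))"
      unfolding A'_def using Uc Ac by (simp add: square_assoc[of _ ?N])
    then show ?thesis using UU' Ac by simp
  qed
  have col0: "A' $$ (i, 0) = (if i = 0 then e else 0)" if "i < ?N" for i
  proof -
    have "col A' 0 = mat_adjoint U *\<^sub>v col (A * U) 0"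
      unfolding A'_def by (rule col_mult2[of _ ?N ?N _ ?N]) (use Uc Ac in auto)
    also have "col (A * U) 0 = A *\<^sub>v col U 0"
      by (rule col_mult2[of _ ?N ?N _ ?N]) (use Uc Ac in auto)
    also have "\<dots> = c \<cdot>\<^sub>v (e \<cdot>\<^sub>v v)"
      unfolding U(2) v(3)[symmetric] by (rule mult_mat_vec[OF Ac v(1)])
    also have "\<dots> = e \<cdot>\<^sub>v col U 0" unfolding U(2) by (simp add: smult_smult_assoc mult.commute)
    also have "mat_adjoint U *\<^sub>v (e \<cdot>\<^sub>v col U 0) = e \<cdot>\<^sub>v (mat_adjoint U *\<^sub>v col U 0)"
      by (rule mult_mat_vec[of _ ?N ?N]) (use Uc U(2) v(1) in auto)
    also have "mat_adjoint U *\<^sub>v col U 0 = col (mat_adjoint U * U) 0"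
      by (rule col_mult2[of _ ?N ?N _ ?N, symmetric]) (use Uc in auto)
    finally have "col A' 0 = e \<cdot>\<^sub>v unit_vec ?N 0" unfolding UU by simp
    then have "col A' 0 $ i = (e \<cdot>\<^sub>v unit_vec ?N 0) $ i" by simp
    then show ?thesis using A'c that by (auto simp: unit_vec_def)
  qed
  have row0: "A' $$ (0, j) = (if j = 0 then cnj e else 0)" if "j < ?N" for j
  proof -
    have "A' $$ (0, j) = mat_adjoint A' $$ (0, j)" by (simp only: A'h)
    also have "\<dots> = cnj (A' $$ (j, 0))" using A'c that by simp
    finally show ?thesis using col0[OF that] by simp
  qed
  define B where "B = mat n n (\<lambda>(i, j). A' $$ (Suc i, Suc j))"
  have "mat_adjoint B = B"
  proof (rule eq_matI)
    fix i j assume "i < dim_row B" "j < dim_col B"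
    then have ij: "i < n" "j < n" by (auto simp: B_def)
    have "A' $$ (Suc i, Suc j) = mat_adjoint A' $$ (Suc i, Suc j)" by (simp only: A'h)
    then show "mat_adjoint B $$ (i, j) = B $$ (i, j)" using ij A'c by (simp add: B_def)
  qed (auto simp: B_def)
  moreover have Bc: "B \<in> carrier_mat n n" by (simp add: B_def)
  ultimately obtain V d where V: "unitary_mat n V" "B = spectral_mat n V d" using Suc.IH by blast
  have Vc: "V \<in> carrier_mat n n" and VV: "mat_adjoint V * V = 1\<^sub>m n" using V(1) by (auto simp: unitary_mat_def)
  define V' where "V' = four_block_mat (1\<^sub>m 1) (0\<^sub>m 1 n) (0\<^sub>m n 1) V"
  define D where "D = (\<lambda>i. case i of 0 \<Rightarrow> e | Suc i \<Rightarrow> d i)"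
  have V'c: "V' \<in> carrier_mat ?N ?N" using Vc by (auto simp: V'_def)
  have V'adj: "mat_adjoint V' = four_block_mat (1\<^sub>m 1) (0\<^sub>m 1 n) (0\<^sub>m n 1) (mat_adjoint V)"
    using Vc by (intro eq_matI) (auto simp: V'_def)
  have D: "mat_diag ?N D = four_block_mat (e \<cdot>\<^sub>m 1\<^sub>m 1) (0\<^sub>m 1 n) (0\<^sub>m n 1) (mat_diag n d)"
    by (intro eq_matI) (auto simp: D_def mat_diag_def split: nat.split)
  have "mat_adjoint V' * V' = 1\<^sub>m ?N"
    unfolding V'adj unfolding V'_def
    by (simp only: mult_block_diag[OF one_carrier_mat one_carrier_mat adjoint_carrier[OF Vc] Vc] VV)
       (simp only: left_mult_one_mat[OF one_carrier_mat] four_block_one_mat plus_1_eq_Suc)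
  then have V'u: "unitary_mat ?N V'" using V'c by (simp add: unitary_mat_def)
  have "A' = four_block_mat (e \<cdot>\<^sub>m 1\<^sub>m 1) (0\<^sub>m 1 n) (0\<^sub>m n 1) B"
    using A'c col0 row0 Bc col0[of 0] row0[of 0] by (intro eq_matI) (auto simp: B_def)
  also have "\<dots> = spectral_mat ?N V' D"
  proof -
    have e1: "e \<cdot>\<^sub>m 1\<^sub>m 1 \<in> carrier_mat 1 1" by simp
    have "V' * mat_diag ?N D = four_block_mat (e \<cdot>\<^sub>m 1\<^sub>m 1) (0\<^sub>m 1 n) (0\<^sub>m n 1) (V * mat_diag n d)"
      unfolding D V'_def mult_block_diag[OF one_carrier_mat e1 Vc mat_diag_dim] left_mult_one_mat[OF e1] ..
    then have "V' * mat_diag ?N D * mat_adjoint V' = four_block_mat (e \<cdot>\<^sub>m 1\<^sub>m 1) (0\<^sub>m 1 n) (0\<^sub>m n 1) (V * mat_diag n d * mat_adjoint V)"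
      unfolding V'adj
      by (simp only: mult_block_diag[OF e1 one_carrier_mat square_mult_carrier[OF Vc mat_diag_dim] adjoint_carrier[OF Vc]] right_mult_one_mat[OF e1])
    then show ?thesis unfolding spectral_mat_def V(2) ..
  qed
  finally have "A = U * (spectral_mat ?N V' D * mat_adjoint U)" using A by simp
  also have "\<dots> = spectral_mat ?N (U * V') D"
    unfolding spectral_mat_def using Uc V'c
    by (simp add: square_adjoint_mult[of _ ?N] square_assoc[of _ ?N])
  finally show ?case using unitary_mat_mult[OF U(1) V'u] by blast
qed

text \<open>\<open>W = mat_adjoint V * U\<close> intertwines the two diagonal matrices, so its entry
  at (i, j) can be nonzero only if \<open>d j = e i\<close>. Then it also intertwines their images
  under \<open>g\<close>. This provides the uniqueness behind the \<open>THE\<close> in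
  \<open>mat_powr\<close>.\<close>

lemma spectral_mat_fun_unique:
  assumes U: "unitary_mat n U" and V: "unitary_mat n V"
    and eq: "spectral_mat n U d = spectral_mat n V e"
  shows "spectral_mat n U (\<lambda>i. g (d i)) = spectral_mat n V (\<lambda>i. g (e i))"
proof -
  have c: "U \<in> carrier_mat n n" "V \<in> carrier_mat n n" and UU: "mat_adjoint U * U = 1\<^sub>m n" and VV: "mat_adjoint V * V = 1\<^sub>m n"
    using U V by (auto simp: unitary_mat_def)
  note UU' = unitary_mat_adjoint[OF U] and VV' = unitary_mat_adjoint[OF V]
  define W where "W = mat_adjoint V * U"
  have Wc: "W \<in> carrier_mat n n" using c by (simp add: W_def)
  have "W * mat_diag n d = mat_adjoint V * (spectral_mat n U d * U)"
    unfolding W_def spectral_mat_def using c UU by (simp add: square_assoc[of _ n])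
  also have "\<dots> = mat_adjoint V * (spectral_mat n V e * U)" by (simp only: eq)
  also have "\<dots> = (mat_adjoint V * V) * (mat_diag n e * W)"
    unfolding W_def spectral_mat_def using c by (simp add: square_assoc[of _ n])
  also have "\<dots> = mat_diag n e * W" unfolding VV using Wc by simp
  finally have eqW: "W * mat_diag n d = mat_diag n e * W" .
  have "W * mat_diag n (\<lambda>i. g (d i)) = mat_diag n (\<lambda>i. g (e i)) * W"
  proof (rule eq_matI)
    fix i j assume "i < dim_row (mat_diag n (\<lambda>i. g (e i)) * W)" "j < dim_col (mat_diag n (\<lambda>i. g (e i)) * W)"
    then have ij: "i < n" "j < n" using Wc by auto
    have "(W * mat_diag n d) $$ (i, j) = (mat_diag n e * W) $$ (i, j)" by (simp only: eqW)
    then have "W $$ (i, j) * d j = e i * W $$ (i, j)"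
      using ij by (simp add: mat_diag_mult_left[OF Wc] mat_diag_mult_right[OF Wc] del: index_mult_mat)
    then have "W $$ (i, j) = 0 \<or> d j = e i" by auto
    then show "(W * mat_diag n (\<lambda>i. g (d i))) $$ (i, j) = (mat_diag n (\<lambda>i. g (e i)) * W) $$ (i, j)"
      using ij by (auto simp: mat_diag_mult_left[OF Wc] mat_diag_mult_right[OF Wc] simp del: index_mult_mat)
  qed (use Wc in auto)
  then have "V * ((W * mat_diag n (\<lambda>i. g (d i))) * mat_adjoint U) = V * ((mat_diag n (\<lambda>i. g (e i)) * W) * mat_adjoint U)"
    by simp
  moreover have "V * ((W * mat_diag n (\<lambda>i. g (d i))) * mat_adjoint U) = (V * mat_adjoint V) * spectral_mat n U (\<lambda>i. g (d i))"
    unfolding W_def spectral_mat_def using c by (simp add: square_assoc[of _ n])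
  moreover have "V * ((mat_diag n (\<lambda>i. g (e i)) * W) * mat_adjoint U) = spectral_mat n V (\<lambda>i. g (e i))"
    unfolding W_def spectral_mat_def using c UU' by (simp add: square_assoc[of _ n])
  ultimately show ?thesis unfolding VV' using c by (simp add: left_mult_one_mat[of _ n n])
qed

section \<open>Positive semidefinite matrices and their complex powers\<close>

lemma form_adjoint:
  assumes "A \<in> carrier_mat n n" "v \<in> carrier_vec n" "w \<in> carrier_vec n"
  shows "(A *\<^sub>v v) \<bullet>c w = v \<bullet>c (mat_adjoint A *\<^sub>v (w :: complex vec))"
proof -
  have "(A *\<^sub>v v) \<bullet>c w = (\<Sum>i<n. \<Sum>j<n. A $$ (i, j) * v $ j * cnj (w $ i))"
    using assms by (simp add: scalar_prod_def atLeast0LessThan sum_distrib_right)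
  also have "\<dots> = (\<Sum>j<n. \<Sum>i<n. A $$ (i, j) * v $ j * cnj (w $ i))"
    by (rule sum.swap)
  also have "\<dots> = v \<bullet>c (mat_adjoint A *\<^sub>v w)"
    using assms by (simp add: scalar_prod_def atLeast0LessThan sum_distrib_left mult_ac)
  finally show ?thesis .
qed

lemma psd_mat_carrier: "psd_mat n A \<Longrightarrow> A \<in> carrier_mat n n"
  by (simp add: psd_mat_def)

lemma psd_mat_adjoint: "psd_mat n A \<Longrightarrow> mat_adjoint A = A"
  by (simp add: psd_mat_def)

lemma psd_mat_mult_adjoint:
  assumes "B \<in> carrier_mat n n"
  shows "psd_mat n (B * mat_adjoint B)"
proof -
  have "0 \<le> Re ((B * mat_adjoint B *\<^sub>v v) \<bullet>c v)" if v: "v \<in> carrier_vec n" for v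
  proof -
    have w: "mat_adjoint B *\<^sub>v v \<in> carrier_vec n" using assms v by (intro mult_mat_vec_carrier) auto
    have "B * mat_adjoint B *\<^sub>v v = B *\<^sub>v (mat_adjoint B *\<^sub>v v)"
      by (rule assoc_mult_mat_vec[of _ n n _ n]) (use assms v in auto)
    then have "(B * mat_adjoint B *\<^sub>v v) \<bullet>c v = (mat_adjoint B *\<^sub>v v) \<bullet>c (mat_adjoint B *\<^sub>v v)"
      using form_adjoint[OF assms w v] by simp
    also have "\<dots> \<ge> 0" by (rule conjugate_square_ge_0_vec)
    finally show ?thesis by (simp add: less_eq_complex_def)
  qed
  then show ?thesis using assms by (simp add: psd_mat_def square_adjoint_mult[of _ n])
qed

lemma psd_mat_spectral:
  assumes A: "psd_mat n A"
  obtains U d where "unitary_mat n U" "A = spectral_mat n U (\<lambda>i. complex_of_real (d i))" "\<And>i. 0 \<le> d i"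
proof -
  have Ac: "A \<in> carrier_mat n n" by (rule psd_mat_carrier[OF A])
  obtain U e where U: "unitary_mat n U" and e: "A = spectral_mat n U e"
    using hermitian_spectral[OF Ac psd_mat_adjoint[OF A]] by blast
  have c: "U \<in> carrier_mat n n" and UU: "mat_adjoint U * U = 1\<^sub>m n" using U by (auto simp: unitary_mat_def)
  define D where "D = mat_adjoint U * (A * U)"
  have "D = (mat_adjoint U * U) * (mat_diag n e * (mat_adjoint U * U))"
    unfolding D_def e spectral_mat_def using c by (simp add: square_assoc[of _ n])
  then have D: "D = mat_diag n e" by (simp add: UU right_mult_one_mat[of _ n n] left_mult_one_mat[of _ n n])
  have Dh: "mat_adjoint D = D"
    unfolding D_def using c Ac psd_mat_adjoint[OF A] by (simp add: square_adjoint_mult[of _ n] square_assoc[of _ n])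
  have e_nonneg: "e i = of_real (Re (e i)) \<and> 0 \<le> Re (e i)" if i: "i < n" for i
  proof
    have "mat_adjoint D $$ (i, i) = D $$ (i, i)" by (simp only: Dh)
    then have "cnj (e i) = e i" using i unfolding D adjoint_diag by (simp add: mat_diag_def)
    then show "e i = of_real (Re (e i))" by (simp add: complex_eq_iff)
    have ui: "col U i \<in> carrier_vec n" using c by (rule col_carrier_vec[OF i])
    have "e i = D $$ (i, i)" using i by (simp add: D mat_diag_def)
    also have "\<dots> = row (mat_adjoint U) i \<bullet> col (A * U) i"
      unfolding D_def using c Ac i by simp
    also have "row (mat_adjoint U) i = conjugate (col U i)"
      using c i by (intro eq_vecI) auto
    also have "col (A * U) i = A *\<^sub>v col U i"
      by (rule col_mult2[OF Ac c i])
    also have "conjugate (col U i) \<bullet> (A *\<^sub>v col U i) = (A *\<^sub>v col U i) \<bullet>c col U i"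
      by (rule comm_scalar_prod[of _ n]) (use ui Ac in auto)
    finally show "0 \<le> Re (e i)" using A ui by (simp add: psd_mat_def)
  qed
  \<comment> \<open>Indices from \<open>n\<close> on do not occur in the matrix; the value 0 makes
    nonnegativity hold without a bound on the index.\<close>
  define d where "d = (\<lambda>i. if i < n then Re (e i) else 0)"
  have "mat_diag n e = mat_diag n (\<lambda>i. complex_of_real (d i))"
    using e_nonneg by (intro eq_matI) (auto simp: mat_diag_def d_def)
  then have "A = spectral_mat n U (\<lambda>i. complex_of_real (d i))" by (simp add: e spectral_mat_def)
  moreover have "0 \<le> d i" for i using e_nonneg by (simp add: d_def)
  ultimately show ?thesis using that U by blast
qed

text \<open>Complex exponents are what makes the interpolating family possible. Since
  \<open>0 powr z = 0\<close>, powers live on the support: exponent 0 gives the support projection,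
  and exponents add up without exception, opposite ones giving that projection. The selected
  decomposition does not depend on \<open>z\<close>, so all powers of \<open>A\<close> are diagonal
  in the same basis.\<close>

definition mat_cpow :: "complex mat \<Rightarrow> complex \<Rightarrow> complex mat" where
  "mat_cpow A z = (let (U, d) = (SOME (U, d :: nat \<Rightarrow> real). unitary_mat (dim_row A) U \<and>
     A = spectral_mat (dim_row A) U (\<lambda>i. of_real (d i)) \<and> (\<forall>i. 0 \<le> d i))
     in spectral_mat (dim_row A) U (\<lambda>i. of_real (d i) powr z))"

lemma mat_cpow_spectral:
  assumes "psd_mat n A"
  obtains U d where "unitary_mat n U" "A = spectral_mat n U (\<lambda>i. complex_of_real (d i))" "\<forall>i. 0 \<le> d i"
    "\<forall>z. mat_cpow A z = spectral_mat n U (\<lambda>i. of_real (d i) powr z)"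
proof -
  let ?P = "\<lambda>(U, d :: nat \<Rightarrow> real). unitary_mat n U \<and> A = spectral_mat n U (\<lambda>i. of_real (d i)) \<and> (\<forall>i. 0 \<le> d i)"
  have n: "dim_row A = n" using psd_mat_carrier[OF assms] by auto
  obtain U0 d0 where "unitary_mat n U0" "A = spectral_mat n U0 (\<lambda>i. complex_of_real (d0 i))" "\<forall>i. 0 \<le> d0 i"
    by (rule psd_mat_spectral[OF assms]) blast
  then have "?P (U0, d0)" by simp
  then have P: "?P (SOME p. ?P p)" by (rule someI)
  obtain U d where p: "(SOME p. ?P p) = (U, d)" by (rule prod.exhaust)
  have "mat_cpow A z = spectral_mat n U (\<lambda>i. of_real (d i) powr z)" for z
    unfolding mat_cpow_def n p by simp
  then show ?thesis using that P unfolding p by blast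
qed

lemma mat_cpow_carrier[simp]:
  assumes "psd_mat n A" shows "mat_cpow A z \<in> carrier_mat n n"
proof -
  obtain U d where "unitary_mat n U" "\<forall>z. mat_cpow A z = spectral_mat n U (\<lambda>i. complex_of_real (d i) powr z)"
    by (rule mat_cpow_spectral[OF assms]) blast
  then show ?thesis by (simp add: unitary_mat_def)
qed

lemma mat_cpow_add:
  assumes "psd_mat n A" shows "mat_cpow A u * mat_cpow A v = mat_cpow A (u + v)"
proof -
  obtain U d where U: "unitary_mat n U" "\<forall>z. mat_cpow A z = spectral_mat n U (\<lambda>i. complex_of_real (d i) powr z)"
    by (rule mat_cpow_spectral[OF assms]) blast
  show ?thesis unfolding U(2)[rule_format] spectral_mat_mult[OF U(1)] by (simp only: powr_add)
qed

lemma mat_cpow_adjoint: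
  assumes "psd_mat n A" shows "mat_adjoint (mat_cpow A z) = mat_cpow A (cnj z)"
proof -
  obtain U d where U: "unitary_mat n U" "\<forall>i. 0 \<le> d i" "\<forall>z. mat_cpow A z = spectral_mat n U (\<lambda>i. complex_of_real (d i) powr z)"
    by (rule mat_cpow_spectral[OF assms]) blast
  have "cnj (complex_of_real x powr z) = complex_of_real x powr cnj z" if "0 \<le> x" for x
    using that by (simp add: cnj_powr)
  then show ?thesis using U by (simp add: spectral_mat_adjoint unitary_mat_def)
qed

lemma mat_cpow_one:
  assumes "psd_mat n A" shows "mat_cpow A 1 = A"
proof -
  obtain U d where U: "A = spectral_mat n U (\<lambda>i. complex_of_real (d i))" "\<forall>z. mat_cpow A z = spectral_mat n U (\<lambda>i. complex_of_real (d i) powr z)"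
    by (rule mat_cpow_spectral[OF assms]) blast
  have "complex_of_real x powr 1 = of_real x" for x
    by (cases "x = 0") (auto simp: powr_def)
  then show ?thesis using U by simp
qed

lemma mat_powr_spectral:
  assumes U: "unitary_mat n U" and A: "A = spectral_mat n U (\<lambda>i. complex_of_real (d i))"
  shows "mat_powr A s = spectral_mat n U (\<lambda>i. complex_of_real (d i powr s))"
proof -
  have n: "dim_row A = n" using A U by (auto simp: spectral_mat_def unitary_mat_def)
  have "(\<exists>V e. unitary_mat n V \<and> A = spectral_mat n V (\<lambda>i. complex_of_real (e i)) \<and>
    B = spectral_mat n V (\<lambda>i. complex_of_real (e i powr s))) \<longleftrightarrow> B = spectral_mat n U (\<lambda>i. complex_of_real (d i powr s))" for B
  proof
    assume "\<exists>V e. unitary_mat n V \<and> A = spectral_mat n V (\<lambda>i. complex_of_real (e i)) \<and>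
    B = spectral_mat n V (\<lambda>i. complex_of_real (e i powr s))"
    then obtain V e where V: "unitary_mat n V" "A = spectral_mat n V (\<lambda>i. complex_of_real (e i))"
      "B = spectral_mat n V (\<lambda>i. complex_of_real (e i powr s))" by blast
    show "B = spectral_mat n U (\<lambda>i. complex_of_real (d i powr s))"
      using spectral_mat_fun_unique[OF V(1) U, of "\<lambda>i. complex_of_real (e i)" "\<lambda>i. complex_of_real (d i)" "\<lambda>x. complex_of_real (Re x powr s)"] V(2) A unfolding V(3) by simp
  qed (use U A in blast)
  then show ?thesis unfolding mat_powr_def n by (simp add: spectral_mat_def)
qed

lemma mat_powr_eq_cpow:
  assumes "psd_mat n A" shows "mat_powr A s = mat_cpow A (of_real s)"
proof -
  obtain U d where U: "unitary_mat n U" "A = spectral_mat n U (\<lambda>i. complex_of_real (d i))" "\<forall>i. 0 \<le> d i"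
    "\<forall>z. mat_cpow A z = spectral_mat n U (\<lambda>i. complex_of_real (d i) powr z)"
    by (rule mat_cpow_spectral[OF assms])
  show ?thesis unfolding mat_powr_spectral[OF U(1,2)] U(4)[rule_format] using U(3) by (simp add: powr_of_real)
qed

lemma psd_mat_cpow:
  assumes "psd_mat n A" shows "psd_mat n (mat_cpow A (of_real s))"
proof -
  have c: "mat_cpow A (of_real (s / 2)) \<in> carrier_mat n n" by (rule mat_cpow_carrier[OF assms])
  have "mat_cpow A (of_real s) = mat_cpow A (of_real (s / 2)) * mat_adjoint (mat_cpow A (of_real (s / 2)))"
    unfolding mat_cpow_adjoint[OF assms] mat_cpow_add[OF assms] complex_cnj_complex_of_real of_real_add[symmetric]
    by simp
  then show ?thesis using psd_mat_mult_adjoint[OF c] by (simp only:)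
qed

section \<open>Positive semidefinite matrices, traces and tensoring with the identity\<close>

lemma psd_mat_factor:
  assumes "psd_mat n A" obtains B where "B \<in> carrier_mat n n" "A = B * mat_adjoint B"
proof
  show "mat_cpow A (of_real (1/2)) \<in> carrier_mat n n" by (rule mat_cpow_carrier[OF assms])
  show "A = mat_cpow A (of_real (1/2)) * mat_adjoint (mat_cpow A (of_real (1/2)))"
  proof -
    have "of_real (1/2) + of_real (1/2) = (1 :: complex)" by simp
    then show ?thesis
      unfolding mat_cpow_adjoint[OF assms] mat_cpow_add[OF assms] complex_cnj_complex_of_real
      by (simp only: mat_cpow_one[OF assms])
  qed
qed

lemma psd_mat_congruence:
  assumes "psd_mat n A" "C \<in> carrier_mat n n" shows "psd_mat n (C * A * mat_adjoint C)"
proof -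
  obtain B where B: "B \<in> carrier_mat n n" "A = B * mat_adjoint B" by (rule psd_mat_factor[OF assms(1)])
  have "C * A * mat_adjoint C = (C * B) * mat_adjoint (C * B)"
    using B assms(2) by (simp add: square_adjoint_mult[of _ n] square_assoc[of _ n])
  then show ?thesis using psd_mat_mult_adjoint[of "C * B" n] B assms(2) by simp
qed

lemma psd_mat_add:
  assumes "psd_mat n A" "psd_mat n B" shows "psd_mat n (A + B)"
proof -
  have c: "A \<in> carrier_mat n n" "B \<in> carrier_mat n n" using assms by (auto intro: psd_mat_carrier)
  have "((A + B) *\<^sub>v v) \<bullet>c v = (A *\<^sub>v v) \<bullet>c v + (B *\<^sub>v v) \<bullet>c v" if "v \<in> carrier_vec n" for v
    using c that by (simp add: add_mult_distrib_mat_vec[of _ n n] add_scalar_prod_distrib[of _ n])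
  then show ?thesis using assms c by (simp add: psd_mat_def adjoint_add[of _ n n])
qed

lemma psd_mat_smult:
  assumes "psd_mat n A" "0 \<le> c" shows "psd_mat n (complex_of_real c \<cdot>\<^sub>m A)"
proof -
  have A: "A \<in> carrier_mat n n" by (rule psd_mat_carrier[OF assms(1)])
  have "((complex_of_real c \<cdot>\<^sub>m A) *\<^sub>v v) \<bullet>c v = of_real c * ((A *\<^sub>v v) \<bullet>c v)" if v: "v \<in> carrier_vec n" for v
  proof -
    have "(complex_of_real c \<cdot>\<^sub>m A) *\<^sub>v v = of_real c \<cdot>\<^sub>v (A *\<^sub>v v)"
      using A v by (intro eq_vecI) auto
    then show ?thesis
      by (simp only: smult_scalar_prod_distrib[OF mult_mat_vec_carrier[OF A v] carrier_vec_conjugate[OF v]])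
  qed
  then show ?thesis using assms A by (simp add: psd_mat_def adjoint_smult)
qed

lemma psd_mat_diag:
  assumes "\<And>i. i < n \<Longrightarrow> 0 \<le> f i" shows "psd_mat n (mat_diag n (\<lambda>i. complex_of_real (f i)))"
proof -
  have "mat_diag n (\<lambda>i. complex_of_real (f i)) = mat_diag n (\<lambda>i. complex_of_real (sqrt (f i))) * mat_adjoint (mat_diag n (\<lambda>i. complex_of_real (sqrt (f i))))"
    using assms by (simp flip: of_real_mult) (rule eq_matI, auto simp: mat_diag_def)
  then show ?thesis using psd_mat_mult_adjoint[of "mat_diag n (\<lambda>i. complex_of_real (sqrt (f i)))" n] by simp
qed

section \<open>Traces\<close>

lemma trace_mult_sum:
  assumes "A \<in> carrier_mat n n" "B \<in> carrier_mat n n"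
  shows "mat_trace (A * B) = (\<Sum>i<n. \<Sum>j<n. A $$ (i, j) * B $$ (j, i))"
  using assms unfolding mat_trace_def by (auto intro!: sum.cong simp: scalar_prod_def atLeast0LessThan)

lemma trace_comm:
  assumes "A \<in> carrier_mat n n" "B \<in> carrier_mat n n"
  shows "mat_trace (A * B) = mat_trace (B * A)"
  unfolding trace_mult_sum[OF assms] trace_mult_sum[OF assms(2,1)] by (subst sum.swap) (simp add: mult.commute)

lemma trace_minus: "A \<in> carrier_mat n n \<Longrightarrow> B \<in> carrier_mat n n \<Longrightarrow> mat_trace (A - B) = mat_trace A - mat_trace B"
  by (auto simp: mat_trace_def sum_subtractf)

lemma trace_smult: "A \<in> carrier_mat n n \<Longrightarrow> mat_trace (c \<cdot>\<^sub>m A) = c * mat_trace A"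
  by (auto simp: mat_trace_def sum_distrib_left)

lemma trace_mult_adjoint:
  assumes "G \<in> carrier_mat n n"
  shows "mat_trace (G * mat_adjoint G) = of_real (\<Sum>(i, j)\<in>{..<n} \<times> {..<n}. (norm (G $$ (i, j)))\<^sup>2)"
proof -
  have "mat_trace (G * mat_adjoint G) = (\<Sum>i<n. \<Sum>j<n. G $$ (i, j) * mat_adjoint G $$ (j, i))"
    by (rule trace_mult_sum) (use assms in auto)
  also have "\<dots> = (\<Sum>i<n. \<Sum>j<n. of_real ((norm (G $$ (i, j)))\<^sup>2))"
    using assms by (auto intro!: sum.cong simp only: complex_norm_square adjoint_index carrier_matD lessThan_iff)
  finally show ?thesis by (simp add: sum.cartesian_product)
qed

lemma trace_psd_nonneg:
  assumes "psd_mat n M" "psd_mat n N"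
  shows "0 \<le> Re (mat_trace (M * N))" "Im (mat_trace (M * N)) = 0"
proof -
  obtain C where C: "C \<in> carrier_mat n n" "M = C * mat_adjoint C" by (rule psd_mat_factor[OF assms(1)])
  obtain R where R: "R \<in> carrier_mat n n" "N = R * mat_adjoint R" by (rule psd_mat_factor[OF assms(2)])
  define G where "G = mat_adjoint C * R"
  have "mat_trace (M * N) = mat_trace (C * (mat_adjoint C * (R * mat_adjoint R)))"
    using C R by (simp add: square_assoc[of _ n])
  also have "\<dots> = mat_trace (G * mat_adjoint G)"
    using C R by (subst trace_comm[of _ n]) (simp_all add: G_def square_adjoint_mult[of _ n] square_assoc[of _ n])
  also have "\<dots> = of_real (\<Sum>(i, j)\<in>{..<n} \<times> {..<n}. (norm (G $$ (i, j)))\<^sup>2)"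
    by (rule trace_mult_adjoint) (use C R in \<open>simp add: G_def\<close>)
  finally show "0 \<le> Re (mat_trace (M * N))" "Im (mat_trace (M * N)) = 0"
    by (auto intro!: sum_nonneg)
qed

lemma psd_mat_one: "psd_mat n (1\<^sub>m n)"
  using psd_mat_mult_adjoint[of "1\<^sub>m n" n] by simp

text \<open>Rank-one matrices \<open>V\<close> recover the quadratic form. The criterion suits
  partial traces and integrals of matrices, because both can be moved across the trace
  pairing.\<close>

lemma psd_matI_trace:
  assumes A: "A \<in> carrier_mat n n" "mat_adjoint A = A"
    and tr: "\<And>V. psd_mat n V \<Longrightarrow> 0 \<le> Re (mat_trace (A * V))"
  shows "psd_mat n A"
  unfolding psd_mat_def
proof (intro conjI ballI A)
  fix v :: "complex vec" assume v: "v \<in> carrier_vec n"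
  define V where "V = mat n n (\<lambda>(i, j). v $ i * cnj (v $ j))"
  \<comment> \<open>The vector is placed in the first column of a square matrix, so that
    \<open>V\<close> becomes \<open>W * mat_adjoint W\<close> within square matrices.\<close>
  define W where "W = mat n n (\<lambda>(i, j). if j = 0 then v $ i else 0)"
  have W: "W \<in> carrier_mat n n" by (simp add: W_def)
  have "V = W * mat_adjoint W"
  proof (rule eq_matI)
    fix i j assume "i < dim_row (W * mat_adjoint W)" "j < dim_col (W * mat_adjoint W)"
    then have ij: "i < n" "j < n" using W by auto
    have "(W * mat_adjoint W) $$ (i, j) = (\<Sum>k<n. W $$ (i, k) * mat_adjoint W $$ (k, j))"
      by (rule mult_index_sum) (use W ij in auto)
    also have "\<dots> = (\<Sum>k<n. if k = 0 then v $ i * cnj (v $ j) else 0)"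
      using W ij by (intro sum.cong) (auto simp: W_def)
    also have "\<dots> = V $$ (i, j)" using ij by (simp add: V_def)
    finally show "V $$ (i, j) = (W * mat_adjoint W) $$ (i, j)" by simp
  qed (use W in \<open>auto simp: V_def\<close>)
  then have "psd_mat n V" using psd_mat_mult_adjoint[OF W] by simp
  moreover have "(A *\<^sub>v v) \<bullet>c v = mat_trace (A * V)"
    using A v by (subst trace_mult_sum[of _ n]) (auto simp: V_def scalar_prod_def atLeast0LessThan sum_distrib_right mult.assoc intro!: sum.cong)
  ultimately show "0 \<le> Re ((A *\<^sub>v v) \<bullet>c v)" using tr by simp
qed

text \<open>The tensor product of \<open>A\<close> with the identity on the second factor: quotient
  and remainder by \<open>dB\<close> recover the pair (a, k) from its position
  \<open>a * dB + k\<close>.\<close>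

definition ampl :: "nat \<Rightarrow> nat \<Rightarrow> complex mat \<Rightarrow> complex mat" where
  "ampl dA dB A = mat (dA * dB) (dA * dB) (\<lambda>(i, j). if i mod dB = j mod dB then A $$ (i div dB, j div dB) else 0)"

lemma ampl_carrier[simp]: "ampl dA dB A \<in> carrier_mat (dA * dB) (dA * dB)"
  by (simp add: ampl_def)

lemma ampl_dim[simp]: "dim_row (ampl dA dB A) = dA * dB" "dim_col (ampl dA dB A) = dA * dB"
  by (simp_all add: ampl_def)

lemma pair_index_less: "a < dA \<Longrightarrow> k < dB \<Longrightarrow> a * dB + k < dA * (dB :: nat)"
proof -
  assume "a < dA" "k < dB"
  then have "a * dB + k < Suc a * dB" by simp
  also have "\<dots> \<le> dA * dB" using \<open>a < dA\<close> by (intro mult_le_mono1) simp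
  finally show ?thesis .
qed

lemma sum_lessThan_mult:
  fixes f :: "nat \<Rightarrow> 'a :: comm_monoid_add"
  shows "(\<Sum>m<dA * dB. f m) = (\<Sum>a<dA. \<Sum>k<dB. f (a * dB + k))"
proof -
  have md: "m mod dB < dB" if "m < dA * dB" for m
    using that by (cases dB) auto
  have "(\<Sum>m<dA * dB. f m) = (\<Sum>(a, k)\<in>{..<dA} \<times> {..<dB}. f (a * dB + k))"
    by (rule sum.reindex_bij_witness[where i = "\<lambda>(a, k). a * dB + k" and j = "\<lambda>m. (m div dB, m mod dB)"])
       (use md in \<open>auto simp: pair_index_less less_mult_imp_div_less\<close>)
  then show ?thesis by (simp add: sum.cartesian_product)
qed

lemma ampl_index:
  assumes "a < dA" "k < dB" "b < dA" "l < dB"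
  shows "ampl dA dB A $$ (a * dB + k, b * dB + l) = (if k = l then A $$ (a, b) else 0)"
  using assms by (simp add: ampl_def pair_index_less)

lemma pair_indexE:
  fixes i dA dB :: nat
  assumes "i < dA * dB"
  obtains a k where "i = a * dB + k" "a < dA" "k < dB"
proof
  show "i = i div dB * dB + i mod dB" by simp
  show "i div dB < dA" using assms by (rule less_mult_imp_div_less)
  have "0 < dB" using assms by (cases dB) auto
  then show "i mod dB < dB" by simp
qed

lemma eq_pair_matI:
  assumes "A \<in> carrier_mat (dA * dB) (dA * dB)" "B \<in> carrier_mat (dA * dB) (dA * dB)"
    and "\<And>a k b l. a < dA \<Longrightarrow> k < dB \<Longrightarrow> b < dA \<Longrightarrow> l < dB \<Longrightarrow>
      A $$ (a * dB + k, b * dB + l) = B $$ (a * dB + k, b * dB + l)"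
  shows "A = B"
proof (rule eq_matI)
  fix i j assume "i < dim_row B" "j < dim_col B"
  then have "i < dA * dB" "j < dA * dB" using assms(2) by auto
  then obtain a k b l where "i = a * dB + k" "a < dA" "k < dB" "j = b * dB + l" "b < dA" "l < dB"
    by (metis pair_indexE)
  then show "A $$ (i, j) = B $$ (i, j)" using assms(3) by simp
qed (use assms in auto)

lemma mult_ampl_index:
  assumes "M \<in> carrier_mat (dA * dB) (dA * dB)" "a < dA" "k < dB" "b < dA" "l < dB"
  shows "(M * ampl dA dB A) $$ (a * dB + k, b * dB + l) = (\<Sum>c<dA. M $$ (a * dB + k, c * dB + l) * A $$ (c, b))"
    and "(ampl dA dB A * M) $$ (a * dB + k, b * dB + l) = (\<Sum>c<dA. A $$ (a, c) * M $$ (c * dB + k, b * dB + l))"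
proof -
  have "(M * ampl dA dB A) $$ (a * dB + k, b * dB + l) = (\<Sum>m<dA * dB. M $$ (a * dB + k, m) * ampl dA dB A $$ (m, b * dB + l))"
    by (rule mult_index_sum[OF assms(1) ampl_carrier]) (use assms in \<open>auto simp: pair_index_less\<close>)
  also have "\<dots> = (\<Sum>c<dA. \<Sum>p<dB. if p = l then M $$ (a * dB + k, c * dB + p) * A $$ (c, b) else 0)"
    unfolding sum_lessThan_mult using assms by (intro sum.cong) (auto simp: ampl_index)
  finally show "(M * ampl dA dB A) $$ (a * dB + k, b * dB + l) = (\<Sum>c<dA. M $$ (a * dB + k, c * dB + l) * A $$ (c, b))"
    using assms by simp
  have "(ampl dA dB A * M) $$ (a * dB + k, b * dB + l) = (\<Sum>m<dA * dB. ampl dA dB A $$ (a * dB + k, m) * M $$ (m, b * dB + l))"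
    by (rule mult_index_sum[OF ampl_carrier assms(1)]) (use assms in \<open>auto simp: pair_index_less\<close>)
  also have "\<dots> = (\<Sum>c<dA. \<Sum>p<dB. if p = k then A $$ (a, c) * M $$ (c * dB + p, b * dB + l) else 0)"
    unfolding sum_lessThan_mult using assms by (intro sum.cong) (auto simp: ampl_index)
  finally show "(ampl dA dB A * M) $$ (a * dB + k, b * dB + l) = (\<Sum>c<dA. A $$ (a, c) * M $$ (c * dB + k, b * dB + l))"
    using assms by simp
qed

lemma ampl_mult:
  assumes "A \<in> carrier_mat dA dA" "B \<in> carrier_mat dA dA"
  shows "ampl dA dB A * ampl dA dB B = ampl dA dB (A * B)"
proof (rule eq_pair_matI)
  fix a k b l assume *: "a < dA" "k < dB" "b < dA" "l < dB"
  have "(ampl dA dB A * ampl dA dB B) $$ (a * dB + k, b * dB + l)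
     = (\<Sum>c<dA. A $$ (a, c) * ampl dA dB B $$ (c * dB + k, b * dB + l))"
    by (rule mult_ampl_index(2)) (use * in auto)
  also have "\<dots> = (if k = l then \<Sum>c<dA. A $$ (a, c) * B $$ (c, b) else 0)"
    using * by (simp add: ampl_index)
  also have "\<dots> = ampl dA dB (A * B) $$ (a * dB + k, b * dB + l)"
    using * by (simp add: ampl_index mult_index_sum[OF assms] del: index_mult_mat)
  finally show "(ampl dA dB A * ampl dA dB B) $$ (a * dB + k, b * dB + l) = ampl dA dB (A * B) $$ (a * dB + k, b * dB + l)" .
qed auto

lemma ampl_adjoint:
  assumes "A \<in> carrier_mat dA dA"
  shows "mat_adjoint (ampl dA dB A) = ampl dA dB (mat_adjoint A)"
proof (rule eq_pair_matI[of _ dA dB])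
  fix a k b l assume *: "a < dA" "k < dB" "b < dA" "l < dB"
  have "mat_adjoint (ampl dA dB A) $$ (a * dB + k, b * dB + l) = cnj (ampl dA dB A $$ (b * dB + l, a * dB + k))"
    by (rule adjoint_index) (use * in \<open>auto simp: ampl_def pair_index_less\<close>)
  then show "mat_adjoint (ampl dA dB A) $$ (a * dB + k, b * dB + l) = ampl dA dB (mat_adjoint A) $$ (a * dB + k, b * dB + l)"
    using * assms by (simp add: ampl_index)
qed auto

lemma ampl_one: "ampl dA dB (1\<^sub>m dA) = 1\<^sub>m (dA * dB)"
proof (rule eq_pair_matI[of _ dA dB])
  fix a k b l assume *: "a < dA" "k < dB" "b < dA" "l < dB"
  have "a * dB + k = b * dB + l \<longleftrightarrow> a = b \<and> k = l"
  proof
    assume eq: "a * dB + k = b * dB + l"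
    have "(a * dB + k) div dB = a" "(a * dB + k) mod dB = k" "(b * dB + l) div dB = b" "(b * dB + l) mod dB = l"
      using * by auto
    then show "a = b \<and> k = l" using eq by metis
  qed simp
  then show "ampl dA dB (1\<^sub>m dA) $$ (a * dB + k, b * dB + l) = 1\<^sub>m (dA * dB) $$ (a * dB + k, b * dB + l)"
    using * by (simp add: ampl_index pair_index_less)
qed auto

lemma ampl_minus:
  assumes "A \<in> carrier_mat dA dA" "B \<in> carrier_mat dA dA"
  shows "ampl dA dB (A - B) = ampl dA dB A - ampl dA dB B"
  by (rule eq_pair_matI[of _ dA dB]) (use assms in \<open>auto intro!: minus_carrier_mat simp: ampl_index pair_index_less\<close>)

lemma psd_mat_ampl:
  assumes "psd_mat dA A" shows "psd_mat (dA * dB) (ampl dA dB A)"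
proof -
  obtain B where B: "B \<in> carrier_mat dA dA" "A = B * mat_adjoint B" by (rule psd_mat_factor[OF assms])
  then have "ampl dA dB A = ampl dA dB B * mat_adjoint (ampl dA dB B)"
    by (simp add: ampl_adjoint ampl_mult)
  then show ?thesis using psd_mat_mult_adjoint[OF ampl_carrier] by simp
qed

section \<open>Partial trace\<close>

lemma ptrace_carrier[simp]: "ptrace_B dA dB M \<in> carrier_mat dA dA"
  by (simp add: ptrace_B_def)

lemma ptrace_dim[simp]: "dim_row (ptrace_B dA dB M) = dA" "dim_col (ptrace_B dA dB M) = dA"
  by (simp_all add: ptrace_B_def)

lemma ptrace_index: "a < dA \<Longrightarrow> b < dA \<Longrightarrow> ptrace_B dA dB M $$ (a, b) = (\<Sum>k<dB. M $$ (a * dB + k, b * dB + k))"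
  by (simp add: ptrace_B_def)

text \<open>The partial trace is a bimodule map over the operators on the first factor. This is how
  identities for marginals and identities for joint matrices are translated into each other.\<close>

lemma ptrace_ampl_mult:
  assumes "M \<in> carrier_mat (dA * dB) (dA * dB)" "A \<in> carrier_mat dA dA"
  shows "ptrace_B dA dB (ampl dA dB A * M) = A * ptrace_B dA dB M"
    and "ptrace_B dA dB (M * ampl dA dB A) = ptrace_B dA dB M * A"
proof -
  have "ptrace_B dA dB (ampl dA dB A * M) $$ (a, b) = (A * ptrace_B dA dB M) $$ (a, b)"
    and "ptrace_B dA dB (M * ampl dA dB A) $$ (a, b) = (ptrace_B dA dB M * A) $$ (a, b)" if "a < dA" "b < dA" for a b
  proof -
    have "ptrace_B dA dB (ampl dA dB A * M) $$ (a, b) = (\<Sum>k<dB. \<Sum>c<dA. A $$ (a, c) * M $$ (c * dB + k, b * dB + k))"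
      unfolding ptrace_index[OF that] by (intro sum.cong mult_ampl_index(2)) (use assms that in auto)
    also have "\<dots> = (\<Sum>c<dA. A $$ (a, c) * ptrace_B dA dB M $$ (c, b))"
      using that by (subst sum.swap) (simp add: ptrace_index sum_distrib_left)
    also have "\<dots> = (A * ptrace_B dA dB M) $$ (a, b)"
      by (rule mult_index_sum[symmetric]) (use assms that in auto)
    finally show "ptrace_B dA dB (ampl dA dB A * M) $$ (a, b) = (A * ptrace_B dA dB M) $$ (a, b)" .
    have "ptrace_B dA dB (M * ampl dA dB A) $$ (a, b) = (\<Sum>k<dB. \<Sum>c<dA. M $$ (a * dB + k, c * dB + k) * A $$ (c, b))"
      unfolding ptrace_index[OF that] by (intro sum.cong mult_ampl_index(1)) (use assms that in auto)
    also have "\<dots> = (\<Sum>c<dA. ptrace_B dA dB M $$ (a, c) * A $$ (c, b))"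
      using that by (subst sum.swap) (simp add: ptrace_index sum_distrib_right)
    also have "\<dots> = (ptrace_B dA dB M * A) $$ (a, b)"
      by (rule mult_index_sum[symmetric]) (use assms that in auto)
    finally show "ptrace_B dA dB (M * ampl dA dB A) $$ (a, b) = (ptrace_B dA dB M * A) $$ (a, b)" .
  qed
  then show "ptrace_B dA dB (ampl dA dB A * M) = A * ptrace_B dA dB M"
    and "ptrace_B dA dB (M * ampl dA dB A) = ptrace_B dA dB M * A"
    using assms by (auto intro!: eq_matI simp: ptrace_B_def simp del: index_mult_mat(1))
qed

lemma ptrace_add:
  assumes "M \<in> carrier_mat (dA * dB) (dA * dB)" "N \<in> carrier_mat (dA * dB) (dA * dB)"
  shows "ptrace_B dA dB (M + N) = ptrace_B dA dB M + ptrace_B dA dB N"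
  by (rule eq_matI) (use assms in \<open>auto simp: ptrace_B_def pair_index_less sum.distrib\<close>)

lemma ptrace_smult:
  assumes "M \<in> carrier_mat (dA * dB) (dA * dB)"
  shows "ptrace_B dA dB (c \<cdot>\<^sub>m M) = c \<cdot>\<^sub>m ptrace_B dA dB M"
  by (rule eq_matI) (use assms in \<open>auto simp: ptrace_B_def pair_index_less sum_distrib_left\<close>)

lemma ptrace_ampl:
  assumes "A \<in> carrier_mat dA dA"
  shows "ptrace_B dA dB (ampl dA dB A) = of_nat dB \<cdot>\<^sub>m A"
  by (rule eq_matI) (use assms in \<open>auto simp: ptrace_index ampl_index\<close>)

lemma trace_ptrace:
  assumes "M \<in> carrier_mat (dA * dB) (dA * dB)"
  shows "mat_trace (ptrace_B dA dB M) = mat_trace M"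
  using assms by (auto simp: mat_trace_def sum_lessThan_mult ptrace_B_def)

text \<open>Pairing the partial trace with \<open>V\<close> is pairing \<open>M\<close> with
  \<open>ampl dA dB V\<close>, so positivity is inherited through
  \<open>psd_matI_trace\<close>.\<close>

lemma psd_mat_ptrace:
  assumes "psd_mat (dA * dB) M" shows "psd_mat dA (ptrace_B dA dB M)"
proof (rule psd_matI_trace)
  have M: "M \<in> carrier_mat (dA * dB) (dA * dB)" by (rule psd_mat_carrier[OF assms])
  show "mat_adjoint (ptrace_B dA dB M) = ptrace_B dA dB M"
  proof (rule eq_matI)
    fix i j assume "i < dim_row (ptrace_B dA dB M)" "j < dim_col (ptrace_B dA dB M)"
    then have ij: "i < dA" "j < dA" by (auto simp: ptrace_B_def)
    have "cnj (M $$ (j * dB + k, i * dB + k)) = M $$ (i * dB + k, j * dB + k)" if "k < dB" for k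
    proof -
      have "mat_adjoint M $$ (i * dB + k, j * dB + k) = cnj (M $$ (j * dB + k, i * dB + k))"
        by (rule adjoint_index) (use M ij that in \<open>auto simp: pair_index_less\<close>)
      then show ?thesis by (simp add: psd_mat_adjoint[OF assms])
    qed
    then show "mat_adjoint (ptrace_B dA dB M) $$ (i, j) = ptrace_B dA dB M $$ (i, j)"
      using ij by (simp add: ptrace_B_def)
  qed (auto simp: ptrace_B_def)
  fix V assume V: "psd_mat dA V"
  have "mat_trace (ptrace_B dA dB M * V) = mat_trace (M * ampl dA dB V)"
    using psd_mat_carrier[OF V] M by (subst ptrace_ampl_mult(2)[symmetric]) (auto simp: trace_ptrace)
  then show "0 \<le> Re (mat_trace (ptrace_B dA dB M * V))"
    using trace_psd_nonneg(1)[OF assms psd_mat_ampl[OF V]] by simp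
qed auto

section \<open>Matrices of exponential polynomials\<close>

definition exp_poly_mat :: "nat \<Rightarrow> (complex \<Rightarrow> complex mat) \<Rightarrow> bool" where
  "exp_poly_mat n F \<longleftrightarrow> (\<forall>z. F z \<in> carrier_mat n n) \<and> (\<forall>i<n. \<forall>j<n. exp_poly (\<lambda>z. F z $$ (i, j)))"

lemma exp_poly_mat_const: "A \<in> carrier_mat n n \<Longrightarrow> exp_poly_mat n (\<lambda>z. A)"
  by (simp add: exp_poly_mat_def exp_poly_const)

lemma exp_poly_mat_mult:
  assumes "exp_poly_mat n F" "exp_poly_mat n G"
  shows "exp_poly_mat n (\<lambda>z. F z * G z)"
  unfolding exp_poly_mat_def
proof (intro conjI allI impI)
  fix i j assume ij: "i < n" "j < n"
  have "(F z * G z) $$ (i, j) = (\<Sum>k<n. F z $$ (i, k) * G z $$ (k, j))" for z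
    by (rule mult_index_sum) (use assms ij in \<open>auto simp: exp_poly_mat_def\<close>)
  then show "exp_poly (\<lambda>z. (F z * G z) $$ (i, j))"
    using assms ij by (auto intro!: exp_poly_sum exp_poly_mult simp: exp_poly_mat_def simp del: index_mult_mat)
qed (use assms in \<open>simp add: exp_poly_mat_def\<close>)

lemma exp_poly_mat_ampl:
  assumes "exp_poly_mat dA F" shows "exp_poly_mat (dA * dB) (\<lambda>z. ampl dA dB (F z))"
  unfolding exp_poly_mat_def
proof (intro conjI allI impI)
  fix i j assume "i < dA * dB" "j < dA * dB"
  then obtain a k b l where *: "i = a * dB + k" "a < dA" "k < dB" "j = b * dB + l" "b < dA" "l < dB"
    by (metis pair_indexE)
  show "exp_poly (\<lambda>z. ampl dA dB (F z) $$ (i, j))"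
    unfolding *(1,4) ampl_index[OF *(2,3,5,6)] using assms *
    by (cases "k = l") (auto simp: exp_poly_mat_def intro: exp_poly_const)
qed simp

text \<open>A positive eigenvalue \<open>x\<close> contributes a constant times an exponential of
  frequency \<open>b * ln x\<close>, which is real because \<open>b\<close> is; the eigenvalue 0
  contributes the constant 0. The unitary does not depend on \<open>z\<close>.\<close>

lemma exp_poly_mat_cpow:
  assumes "psd_mat n A" shows "exp_poly_mat n (\<lambda>z. mat_cpow A (a + of_real b * z))"
proof -
  obtain U d where U: "unitary_mat n U" "\<forall>z. mat_cpow A z = spectral_mat n U (\<lambda>i. complex_of_real (d i) powr z)" "\<forall>i. 0 \<le> d i"
    by (rule mat_cpow_spectral[OF assms]) blast
  have Uc: "U \<in> carrier_mat n n" using U(1) by (simp add: unitary_mat_def)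
  have pw: "exp_poly (\<lambda>z. complex_of_real x powr (a + of_real b * z))" if "0 \<le> x" for x
  proof (cases "x = 0")
    case False
    then have "complex_of_real x powr (a + of_real b * z) = exp (a * of_real (ln x)) * exp (of_real (b * ln x) * z)" for z
      using that by (simp add: powr_def Ln_of_real algebra_simps flip: exp_add)
    then show ?thesis by (simp only: exp_poly_monom)
  qed (simp add: exp_poly_const)
  show ?thesis
    unfolding exp_poly_mat_def U(2)[rule_format]
    using Uc U(3) by (auto simp: spectral_mat_index intro!: exp_poly_sum exp_poly_mult exp_poly_const pw)
qed

section \<open>Integrals of matrices and trace inequalities\<close>

definition bounded_cont_mat :: "nat \<Rightarrow> (real \<Rightarrow> complex mat) \<Rightarrow> bool" where
  "bounded_cont_mat n F \<longleftrightarrow> (\<forall>t. F t \<in> carrier_mat n n) \<and> (\<forall>i<n. \<forall>j<n. bounded_cont (\<lambda>t. F t $$ (i, j)))"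

lemma bounded_cont_mat_const: "A \<in> carrier_mat n n \<Longrightarrow> bounded_cont_mat n (\<lambda>t. A)"
  by (simp add: bounded_cont_mat_def bounded_cont_const)

lemma bounded_cont_mat_mult:
  assumes "bounded_cont_mat n F" "bounded_cont_mat n G"
  shows "bounded_cont_mat n (\<lambda>t. F t * G t)"
  unfolding bounded_cont_mat_def
proof (intro conjI allI impI)
  fix i j assume ij: "i < n" "j < n"
  have "(F t * G t) $$ (i, j) = (\<Sum>k<n. F t $$ (i, k) * G t $$ (k, j))" for t
    by (rule mult_index_sum) (use assms ij in \<open>auto simp: bounded_cont_mat_def\<close>)
  then show "bounded_cont (\<lambda>t. (F t * G t) $$ (i, j))"
    using assms ij by (auto intro!: bounded_cont_sum bounded_cont_mult simp: bounded_cont_mat_def simp del: index_mult_mat)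
qed (use assms in \<open>simp add: bounded_cont_mat_def\<close>)

lemma bounded_cont_mat_adjoint:
  assumes "bounded_cont_mat n F"
  shows "bounded_cont_mat n (\<lambda>t. mat_adjoint (F t))"
  unfolding bounded_cont_mat_def
proof (intro conjI allI impI)
  fix i j assume ij: "i < n" "j < n"
  have F: "F t \<in> carrier_mat n n" for t using assms by (simp add: bounded_cont_mat_def)
  have "mat_adjoint (F t) $$ (i, j) = cnj (F t $$ (j, i))" for t
    using F[of t] ij by simp
  then show "bounded_cont (\<lambda>t. mat_adjoint (F t) $$ (i, j))"
    using assms ij by (simp add: bounded_cont_mat_def bounded_cont_cnj)
qed (use assms in \<open>simp add: bounded_cont_mat_def\<close>)

lemma bounded_cont_mat_exp_poly:
  assumes "exp_poly_mat n F"
  shows "bounded_cont_mat n (\<lambda>t. F (of_real x + \<i> * of_real t))"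
  unfolding bounded_cont_mat_def
proof (intro conjI allI impI)
  fix i j assume "i < n" "j < n"
  then have "exp_poly (\<lambda>z. F z $$ (i, j))" using assms by (simp add: exp_poly_mat_def)
  then show "bounded_cont (\<lambda>t. F (of_real x + \<i> * of_real t) $$ (i, j))" by (rule bounded_cont_exp_poly)
qed (use assms in \<open>simp add: exp_poly_mat_def\<close>)

definition mat_integral :: "nat \<Rightarrow> real measure \<Rightarrow> (real \<Rightarrow> complex mat) \<Rightarrow> complex mat" where
  "mat_integral n \<mu> F = mat n n (\<lambda>(i, j). LINT t|\<mu>. F t $$ (i, j))"

lemma mat_integral_carrier[simp]: "mat_integral n \<mu> F \<in> carrier_mat n n"
  by (simp add: mat_integral_def)

lemma mat_integral_dim[simp]: "dim_row (mat_integral n \<mu> F) = n" "dim_col (mat_integral n \<mu> F) = n"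
  by (simp_all add: mat_integral_def)

lemma integrable_mat_entry:
  assumes "prob_space \<mu>" "sets \<mu> = sets borel" "bounded_cont_mat n F" "i < n" "j < n"
  shows "integrable \<mu> (\<lambda>t. F t $$ (i, j))"
  using assms by (intro integrable_bounded_cont) (auto simp: bounded_cont_mat_def)

lemma trace_mat_integral:
  assumes \<mu>: "prob_space \<mu>" "sets \<mu> = sets borel" and F: "bounded_cont_mat n F" and M: "M \<in> carrier_mat n n"
  shows "integrable \<mu> (\<lambda>t. mat_trace (M * F t))"
    and "mat_trace (M * mat_integral n \<mu> F) = (LINT t|\<mu>. mat_trace (M * F t))"
proof -
  have Fc: "F t \<in> carrier_mat n n" for t using F by (simp add: bounded_cont_mat_def)
  note int = integrable_mat_entry[OF \<mu> F]
  show "integrable \<mu> (\<lambda>t. mat_trace (M * F t))"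
    unfolding trace_mult_sum[OF M Fc]
    by (intro Bochner_Integration.integrable_sum integrable_mult_right int) auto
  have "(LINT t|\<mu>. mat_trace (M * F t)) = (\<Sum>i<n. \<Sum>j<n. M $$ (i, j) * (LINT t|\<mu>. F t $$ (j, i)))"
  proof -
    have "(LINT t|\<mu>. mat_trace (M * F t)) = (\<Sum>i<n. (LINT t|\<mu>. (\<Sum>j<n. M $$ (i, j) * F t $$ (j, i))))"
      unfolding trace_mult_sum[OF M Fc]
      by (intro Bochner_Integration.integral_sum Bochner_Integration.integrable_sum integrable_mult_right int) auto
    also have "\<dots> = (\<Sum>i<n. \<Sum>j<n. (LINT t|\<mu>. M $$ (i, j) * F t $$ (j, i)))"
      by (intro sum.cong refl Bochner_Integration.integral_sum integrable_mult_right int) auto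
    finally show ?thesis by simp
  qed
  also have "\<dots> = mat_trace (M * mat_integral n \<mu> F)"
    unfolding trace_mult_sum[OF M mat_integral_carrier] by (simp add: mat_integral_def)
  finally show "mat_trace (M * mat_integral n \<mu> F) = (LINT t|\<mu>. mat_trace (M * F t))" ..
qed

lemma psd_mat_integral:
  assumes \<mu>: "prob_space \<mu>" "sets \<mu> = sets borel" and F: "bounded_cont_mat n F" and psd: "\<And>t. psd_mat n (F t)"
  shows "psd_mat n (mat_integral n \<mu> F)"
proof (rule psd_matI_trace)
  show "mat_adjoint (mat_integral n \<mu> F) = mat_integral n \<mu> F"
  proof (rule eq_matI)
    fix i j assume "i < dim_row (mat_integral n \<mu> F)" "j < dim_col (mat_integral n \<mu> F)"
    then have ij: "i < n" "j < n" by auto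
    have "cnj (F t $$ (j, i)) = F t $$ (i, j)" for t
    proof -
      have "mat_adjoint (F t) $$ (i, j) = cnj (F t $$ (j, i))"
        using psd_mat_carrier[OF psd[of t]] ij by simp
      then show ?thesis by (simp add: psd_mat_adjoint[OF psd])
    qed
    then show "mat_adjoint (mat_integral n \<mu> F) $$ (i, j) = mat_integral n \<mu> F $$ (i, j)"
      using ij by (simp add: mat_integral_def flip: Bochner_Integration.integral_cnj)
  qed auto
  fix V assume V: "psd_mat n V"
  note Vc = psd_mat_carrier[OF V] and Fc = psd_mat_carrier[OF psd]
  have "mat_trace (mat_integral n \<mu> F * V) = (LINT t|\<mu>. mat_trace (V * F t))"
    by (subst trace_comm[of _ n]) (use Vc trace_mat_integral(2)[OF \<mu> F Vc] in auto)
  also have "Re \<dots> = (LINT t|\<mu>. Re (mat_trace (V * F t)))"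
    by (rule integral_Re[symmetric]) (rule trace_mat_integral(1)[OF \<mu> F Vc])
  also have "\<dots> \<ge> 0" by (intro integral_nonneg_AE AE_I2 trace_psd_nonneg(1)[OF V psd])
  finally show "0 \<le> Re (mat_trace (mat_integral n \<mu> F * V))" .
qed auto

lemma mat_integral_const_minus:
  assumes \<mu>: "prob_space \<mu>" "sets \<mu> = sets borel" and F: "bounded_cont_mat n F" and A: "A \<in> carrier_mat n n"
  shows "mat_integral n \<mu> (\<lambda>t. A - F t) = A - mat_integral n \<mu> F" "bounded_cont_mat n (\<lambda>t. A - F t)"
proof -
  interpret prob_space \<mu> by fact
  have Fc: "F t \<in> carrier_mat n n" for t using F by (simp add: bounded_cont_mat_def)
  have ix: "(A - F t) $$ (i, j) = A $$ (i, j) + (-1) * F t $$ (i, j)" if "i < n" "j < n" for t i j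
    using Fc[of t] A that by simp
  show "mat_integral n \<mu> (\<lambda>t. A - F t) = A - mat_integral n \<mu> F"
  proof (rule eq_matI)
    fix i j assume "i < dim_row (A - mat_integral n \<mu> F)" "j < dim_col (A - mat_integral n \<mu> F)"
    then have ij: "i < n" "j < n" by auto
    have "mat_integral n \<mu> (\<lambda>t. A - F t) $$ (i, j) = (LINT t|\<mu>. A $$ (i, j) + (-1) * F t $$ (i, j))"
      using ij by (simp only: mat_integral_def index_mat split ix)
    also have "\<dots> = A $$ (i, j) - (LINT t|\<mu>. F t $$ (i, j))"
      using integrable_mat_entry[OF \<mu> F ij] by (simp add: prob_space)
    finally show "mat_integral n \<mu> (\<lambda>t. A - F t) $$ (i, j) = (A - mat_integral n \<mu> F) $$ (i, j)"
      using ij A by (simp add: mat_integral_def)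
  qed auto
  show "bounded_cont_mat n (\<lambda>t. A - F t)"
    unfolding bounded_cont_mat_def
  proof (intro conjI allI impI)
    show "A - F t \<in> carrier_mat n n" for t using Fc[of t] by (rule minus_carrier_mat)
    fix i j assume ij: "i < n" "j < n"
    then have "bounded_cont (\<lambda>t. F t $$ (i, j))" using F by (simp add: bounded_cont_mat_def)
    then show "bounded_cont (\<lambda>t. (A - F t) $$ (i, j))"
      unfolding ix[OF ij] by (intro bounded_cont_add bounded_cont_const bounded_cont_mult)
  qed
qed

lemma ptrace_mat_integral:
  assumes \<mu>: "prob_space \<mu>" "sets \<mu> = sets borel" and F: "bounded_cont_mat (dA * dB) F"
  shows "ptrace_B dA dB (mat_integral (dA * dB) \<mu> F) = mat_integral dA \<mu> (\<lambda>t. ptrace_B dA dB (F t))"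
proof (rule eq_matI)
  fix i j assume "i < dim_row (mat_integral dA \<mu> (\<lambda>t. ptrace_B dA dB (F t)))" "j < dim_col (mat_integral dA \<mu> (\<lambda>t. ptrace_B dA dB (F t)))"
  then have ij: "i < dA" "j < dA" by auto
  have "ptrace_B dA dB (mat_integral (dA * dB) \<mu> F) $$ (i, j) = (\<Sum>k<dB. (LINT t|\<mu>. F t $$ (i * dB + k, j * dB + k)))"
    using ij by (simp add: ptrace_index mat_integral_def pair_index_less)
  also have "\<dots> = (LINT t|\<mu>. (\<Sum>k<dB. F t $$ (i * dB + k, j * dB + k)))"
    using ij by (intro Bochner_Integration.integral_sum[symmetric] integrable_mat_entry[OF \<mu> F]) (auto simp: pair_index_less)
  finally show "ptrace_B dA dB (mat_integral (dA * dB) \<mu> F) $$ (i, j) = mat_integral dA \<mu> (\<lambda>t. ptrace_B dA dB (F t)) $$ (i, j)"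
    using ij by (simp add: mat_integral_def ptrace_index)
qed auto

text \<open>With \<open>M = C * C\<^sup>\<dagger>\<close> and \<open>\<rho> = K * K\<^sup>\<dagger>\<close> the trace is the sum of the squared moduli of the
  entries of \<open>C\<^sup>\<dagger> * G z * K\<close>.\<close>

lemma three_lines_trace:
  assumes \<mu>: "strip_measures \<theta> \<mu>0 \<mu>1" and \<theta>: "0 < \<theta>" "\<theta> \<le> 1"
    and M: "psd_mat n M" and \<rho>: "psd_mat n \<rho>" and G: "exp_poly_mat n G"
  defines "f \<equiv> \<lambda>z. Re (mat_trace (M * (G z * \<rho> * mat_adjoint (G z))))"
  shows "f (of_real \<theta>) \<le> (if \<theta> = 1 then LINT t|\<mu>1. f (of_real 1 + \<i> * of_real t)
     else (LINT t|\<mu>0. f (of_real 0 + \<i> * of_real t)) powr (1 - \<theta>) * (LINT t|\<mu>1. f (of_real 1 + \<i> * of_real t)) powr \<theta>)"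
proof -
  obtain C where C: "C \<in> carrier_mat n n" "M = C * mat_adjoint C" by (rule psd_mat_factor[OF M])
  obtain K where K: "K \<in> carrier_mat n n" "\<rho> = K * mat_adjoint K" by (rule psd_mat_factor[OF \<rho>])
  define H where "H = (\<lambda>z. mat_adjoint C * (G z * K))"
  have Gc: "G z \<in> carrier_mat n n" for z using G by (simp add: exp_poly_mat_def)
  have H: "exp_poly_mat n H" unfolding H_def
    by (intro exp_poly_mat_mult exp_poly_mat_const G) (use C K in auto)
  have f: "f z = (\<Sum>(i, j)\<in>{..<n} \<times> {..<n}. (norm (H z $$ (i, j)))\<^sup>2)" for z
  proof -
    have "mat_trace (M * (G z * \<rho> * mat_adjoint (G z))) = mat_trace (C * (mat_adjoint C * (G z * (K * (mat_adjoint K * mat_adjoint (G z))))))"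
      using C K Gc by (simp add: square_assoc[of _ n])
    also have "\<dots> = mat_trace (H z * mat_adjoint (H z))"
      using C K Gc by (subst trace_comm[of _ n]) (simp_all add: H_def square_adjoint_mult[of _ n] square_assoc[of _ n])
    also have "\<dots> = of_real (\<Sum>(i, j)\<in>{..<n} \<times> {..<n}. (norm (H z $$ (i, j)))\<^sup>2)"
      by (rule trace_mult_adjoint) (use H in \<open>simp add: exp_poly_mat_def\<close>)
    finally show ?thesis unfolding f_def by simp
  qed
  have "exp_poly ((\<lambda>p z. H z $$ p) p)" if "p \<in> {..<n} \<times> {..<n}" for p
    using that H by (auto simp: exp_poly_mat_def)
  from three_lines[where I = "{..<n} \<times> {..<n}" and h = "\<lambda>p z. H z $$ p", OF \<mu> this \<theta>]
  show ?thesis unfolding f case_prod_unfold prod.collapse .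
qed

text \<open>For \<open>M = C * mat_adjoint C\<close> and \<open>\<rho> = K * mat_adjoint K\<close>,
  the left-hand trace is the Hilbert-Schmidt inner product of \<open>mat_adjoint C * G * K\<close>
  and \<open>mat_adjoint C * K\<close>. It serves the range \<alpha> < 1, where \<open>G\<close>
  stands on one side of \<rho> only.\<close>

lemma trace_cauchy_schwarz:
  assumes M: "psd_mat n M" and \<rho>: "psd_mat n \<rho>" and G: "G \<in> carrier_mat n n"
  shows "norm (mat_trace (M * (G * \<rho>))) \<le> sqrt (Re (mat_trace (M * \<rho>))) * sqrt (Re (mat_trace (M * (G * \<rho> * mat_adjoint G))))"
proof -
  obtain C where C: "C \<in> carrier_mat n n" "M = C * mat_adjoint C" by (rule psd_mat_factor[OF M])
  obtain K where K: "K \<in> carrier_mat n n" "\<rho> = K * mat_adjoint K" by (rule psd_mat_factor[OF \<rho>])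
  define H J where "H = mat_adjoint C * (G * K)" and "J = mat_adjoint C * K"
  have HJ: "H \<in> carrier_mat n n" "J \<in> carrier_mat n n" using C K G by (auto simp: H_def J_def)
  let ?I = "{..<n} \<times> {..<n}"
  define l where "l = (\<lambda>H :: complex mat. L2_set (\<lambda>(i, j). norm (H $$ (i, j))) ?I)"
  have l: "sqrt (Re (mat_trace (H * mat_adjoint H))) = l H" if "H \<in> carrier_mat n n" for H
    unfolding trace_mult_adjoint[OF that] l_def L2_set_def by (simp add: case_prod_unfold)
  have 1: "mat_trace (M * (G * \<rho>)) = mat_trace (H * mat_adjoint J)"
  proof -
    have "mat_trace (M * (G * \<rho>)) = mat_trace (C * (mat_adjoint C * (G * (K * mat_adjoint K))))"
      using C K G by (simp add: square_assoc[of _ n])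
    also have "\<dots> = mat_trace (H * mat_adjoint J)"
      using C K G by (subst trace_comm[of _ n]) (simp_all add: H_def J_def square_adjoint_mult[of _ n] square_assoc[of _ n])
    finally show ?thesis .
  qed
  have 2: "mat_trace (M * \<rho>) = mat_trace (J * mat_adjoint J)"
  proof -
    have "mat_trace (M * \<rho>) = mat_trace (C * (mat_adjoint C * (K * mat_adjoint K)))"
      using C K G by (simp add: square_assoc[of _ n])
    also have "\<dots> = mat_trace (J * mat_adjoint J)"
      using C K by (subst trace_comm[of _ n]) (simp_all add: J_def square_adjoint_mult[of _ n] square_assoc[of _ n])
    finally show ?thesis .
  qed
  have 3: "mat_trace (M * (G * \<rho> * mat_adjoint G)) = mat_trace (H * mat_adjoint H)"
  proof -
    have "mat_trace (M * (G * \<rho> * mat_adjoint G)) = mat_trace (C * (mat_adjoint C * (G * (K * (mat_adjoint K * mat_adjoint G)))))"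
      using C K G by (simp add: square_assoc[of _ n])
    also have "\<dots> = mat_trace (H * mat_adjoint H)"
      using C K G by (subst trace_comm[of _ n]) (simp_all add: H_def square_adjoint_mult[of _ n] square_assoc[of _ n])
    finally show ?thesis .
  qed
  have "norm (mat_trace (H * mat_adjoint J)) \<le> (\<Sum>(i, j)\<in>?I. \<bar>norm (H $$ (i, j))\<bar> * \<bar>norm (J $$ (i, j))\<bar>)"
  proof -
    have "mat_trace (H * mat_adjoint J) = (\<Sum>i<n. \<Sum>j<n. H $$ (i, j) * mat_adjoint J $$ (j, i))"
      by (rule trace_mult_sum) (use HJ in auto)
    also have "\<dots> = (\<Sum>(i, j)\<in>?I. H $$ (i, j) * mat_adjoint J $$ (j, i))"
      by (simp add: sum.cartesian_product)
    also have "norm \<dots> \<le> (\<Sum>(i, j)\<in>?I. norm (H $$ (i, j) * mat_adjoint J $$ (j, i)))"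
      unfolding case_prod_unfold by (rule norm_sum)
    also have "\<dots> = (\<Sum>(i, j)\<in>?I. \<bar>norm (H $$ (i, j))\<bar> * \<bar>norm (J $$ (i, j))\<bar>)"
      using HJ by (intro sum.cong) (auto simp: norm_mult)
    finally show ?thesis .
  qed
  also have "\<dots> \<le> l H * l J"
    unfolding l_def case_prod_unfold by (rule L2_set_mult_ineq)
  finally show ?thesis unfolding 1 2 3 l[OF HJ(1)] l[OF HJ(2)] by (simp add: mult.commute)
qed

text \<open>With \<open>\<rho> = K * mat_adjoint K\<close> the trace is the sum of the squared
  moduli of the entries of \<open>C * K\<close>. The trace sees only the marginal when
  \<open>C\<close> acts on the first factor, and so this lemma lifts an identity from the marginal
  to \<rho>.\<close>

lemma psd_congruence_trace_zero:
  assumes \<rho>: "psd_mat n \<rho>" and C: "C \<in> carrier_mat n n" and 0: "mat_trace (C * \<rho> * mat_adjoint C) = 0"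
  shows "C * \<rho> = 0\<^sub>m n n"
proof -
  obtain K where K: "K \<in> carrier_mat n n" "\<rho> = K * mat_adjoint K" by (rule psd_mat_factor[OF \<rho>])
  have CK: "C * K \<in> carrier_mat n n" using C K by simp
  have "mat_trace ((C * K) * mat_adjoint (C * K)) = 0"
    using 0 C K by (simp add: square_adjoint_mult[of _ n] square_assoc[of _ n])
  then have "(\<Sum>(i, j)\<in>{..<n} \<times> {..<n}. (norm ((C * K) $$ (i, j)))\<^sup>2) = 0"
    unfolding trace_mult_adjoint[OF CK] of_real_eq_0_iff .
  then have "(C * K) $$ (i, j) = 0" if "i < n" "j < n" for i j
    using that by (subst (asm) sum_nonneg_eq_0_iff) (auto simp del: index_mult_mat)
  then have "C * K = 0\<^sub>m n n" using CK by (intro eq_matI) (auto simp del: index_mult_mat(1))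
  then have "(C * K) * mat_adjoint K = 0\<^sub>m n n" using K by simp
  then show ?thesis using C K by (simp add: square_assoc[of _ n])
qed

text \<open>Turns the inclusion of supports into algebra: the columns of \<rho> lie in its support,
  those of \<open>1 - P\<close> in the kernel of \<sigma>, and the entries of
  \<open>(1 - P) * \<rho>\<close> are the inner products of such columns, since \<open>1 - P\<close>
  is self-adjoint.\<close>

lemma cpow_zero_mult_of_supp:
  assumes \<rho>: "psd_mat n \<rho>" and \<sigma>: "psd_mat n \<sigma>" and supp: "mat_supp \<rho> \<subseteq> mat_supp \<sigma>"
  shows "mat_cpow \<sigma> 0 * \<rho> = \<rho>"
proof -
  define P where "P = mat_cpow \<sigma> 0"
  have P: "P \<in> carrier_mat n n" using \<sigma> by (simp add: P_def)
  have \<rho>c: "\<rho> \<in> carrier_mat n n" and \<sigma>c: "\<sigma> \<in> carrier_mat n n" using \<rho> \<sigma> by (auto intro: psd_mat_carrier)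
  define N where "N = 1\<^sub>m n - P"
  have N: "N \<in> carrier_mat n n" unfolding N_def using P by (intro minus_carrier_mat)
  have Nadj: "mat_adjoint N = N"
    unfolding N_def using P by (simp add: adjoint_minus[of _ n n]) (simp add: P_def mat_cpow_adjoint[OF \<sigma>])
  have "\<sigma> * P = \<sigma>"
    using mat_cpow_add[OF \<sigma>, of 1 0] by (simp add: P_def mat_cpow_one[OF \<sigma>])
  then have \<sigma>N: "\<sigma> * N = 0\<^sub>m n n"
    unfolding N_def using \<sigma>c P by (simp add: mult_minus_distrib_mat[of _ n n _ n] minus_r_inv_mat)
  have "N * \<rho> = 0\<^sub>m n n"
  proof (rule eq_matI)
    fix i j assume "i < dim_row (0\<^sub>m n n :: complex mat)" "j < dim_col (0\<^sub>m n n :: complex mat)"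
    then have ij: "i < n" "j < n" by auto
    have "col \<rho> j \<in> mat_supp \<rho>"
      unfolding mat_supp_def
    proof (intro CollectI conjI ballI)
      show "col \<rho> j \<in> carrier_vec (dim_col \<rho>)" using \<rho>c ij by auto
      fix w assume w: "w \<in> mat_kernel \<rho>"
      note w = mat_kernelD[OF \<rho>c w]
      have "col \<rho> j \<bullet>c w = (\<Sum>k<n. cnj (\<rho> $$ (j, k) * w $ k))"
      proof -
        have "\<rho> $$ (k, j) = cnj (\<rho> $$ (j, k))" if "k < n" for k
        proof -
          have "mat_adjoint \<rho> $$ (k, j) = cnj (\<rho> $$ (j, k))" using \<rho>c ij that by simp
          then show ?thesis by (simp add: psd_mat_adjoint[OF \<rho>])
        qed
        then show ?thesis using w(1) \<rho>c ij by (simp add: scalar_prod_def atLeast0LessThan)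
      qed
      also have "\<dots> = cnj ((\<rho> *\<^sub>v w) $ j)"
        using w(1) \<rho>c ij by (simp add: scalar_prod_def atLeast0LessThan)
      finally show "col \<rho> j \<bullet>c w = 0" using w(2) ij by simp
    qed
    then have "col \<rho> j \<in> mat_supp \<sigma>" using supp by blast
    moreover have "col N i \<in> mat_kernel \<sigma>"
    proof (rule mat_kernelI[OF \<sigma>c])
      show "col N i \<in> carrier_vec n" using N ij by auto
      have "\<sigma> *\<^sub>v col N i = col (\<sigma> * N) i" by (rule col_mult2[OF \<sigma>c N ij(1), symmetric])
      then show "\<sigma> *\<^sub>v col N i = 0\<^sub>v n" using ij by (simp add: \<sigma>N)
    qed
    ultimately have 0: "col \<rho> j \<bullet>c col N i = 0" by (auto simp: mat_supp_def)
    have "(N * \<rho>) $$ (i, j) = (\<Sum>k<n. mat_adjoint N $$ (i, k) * \<rho> $$ (k, j))"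
      unfolding Nadj by (rule mult_index_sum) (use N \<rho>c ij in auto)
    also have "\<dots> = col \<rho> j \<bullet>c col N i"
      using N \<rho>c ij by (simp add: scalar_prod_def atLeast0LessThan mult.commute)
    finally show "(N * \<rho>) $$ (i, j) = 0\<^sub>m n n $$ (i, j)" using 0 ij by simp
  qed (use N \<rho>c in auto)
  then have eq: "\<rho> - P * \<rho> = 0\<^sub>m n n"
    unfolding N_def using \<rho>c P by (simp add: minus_mult_distrib_mat[of _ n n _ _ n])
  show ?thesis unfolding P_def[symmetric]
  proof (rule eq_matI)
    fix i j assume ij: "i < dim_row \<rho>" "j < dim_col \<rho>"
    have "(\<rho> - P * \<rho>) $$ (i, j) = 0\<^sub>m n n $$ (i, j)" by (simp only: eq)
    then show "(P * \<rho>) $$ (i, j) = \<rho> $$ (i, j)" using ij \<rho>c P by (simp del: index_mult_mat(1))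
  qed (use \<rho>c P in auto)
qed

section \<open>Diagonal matrices and the classical divergence\<close>

lemma mat_powr_diag: "mat_powr (mat_diag n (\<lambda>i. complex_of_real (f i))) s = mat_diag n (\<lambda>i. complex_of_real (f i powr s))"
proof -
  have sp: "spectral_mat n (1\<^sub>m n) g = mat_diag n g" for g
    by (simp add: spectral_mat_def left_mult_one_mat[of _ n n] right_mult_one_mat[of _ n n])
  have "mat_powr (mat_diag n (\<lambda>i. complex_of_real (f i))) s = spectral_mat n (1\<^sub>m n) (\<lambda>i. complex_of_real (f i powr s))"
    by (rule mat_powr_spectral) (simp_all add: unitary_mat_def sp)
  then show ?thesis by (simp add: sp)
qed

lemma mat_supp_diag_mono:
  assumes "\<And>i. i < n \<Longrightarrow> q i = 0 \<Longrightarrow> p i = (0 :: complex)"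
  shows "mat_supp (mat_diag n p) \<subseteq> mat_supp (mat_diag n q)"
proof -
  have mv: "mat_diag n f *\<^sub>v w = vec n (\<lambda>i. f i * w $ i)" if "w \<in> carrier_vec n" for f :: "nat \<Rightarrow> complex" and w
  proof (rule eq_vecI)
    fix i assume "i < dim_vec (vec n (\<lambda>i. f i * w $ i))"
    then have i: "i < n" by simp
    then have "(mat_diag n f *\<^sub>v w) $ i = (\<Sum>k<n. mat_diag n f $$ (i, k) * w $ k)"
      using that by (simp add: scalar_prod_def atLeast0LessThan)
    also have "\<dots> = (\<Sum>k<n. if k = i then f k * w $ k else 0)"
      using i by (intro sum.cong) (auto simp: mat_diag_def)
    finally show "(mat_diag n f *\<^sub>v w) $ i = vec n (\<lambda>i. f i * w $ i) $ i" using i by simp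
  qed simp
  have "mat_kernel (mat_diag n q) \<subseteq> mat_kernel (mat_diag n p)"
  proof
    fix w assume "w \<in> mat_kernel (mat_diag n q)"
    then have w: "w \<in> carrier_vec n" "vec n (\<lambda>i. q i * w $ i) = 0\<^sub>v n"
      using mat_kernelD[OF mat_diag_dim, of w n q] by (auto simp: mv)
    have "p i * w $ i = 0" if "i < n" for i
    proof -
      have "vec n (\<lambda>i. q i * w $ i) $ i = 0\<^sub>v n $ i" by (simp only: w(2))
      then show ?thesis using assms[OF that] that by auto
    qed
    then show "w \<in> mat_kernel (mat_diag n p)"
      using w(1) by (intro mat_kernelI[OF mat_diag_dim]) (auto simp: mv intro!: eq_vecI)
  qed
  then show ?thesis by (auto simp: mat_supp_def)
qed

text \<open>Diagonal matrices commute, so the sandwich collapses to the classical sum. For \<alpha>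
  > 1 an outcome with \<open>q i = 0\<close> contributes 0 by the convention on powers of 0, and
  \<open>ac\<close>, which is the inclusion of supports, keeps the divergence on its finite
  branch.\<close>

lemma renyi_real_diag:
  assumes \<alpha>: "0 < \<alpha>" and p: "\<And>i. i < n \<Longrightarrow> 0 \<le> p i" and q: "\<And>i. i < n \<Longrightarrow> 0 \<le> q i"
    and ac: "\<And>i. 1 \<le> \<alpha> \<Longrightarrow> i < n \<Longrightarrow> q i = 0 \<Longrightarrow> p i = 0"
  shows "renyi_real \<alpha> (mat_diag n (\<lambda>i. complex_of_real (p i))) (mat_diag n (\<lambda>i. complex_of_real (q i)))
    = ereal (1 / (\<alpha> - 1)) * elog2 (\<Sum>i<n. p i powr \<alpha> * q i powr (1 - \<alpha>))"
proof -
  define s where "s = (1 - \<alpha>) / (2 * \<alpha>)"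
  have pw: "(q i powr s * p i * q i powr s) powr \<alpha> = p i powr \<alpha> * q i powr (1 - \<alpha>)" if "i < n" for i
  proof -
    have "q i powr (2 * s) = q i powr s * q i powr s" by (simp flip: powr_add)
    then have "(q i powr s * p i * q i powr s) powr \<alpha> = (p i * q i powr (2 * s)) powr \<alpha>"
      by (simp only: mult_ac)
    also have "\<dots> = p i powr \<alpha> * (q i powr (2 * s)) powr \<alpha>" by (rule powr_mult)
    also have "\<dots> = p i powr \<alpha> * q i powr (1 - \<alpha>)"
    proof -
      have "2 * s * \<alpha> = 1 - \<alpha>" using \<alpha> by (simp add: s_def)
      then show ?thesis by (simp only: powr_powr)
    qed
    finally show ?thesis .
  qed
  have "mat_powr (mat_diag n (\<lambda>i. complex_of_real (q i))) s * mat_diag n (\<lambda>i. complex_of_real (p i)) * mat_powr (mat_diag n (\<lambda>i. complex_of_real (q i))) s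
    = mat_diag n (\<lambda>i. complex_of_real (q i powr s * p i * q i powr s))"
    by (simp add: mat_powr_diag)
  then have "mat_trace (mat_powr (mat_powr (mat_diag n (\<lambda>i. complex_of_real (q i))) s * mat_diag n (\<lambda>i. complex_of_real (p i)) * mat_powr (mat_diag n (\<lambda>i. complex_of_real (q i))) s) \<alpha>)
    = (\<Sum>i<n. complex_of_real (p i powr \<alpha> * q i powr (1 - \<alpha>)))"
    by (simp only: mat_powr_diag) (auto simp: mat_trace_def mat_diag_def pw intro!: sum.cong)
  moreover have "\<alpha> < 1 \<or> mat_supp (mat_diag n (\<lambda>i. complex_of_real (p i))) \<subseteq> mat_supp (mat_diag n (\<lambda>i. complex_of_real (q i)))"
  proof (cases "\<alpha> < 1")
    case False
    then show ?thesis using ac by (intro disjI2 mat_supp_diag_mono) auto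
  qed simp
  ultimately show ?thesis unfolding renyi_real_def Let_def s_def[symmetric] by simp
qed

section \<open>Measurements and extensions\<close>

lemma povm_psd: "povm d n M \<Longrightarrow> x < n \<Longrightarrow> psd_mat d (M x)"
  by (simp add: povm_def)

lemma povm_trace_sum:
  assumes "povm d n M" "Y \<in> carrier_mat d d"
  shows "(\<Sum>x<n. mat_trace (M x * Y)) = mat_trace Y"
proof -
  have Mc: "M x \<in> carrier_mat d d" if "x < n" for x using povm_psd[OF assms(1) that] by (rule psd_mat_carrier)
  have one: "(\<Sum>x<n. M x $$ (i, j)) = 1\<^sub>m d $$ (i, j)" if "i < d" "j < d" for i j
  proof -
    have "mat d d (\<lambda>(i, j). \<Sum>x<n. M x $$ (i, j)) $$ (i, j) = 1\<^sub>m d $$ (i, j)"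
      using assms(1) by (simp only: povm_def)
    then show ?thesis using that by simp
  qed
  have "(\<Sum>x<n. mat_trace (M x * Y)) = (\<Sum>x<n. \<Sum>i<d. \<Sum>j<d. M x $$ (i, j) * Y $$ (j, i))"
    using Mc assms(2) by (intro sum.cong) (auto simp: trace_mult_sum)
  also have "\<dots> = (\<Sum>i<d. \<Sum>j<d. \<Sum>x<n. M x $$ (i, j) * Y $$ (j, i))"
    by (subst sum.swap) (intro sum.cong refl sum.swap)
  also have "\<dots> = (\<Sum>i<d. \<Sum>j<d. 1\<^sub>m d $$ (i, j) * Y $$ (j, i))"
    by (intro sum.cong refl) (simp add: one flip: sum_distrib_right)
  also have "\<dots> = mat_trace (1\<^sub>m d * Y)"
    by (rule trace_mult_sum[symmetric]) (use assms in auto)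
  finally show ?thesis using assms(2) by simp
qed

lemma povm_channel_psd:
  assumes "povm d n M" "psd_mat d \<rho>"
  shows "povm_channel n M \<rho> = mat_diag n (\<lambda>x. complex_of_real (Re (mat_trace (M x * \<rho>))))"
  unfolding povm_channel_def
  by (rule eq_matI) (use trace_psd_nonneg(2)[OF povm_psd[OF assms(1)] assms(2)] in \<open>auto simp: mat_diag_def complex_eq_iff\<close>)

lemma povm_ampl:
  assumes "povm dA n M" shows "povm (dA * dB) n (\<lambda>x. ampl dA dB (M x))"
  unfolding povm_def
proof (intro conjI allI impI)
  show "psd_mat (dA * dB) (ampl dA dB (M x))" if "x < n" for x
    using psd_mat_ampl[OF povm_psd[OF assms that]] .
  have one: "(\<Sum>x<n. M x $$ (i, j)) = 1\<^sub>m dA $$ (i, j)" if "i < dA" "j < dA" for i j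
  proof -
    have "mat dA dA (\<lambda>(i, j). \<Sum>x<n. M x $$ (i, j)) $$ (i, j) = 1\<^sub>m dA $$ (i, j)"
      using assms by (simp only: povm_def)
    then show ?thesis using that by simp
  qed
  show "mat (dA * dB) (dA * dB) (\<lambda>(i, j). \<Sum>x<n. ampl dA dB (M x) $$ (i, j)) = 1\<^sub>m (dA * dB)"
    unfolding ampl_one[symmetric]
  proof (rule eq_pair_matI)
    fix a k b l assume *: "a < dA" "k < dB" "b < dA" "l < dB"
    then show "mat (dA * dB) (dA * dB) (\<lambda>(i, j). \<Sum>x<n. ampl dA dB (M x) $$ (i, j)) $$ (a * dB + k, b * dB + l)
      = ampl dA dB (1\<^sub>m dA) $$ (a * dB + k, b * dB + l)"
      using one[of a b] by (simp add: pair_index_less ampl_index)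
  qed auto
qed

lemma povm_channel_ampl:
  assumes "povm dA n M" "Y \<in> carrier_mat (dA * dB) (dA * dB)"
  shows "povm_channel n (\<lambda>x. ampl dA dB (M x)) Y = povm_channel n M (ptrace_B dA dB Y)"
proof -
  have "mat_trace (ampl dA dB (M x) * Y) = mat_trace (M x * ptrace_B dA dB Y)" if "x < n" for x
    using psd_mat_carrier[OF povm_psd[OF assms(1) that]] assms(2)
    by (simp add: ptrace_ampl_mult(1)[symmetric] trace_ptrace)
  then show ?thesis unfolding povm_channel_def by (intro eq_matI) (auto simp: mat_diag_def)
qed

lemma measured_renyi_ptrace_le:
  assumes "\<rho> \<in> carrier_mat (dA * dB) (dA * dB)" "\<tau> \<in> extensions dA dB \<sigma>"
  shows "measured_renyi \<alpha> (ptrace_B dA dB \<rho>) \<sigma> \<le> measured_renyi \<alpha> \<rho> \<tau>"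
  unfolding measured_renyi_def
proof (rule Sup_subset_mono, rule subsetI)
  have \<tau>: "\<tau> \<in> carrier_mat (dA * dB) (dA * dB)" "ptrace_B dA dB \<tau> = \<sigma>"
    using assms(2) by (auto simp: extensions_def density_mats_def intro: psd_mat_carrier)
  fix y assume "y \<in> {renyi_div \<alpha> (povm_channel n M (ptrace_B dA dB \<rho>)) (povm_channel n M \<sigma>) | n M. povm (dim_row (ptrace_B dA dB \<rho>)) n M}"
  then obtain n M where M: "povm dA n M" "y = renyi_div \<alpha> (povm_channel n M (ptrace_B dA dB \<rho>)) (povm_channel n M \<sigma>)"
    by auto
  let ?M = "\<lambda>x. ampl dA dB (M x)"
  have "y = renyi_div \<alpha> (povm_channel n ?M \<rho>) (povm_channel n ?M \<tau>)"
    unfolding M(2) povm_channel_ampl[OF M(1) assms(1)] povm_channel_ampl[OF M(1) \<tau>(1)] \<tau>(2) ..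
  moreover have "povm (dim_row \<rho>) n ?M" using povm_ampl[OF M(1)] assms(1) by simp
  ultimately show "y \<in> {renyi_div \<alpha> (povm_channel n M \<rho>) (povm_channel n M \<tau>) | n M. povm (dim_row \<rho>) n M}"
    by blast
qed

text \<open>The missing part of the marginal is added in product with the maximally mixed state. As
  this addition is positive, all outcome probabilities can only grow, so lower bounds on the traces
  against \<tau> survive.\<close>

lemma extension_completion:
  assumes dB: "0 < dB" and \<tau>: "psd_mat (dA * dB) \<tau>" and \<sigma>: "\<sigma> \<in> density_mats dA"
    and le: "psd_mat dA (\<sigma> - ptrace_B dA dB \<tau>)"
  defines "\<tau>' \<equiv> \<tau> + complex_of_real (1 / real dB) \<cdot>\<^sub>m ampl dA dB (\<sigma> - ptrace_B dA dB \<tau>)"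
  shows "\<tau>' \<in> extensions dA dB \<sigma>" "psd_mat (dA * dB) (\<tau>' - \<tau>)"
proof -
  let ?D = "\<sigma> - ptrace_B dA dB \<tau>" and ?N = "dA * dB"
  let ?E = "complex_of_real (1 / real dB) \<cdot>\<^sub>m ampl dA dB ?D"
  have \<sigma>c: "\<sigma> \<in> carrier_mat dA dA" using \<sigma> by (auto simp: density_mats_def intro: psd_mat_carrier)
  have \<tau>c: "\<tau> \<in> carrier_mat ?N ?N" by (rule psd_mat_carrier[OF \<tau>])
  have Dc: "?D \<in> carrier_mat dA dA" by (rule psd_mat_carrier[OF le])
  have E: "psd_mat ?N ?E" by (intro psd_mat_smult psd_mat_ampl le) simp
  note Ec = psd_mat_carrier[OF E]
  have "\<tau>' - \<tau> = ?E" unfolding \<tau>'_def using \<tau>c Ec by (intro eq_matI) auto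
  then show "psd_mat ?N (\<tau>' - \<tau>)" using E by simp
  have \<tau>': "psd_mat ?N \<tau>'" unfolding \<tau>'_def by (rule psd_mat_add[OF \<tau> E])
  have "ptrace_B dA dB ?E = complex_of_real (1 / real dB) \<cdot>\<^sub>m (of_nat dB \<cdot>\<^sub>m ?D)"
    by (simp only: ptrace_smult[OF ampl_carrier] ptrace_ampl[OF Dc])
  also have "\<dots> = ?D" using dB by (intro eq_matI) auto
  finally have "ptrace_B dA dB ?E = ?D" .
  then have "ptrace_B dA dB \<tau>' = ptrace_B dA dB \<tau> + ?D"
    unfolding \<tau>'_def by (simp only: ptrace_add[OF \<tau>c Ec])
  also have "\<dots> = \<sigma>" using \<sigma>c by (intro eq_matI) auto
  finally have pt: "ptrace_B dA dB \<tau>' = \<sigma>" .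
  have "mat_trace \<tau>' = mat_trace \<sigma>"
    using trace_ptrace[OF psd_mat_carrier[OF \<tau>']] pt by simp
  then show "\<tau>' \<in> extensions dA dB \<sigma>" using \<tau>' pt \<sigma> by (simp add: extensions_def density_mats_def)
qed

lemma D_max_diag_le:
  assumes "\<And>i. i < n \<Longrightarrow> p i \<le> 2 powr l * q i"
  shows "D_max (mat_diag n (\<lambda>i. complex_of_real (p i))) (mat_diag n (\<lambda>i. complex_of_real (q i))) \<le> ereal l"
  unfolding D_max_def
proof (rule Inf_lower)
  have "complex_of_real (2 powr l) \<cdot>\<^sub>m mat_diag n (\<lambda>i. complex_of_real (q i)) - mat_diag n (\<lambda>i. complex_of_real (p i))
    = mat_diag n (\<lambda>i. complex_of_real (2 powr l * q i - p i))"
    by (rule eq_matI) (auto simp: mat_diag_def)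
  moreover have "psd_mat n (mat_diag n (\<lambda>i. complex_of_real (2 powr l * q i - p i)))"
    by (rule psd_mat_diag) (use assms in auto)
  ultimately show "ereal l \<in> {ereal l |l. psd_mat (dim_row (mat_diag n (\<lambda>i. complex_of_real (q i))))
      (complex_of_real (2 powr l) \<cdot>\<^sub>m mat_diag n (\<lambda>i. complex_of_real (q i)) - mat_diag n (\<lambda>i. complex_of_real (p i)))}"
    by auto
qed

text \<open>Every feasible exponent \<open>l\<close> gets its own extension, so the infimum defining
  \<open>D_max\<close> is compared term by term. The extension dominates \<open>2 powr - l\<close>
  times \<rho>, and this operator inequality passes to each outcome.\<close>

lemma measured_renyi_set_D_max_le:
  assumes dB: "0 < dB" and \<rho>: "\<rho> \<in> density_mats (dA * dB)" and \<sigma>: "\<sigma> \<in> density_mats dA"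
  shows "measured_renyi_set \<infinity> \<rho> (extensions dA dB \<sigma>) \<le> D_max (ptrace_B dA dB \<rho>) \<sigma>"
  unfolding D_max_def[of "ptrace_B dA dB \<rho>"]
proof (rule Inf_greatest)
  fix y assume "y \<in> {ereal l |l. psd_mat (dim_row \<sigma>) (complex_of_real (2 powr l) \<cdot>\<^sub>m \<sigma> - ptrace_B dA dB \<rho>)}"
  moreover have \<sigma>c: "\<sigma> \<in> carrier_mat dA dA" using \<sigma> by (auto simp: density_mats_def intro: psd_mat_carrier)
  ultimately obtain l where y: "y = ereal l" and l: "psd_mat dA (complex_of_real (2 powr l) \<cdot>\<^sub>m \<sigma> - ptrace_B dA dB \<rho>)"
    by auto
  have \<rho>p: "psd_mat (dA * dB) \<rho>" using \<rho> by (simp add: density_mats_def)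
  note \<rho>c = psd_mat_carrier[OF \<rho>p]
  define \<tau>0 where "\<tau>0 = complex_of_real (2 powr - l) \<cdot>\<^sub>m \<rho>"
  have \<tau>0: "psd_mat (dA * dB) \<tau>0" unfolding \<tau>0_def by (intro psd_mat_smult \<rho>p) simp
  have "\<sigma> - ptrace_B dA dB \<tau>0 = complex_of_real (2 powr - l) \<cdot>\<^sub>m (complex_of_real (2 powr l) \<cdot>\<^sub>m \<sigma> - ptrace_B dA dB \<rho>)"
    unfolding \<tau>0_def ptrace_smult[OF \<rho>c] using \<sigma>c
    by (intro eq_matI) (auto simp: right_diff_distrib powr_minus field_simps)
  then have "psd_mat dA (\<sigma> - ptrace_B dA dB \<tau>0)" by (simp add: psd_mat_smult[OF l])
  then obtain \<tau> where \<tau>: "\<tau> \<in> extensions dA dB \<sigma>" and ge: "psd_mat (dA * dB) (\<tau> - \<tau>0)"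
    using extension_completion[OF dB \<tau>0 \<sigma>] by blast
  have \<tau>p: "psd_mat (dA * dB) \<tau>" using \<tau> by (simp add: extensions_def density_mats_def)
  note \<tau>c = psd_mat_carrier[OF \<tau>p] and \<tau>0c = psd_mat_carrier[OF \<tau>0]
  have "measured_renyi \<infinity> \<rho> \<tau> \<le> ereal l"
    unfolding measured_renyi_def
  proof (rule Sup_least)
    fix z assume "z \<in> {renyi_div \<infinity> (povm_channel n M \<rho>) (povm_channel n M \<tau>) | n M. povm (dim_row \<rho>) n M}"
    then obtain n M where M: "povm (dA * dB) n M" and z: "z = D_max (povm_channel n M \<rho>) (povm_channel n M \<tau>)"
      using \<rho>c by (auto simp: renyi_div_def)
    show "z \<le> ereal l"
      unfolding z povm_channel_psd[OF M \<rho>p] povm_channel_psd[OF M \<tau>p]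
    proof (rule D_max_diag_le)
      fix x assume x: "x < n"
      note Mp = povm_psd[OF M x] and Mc = psd_mat_carrier[OF povm_psd[OF M x]]
      have "mat_trace (M x * (\<tau> - \<tau>0)) = mat_trace (M x * \<tau>) - mat_trace (M x * \<tau>0)"
        using Mc \<tau>c \<tau>0c by (simp add: mult_minus_distrib_mat[of _ "dA * dB" "dA * dB" _ "dA * dB"] trace_minus[of _ "dA * dB"])
      then have "Re (mat_trace (M x * \<tau>0)) \<le> Re (mat_trace (M x * \<tau>))"
        using trace_psd_nonneg(1)[OF Mp ge] by simp
      moreover have "M x * \<tau>0 = complex_of_real (2 powr - l) \<cdot>\<^sub>m (M x * \<rho>)"
        unfolding \<tau>0_def by (rule mult_smult_distrib[OF Mc \<rho>c])
      then have "mat_trace (M x * \<tau>0) = complex_of_real (2 powr - l) * mat_trace (M x * \<rho>)"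
        using Mc \<rho>c by (simp add: trace_smult[of _ "dA * dB"])
      ultimately have "2 powr - l * Re (mat_trace (M x * \<rho>)) \<le> Re (mat_trace (M x * \<tau>))" by simp
      then have "2 powr l * (2 powr - l * Re (mat_trace (M x * \<rho>))) \<le> 2 powr l * Re (mat_trace (M x * \<tau>))"
        by (intro mult_left_mono) auto
      then show "Re (mat_trace (M x * \<rho>)) \<le> 2 powr l * Re (mat_trace (M x * \<tau>))"
      proof -
        have one: "2 powr l * 2 powr - l = (1 :: real)" by (simp flip: powr_add)
        show ?thesis
          using \<open>2 powr l * (2 powr - l * Re (mat_trace (M x * \<rho>))) \<le> _\<close>
          by (simp only: mult.assoc[symmetric] one mult_1_left)
      qed
    qed
  qed
  then show "measured_renyi_set \<infinity> \<rho> (extensions dA dB \<sigma>) \<le> y"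
    unfolding measured_renyi_set_def y using \<tau> by (rule INF_lower2[rotated])
qed

section \<open>The interpolating family\<close>

lemma psd_trace_real:
  assumes "psd_mat n A" shows "mat_trace A = of_real (Re (mat_trace A))"
  using trace_psd_nonneg(2)[OF psd_mat_one assms] left_mult_one_mat[OF psd_mat_carrier[OF assms]]
  by (simp add: complex_eq_iff)

text \<open>The family \<open>L z\<close> interpolates: its conjugation takes \<open>\<rho>\<^sub>A\<close> to a matrix of trace \<open>tr (X\<^sup>\<alpha>)\<close> on
  the line \<open>Re z = 0\<close> and to a matrix below \<open>\<sigma>\<close> on the line \<open>Re z = 1\<close>.\<close>

locale renyi_interpolation =
  fixes dA dB :: nat and \<rho> \<sigma> :: "complex mat" and \<alpha> :: real
  assumes dB: "0 < dB" and \<rho>: "psd_mat (dA * dB) \<rho>" and \<sigma>: "psd_mat dA \<sigma>"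
    and \<alpha>: "1 / 2 \<le> \<alpha>" "\<alpha> \<noteq> 1"
    and supp: "1 < \<alpha> \<Longrightarrow> mat_cpow \<sigma> 0 * ptrace_B dA dB \<rho> = ptrace_B dA dB \<rho>"
begin

text \<open>\<open>- r / 2\<close> is the exponent \<open>(1 - \<alpha>) / (2 * \<alpha>)\<close> of
  the sandwiched divergence, and \<open>r\<close> has the sign of \<open>\<alpha> - 1\<close>. At
  the point \<open>\<theta> = \<bar>r\<bar>\<close> the outer factor of \<open>L\<close> is
  therefore the inverse of \<open>S\<close> on the support of \<sigma> if \<alpha> > 1, and
  \<open>S\<close> itself if \<alpha> < 1.\<close>

definition r where "r = (\<alpha> - 1) / \<alpha>"
definition \<theta> where "\<theta> = \<bar>r\<bar>"
definition \<rho>A where "\<rho>A = ptrace_B dA dB \<rho>"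
definition S where "S = mat_cpow \<sigma> (of_real (- r / 2))"
definition X where "X = S * \<rho>A * S"
text \<open>Both exponents are written in the affine form \<open>a + of_real b * z\<close> of
  \<open>exp_poly_mat_cpow\<close>. Twice the real part of the exponent of \<open>X\<close>, plus 1,
  is \<open>\<alpha> * (1 - Re z)\<close>.\<close>

definition L where "L z = mat_cpow \<sigma> (0 + of_real (1 / 2) * z) * (mat_cpow X (of_real ((\<alpha> - 1) / 2) + of_real (- \<alpha> / 2) * z) * S)"
definition R where "R z = ampl dA dB (L z) * \<rho> * mat_adjoint (ampl dA dB (L z))"
definition Q where "Q = Re (mat_trace (mat_cpow X (of_real \<alpha>)))"

lemma \<alpha>_pos: "0 < \<alpha>" using \<alpha> by simp

lemma r_eq: "\<alpha> * r = \<alpha> - 1" using \<alpha>_pos by (simp add: r_def)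

lemma \<theta>_pos: "0 < \<theta>" using \<alpha> by (simp add: \<theta>_def r_def)

lemma \<theta>_gt: "1 < \<alpha> \<Longrightarrow> \<theta> = r \<and> \<theta> < 1" by (simp add: \<theta>_def r_def field_simps)

text \<open>The inequality amounts to \<open>1 - \<alpha> \<le> \<alpha>\<close>: the lower limit
  1/2 for \<alpha> keeps \<theta> in the closed strip, and it is exactly where \<theta> = 1.\<close>

lemma \<theta>_lt: "\<alpha> < 1 \<Longrightarrow> \<theta> = - r \<and> \<theta> \<le> 1"
  using \<alpha> by (simp add: \<theta>_def r_def field_simps)

lemma \<theta>_le_1: "\<theta> \<le> 1" using \<theta>_gt \<theta>_lt \<alpha>(2) by (cases "\<alpha> < 1") auto

lemma \<rho>A: "psd_mat dA \<rho>A" unfolding \<rho>A_def by (rule psd_mat_ptrace[OF \<rho>])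

lemma S_carrier: "S \<in> carrier_mat dA dA" using \<sigma> by (simp add: S_def)

lemma S_adjoint: "mat_adjoint S = S" by (simp only: S_def mat_cpow_adjoint[OF \<sigma>] complex_cnj_complex_of_real)

lemma X: "psd_mat dA X"
  using psd_mat_congruence[OF \<rho>A S_carrier] by (simp add: X_def S_adjoint)

lemmas carriers = mat_cpow_carrier[OF \<sigma>] mat_cpow_carrier[OF X] S_carrier psd_mat_carrier[OF \<rho>A]

lemma L_carrier: "L z \<in> carrier_mat dA dA" unfolding L_def by (intro square_mult_carrier carriers)

lemma exp_poly_L: "exp_poly_mat dA L"
  unfolding L_def[abs_def] by (intro exp_poly_mat_mult exp_poly_mat_cpow exp_poly_mat_const \<sigma> X S_carrier)

lemma S_\<rho>A_S: "Y \<in> carrier_mat dA dA \<Longrightarrow> S * (\<rho>A * (S * Y)) = X * Y"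
  unfolding X_def using carriers by (simp add: square_assoc[of _ dA])

lemma cpow_mult_cpow_mult: "psd_mat n A \<Longrightarrow> Y \<in> carrier_mat n n \<Longrightarrow> mat_cpow A u * (mat_cpow A v * Y) = mat_cpow A (u + v) * Y"
  by (simp add: mat_cpow_add flip: square_assoc[of _ n])

lemma ptrace_R: "ptrace_B dA dB (R z) = L z * \<rho>A * mat_adjoint (L z)"
proof -
  note \<rho>c = psd_mat_carrier[OF \<rho>]
  have "ptrace_B dA dB (ampl dA dB (L z) * \<rho> * ampl dA dB (mat_adjoint (L z)))
    = ptrace_B dA dB (ampl dA dB (L z) * \<rho>) * mat_adjoint (L z)"
    by (rule ptrace_ampl_mult(2)) (use \<rho>c L_carrier in auto)
  then show ?thesis
    unfolding R_def \<rho>A_def ampl_adjoint[OF L_carrier] ptrace_ampl_mult(1)[OF \<rho>c L_carrier] .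
qed

text \<open>The inner factors combine to \<open>S * \<rho>A * S = X\<close> between powers of
  \<open>X\<close> with exponents \<open>u\<close> and \<open>cnj u\<close>. In
  \<open>u + 1 + cnj u\<close> the imaginary parts cancel, so only outer unitary-like powers of
  \<sigma> depend on the height.\<close>

lemma L_\<rho>A_L: "L z * \<rho>A * mat_adjoint (L z) = mat_cpow \<sigma> (z / 2) * (mat_cpow X (of_real (\<alpha> * (1 - Re z))) * mat_cpow \<sigma> (cnj z / 2))"
proof -
  define u where "u = of_real ((\<alpha> - 1) / 2) + of_real (- \<alpha> / 2) * z"
  have uu: "u + (1 + cnj u) = of_real (\<alpha> * (1 - Re z))"
    by (simp add: u_def complex_eq_iff) (simp add: field_simps)
  have L: "L z = mat_cpow \<sigma> (z / 2) * (mat_cpow X u * S)" by (simp add: L_def u_def)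
  have Ladj: "mat_adjoint (L z) = S * (mat_cpow X (cnj u) * mat_cpow \<sigma> (cnj z / 2))"
    unfolding L using carriers
    by (simp add: square_adjoint_mult[of _ dA] square_assoc[of _ dA] mat_cpow_adjoint[OF \<sigma>] mat_cpow_adjoint[OF X] S_adjoint)
  have "L z * \<rho>A * mat_adjoint (L z)
    = mat_cpow \<sigma> (z / 2) * (mat_cpow X u * (S * (\<rho>A * (S * (mat_cpow X (cnj u) * mat_cpow \<sigma> (cnj z / 2))))))"
    unfolding Ladj unfolding L using carriers by (simp add: square_assoc[of _ dA])
  also have "\<dots> = mat_cpow \<sigma> (z / 2) * (mat_cpow X u * (mat_cpow X 1 * (mat_cpow X (cnj u) * mat_cpow \<sigma> (cnj z / 2))))"
    using carriers by (simp add: S_\<rho>A_S mat_cpow_one[OF X])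
  also have "\<dots> = mat_cpow \<sigma> (z / 2) * (mat_cpow X (u + (1 + cnj u)) * mat_cpow \<sigma> (cnj z / 2))"
    using carriers by (simp add: cpow_mult_cpow_mult[OF X])
  finally show ?thesis unfolding uu .
qed

lemma R_psd: "psd_mat (dA * dB) (R z)"
  unfolding R_def by (rule psd_mat_congruence[OF \<rho> ampl_carrier])

lemma cpow_\<sigma>_zero_X: "mat_cpow \<sigma> 0 * X = X"
proof -
  have "mat_cpow \<sigma> 0 * X = (mat_cpow \<sigma> 0 * S) * (\<rho>A * S)"
    unfolding X_def using carriers by (simp add: square_assoc[of _ dA])
  also have "mat_cpow \<sigma> 0 * S = S" unfolding S_def mat_cpow_add[OF \<sigma>] by simp
  finally show ?thesis unfolding X_def using carriers by (simp add: square_assoc[of _ dA])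
qed

text \<open>The outer powers of \<sigma> have opposite imaginary exponents. By cyclicity they meet
  and give the support projection of \<sigma>, which \<open>X\<close> absorbs because
  \<open>S\<close> does. The trace does not depend on \<open>t\<close>, and this makes the left
  averages add up to \<open>Q\<close>.\<close>

lemma trace_R_left: "mat_trace (R (of_real 0 + \<i> * of_real t)) = of_real Q"
proof -
  let ?z = "of_real 0 + \<i> * of_real t"
  have X\<alpha>: "mat_cpow X (of_real \<alpha>) = X * mat_cpow X (of_real (\<alpha> - 1))"
    using mat_cpow_add[OF X, of 1 "of_real (\<alpha> - 1)"] by (simp add: mat_cpow_one[OF X])
  have "mat_trace (R ?z) = mat_trace (L ?z * \<rho>A * mat_adjoint (L ?z))"
    using trace_ptrace[OF psd_mat_carrier[OF R_psd]] by (simp only: ptrace_R)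
  also have "\<dots> = mat_trace (mat_cpow \<sigma> (?z / 2) * (mat_cpow X (of_real \<alpha>) * mat_cpow \<sigma> (cnj ?z / 2)))"
    unfolding L_\<rho>A_L by simp
  also have "\<dots> = mat_trace (mat_cpow X (of_real \<alpha>) * (mat_cpow \<sigma> (cnj ?z / 2) * mat_cpow \<sigma> (?z / 2)))"
    by (subst trace_comm[of _ dA]) (use carriers in \<open>simp_all add: square_assoc[of _ dA]\<close>)
  also have "mat_cpow \<sigma> (cnj ?z / 2) * mat_cpow \<sigma> (?z / 2) = mat_cpow \<sigma> 0"
    unfolding mat_cpow_add[OF \<sigma>] by simp
  also have "mat_trace (mat_cpow X (of_real \<alpha>) * mat_cpow \<sigma> 0) = mat_trace (mat_cpow \<sigma> 0 * mat_cpow X (of_real \<alpha>))"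
    by (rule trace_comm) (use carriers in auto)
  also have "mat_cpow \<sigma> 0 * mat_cpow X (of_real \<alpha>) = mat_cpow X (of_real \<alpha>)"
    unfolding X\<alpha> using carriers psd_mat_carrier[OF X]
    by (simp add: cpow_\<sigma>_zero_X flip: square_assoc[of _ dA])
  also have "mat_trace (mat_cpow X (of_real \<alpha>)) = of_real Q"
    unfolding Q_def by (rule psd_trace_real[OF psd_mat_cpow[OF X]])
  finally show ?thesis .
qed

text \<open>With the support projection \<open>P\<close> of \<open>X\<close> and \<open>C\<close>
  the power of \<sigma> with exponent \<open>z / 2\<close>, one has
  \<open>\<sigma> = C * mat_adjoint C\<close> and the marginal of \<open>R z\<close> is
  \<open>C * P * mat_adjoint C\<close>. The difference is a congruence of the projection
  \<open>1 - P\<close>.\<close>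

lemma \<sigma>_minus_ptrace_R_right: "psd_mat dA (\<sigma> - ptrace_B dA dB (R (of_real 1 + \<i> * of_real t)))"
proof -
  let ?z = "of_real 1 + \<i> * of_real t"
  define P where "P = mat_cpow X 0"
  define C where "C = mat_cpow \<sigma> (?z / 2)"
  have Pc: "P \<in> carrier_mat dA dA" and Cc: "C \<in> carrier_mat dA dA" using carriers by (auto simp: P_def C_def)
  have Padj: "mat_adjoint P = P" and PP: "P * P = P" by (simp_all add: P_def mat_cpow_adjoint[OF X] mat_cpow_add[OF X])
  have Cadj: "mat_adjoint C = mat_cpow \<sigma> (cnj ?z / 2)" by (simp add: C_def mat_cpow_adjoint[OF \<sigma>])
  have \<sigma>eq: "\<sigma> = C * mat_adjoint C"
  proof -
    have "?z / 2 + cnj ?z / 2 = 1" by (simp add: complex_eq_iff)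
    then have "C * mat_adjoint C = mat_cpow \<sigma> 1"
      unfolding Cadj unfolding C_def mat_cpow_add[OF \<sigma>] by (simp only:)
    then show ?thesis by (simp add: mat_cpow_one[OF \<sigma>])
  qed
  have Nc: "1\<^sub>m dA - P \<in> carrier_mat dA dA" using Pc by (rule minus_carrier_mat)
  have "(1\<^sub>m dA - P) * mat_adjoint (1\<^sub>m dA - P) = (1\<^sub>m dA - P) * (1\<^sub>m dA - P)"
    using Pc by (simp add: adjoint_minus[of _ dA dA] Padj)
  also have "\<dots> = (1\<^sub>m dA - P) * 1\<^sub>m dA - (1\<^sub>m dA - P) * P"
    by (rule mult_minus_distrib_mat[OF Nc _ Pc]) simp
  also have "\<dots> = 1\<^sub>m dA - P"
  proof -
    have "(1\<^sub>m dA - P) * P = 0\<^sub>m dA dA"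
      using Pc by (simp add: minus_mult_distrib_mat[of _ dA dA _ _ dA] PP minus_r_inv_mat left_mult_one_mat[of _ dA dA])
    then show ?thesis unfolding right_mult_one_mat[OF Nc] using Pc by (intro eq_matI) auto
  qed
  finally have "psd_mat dA (1\<^sub>m dA - P)" using psd_mat_mult_adjoint[OF Nc] by simp
  from psd_mat_congruence[OF this Cc]
  have "psd_mat dA (C * (1\<^sub>m dA - P) * mat_adjoint C)" .
  also have "C * (1\<^sub>m dA - P) * mat_adjoint C = \<sigma> - C * (P * mat_adjoint C)"
  proof -
    have "C * (1\<^sub>m dA - P) = C - C * P"
      using mult_minus_distrib_mat[OF Cc _ Pc, of "1\<^sub>m dA"] Cc by simp
    then have "C * (1\<^sub>m dA - P) * mat_adjoint C = C * mat_adjoint C - (C * P) * mat_adjoint C"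
      using Cc Pc by (simp add: minus_mult_distrib_mat[of _ dA dA _ _ dA])
    then show ?thesis unfolding \<sigma>eq[symmetric] using Cc Pc by (simp add: square_assoc[of _ dA])
  qed
  also have "C * (P * mat_adjoint C) = ptrace_B dA dB (R ?z)"
    unfolding ptrace_R L_\<rho>A_L Cadj by (simp add: C_def P_def)
  finally show ?thesis .
qed

text \<open>At \<theta> the matrix \<open>L\<close> fixes the marginal by the support assumption.
  That its amplification fixes \<rho> itself follows because the defect has trace 0, and a positive
  matrix of trace 0 vanishes.\<close>

lemma R_\<theta>_gt:
  assumes "1 < \<alpha>" shows "R (of_real \<theta>) = \<rho>"
proof -
  note \<rho>c = psd_mat_carrier[OF \<rho>] and \<rho>Ac = psd_mat_carrier[OF \<rho>A]
  let ?L = "L (of_real \<theta>)" and ?N = "dA * dB"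
  have Lc: "?L \<in> carrier_mat dA dA" by (rule L_carrier)
  have P\<rho>: "mat_cpow \<sigma> 0 * \<rho>A = \<rho>A" using supp[OF assms] by (simp add: \<rho>A_def)
  have \<rho>P: "\<rho>A * mat_cpow \<sigma> 0 = \<rho>A"
  proof -
    have "mat_adjoint (mat_cpow \<sigma> 0 * \<rho>A) = \<rho>A * mat_cpow \<sigma> 0"
      using carriers by (simp add: square_adjoint_mult[of _ dA] psd_mat_adjoint[OF \<rho>A] mat_cpow_adjoint[OF \<sigma>])
    then show ?thesis unfolding P\<rho> psd_mat_adjoint[OF \<rho>A] by simp
  qed
  define T where "T = mat_cpow \<sigma> (of_real (r / 2))"
  have Tc: "T \<in> carrier_mat dA dA" using carriers by (simp add: T_def)
  have ST: "S * T = mat_cpow \<sigma> 0" "T * S = mat_cpow \<sigma> 0"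
    unfolding S_def T_def mat_cpow_add[OF \<sigma>] by (simp_all flip: of_real_add)
  have L: "?L = T * (mat_cpow X 0 * S)"
  proof -
    have "1 / 2 * \<theta> = r / 2" "(\<alpha> - 1) / 2 + (- \<alpha> / 2) * \<theta> = 0"
      using \<theta>_gt[OF assms] r_eq by simp_all
    then show ?thesis
      unfolding L_def T_def by (simp only: add_0_left of_real_0 flip: of_real_mult of_real_add)
  qed
  \<comment> \<open>This puts \<open>S * \<rho>A\<close> into the range of \<open>X\<close>, where
    the support projection \<open>mat_cpow X 0\<close> acts as the identity.\<close>
  have S\<rho>: "S * \<rho>A = X * T"
  proof -
    have "X * T = S * (\<rho>A * (S * T))" unfolding X_def using carriers Tc by (simp add: square_assoc[of _ dA])
    then show ?thesis by (simp add: ST \<rho>P)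
  qed
  have "?L * \<rho>A = T * (mat_cpow X 0 * (S * \<rho>A))"
    unfolding L using carriers Tc by (simp add: square_assoc[of _ dA])
  also have "mat_cpow X 0 * (S * \<rho>A) = S * \<rho>A"
    unfolding S\<rho> using cpow_mult_cpow_mult[OF X Tc, of 0 1] by (simp add: mat_cpow_one[OF X])
  also have "T * (S * \<rho>A) = (T * S) * \<rho>A" using carriers Tc by (simp add: square_assoc[of _ dA])
  finally have L\<rho>: "?L * \<rho>A = \<rho>A" unfolding ST P\<rho> .
  define N where "N = 1\<^sub>m dA - ?L"
  have Nc: "N \<in> carrier_mat dA dA" unfolding N_def using Lc by (rule minus_carrier_mat)
  have N\<rho>: "N * \<rho>A = 0\<^sub>m dA dA"
    unfolding N_def using Lc \<rho>Ac by (simp add: minus_mult_distrib_mat[of _ dA dA _ _ dA] L\<rho> minus_r_inv_mat)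
  have "ampl dA dB N * \<rho> = 0\<^sub>m ?N ?N"
  proof (rule psd_congruence_trace_zero[OF \<rho> ampl_carrier])
    have "mat_trace (ampl dA dB N * \<rho> * mat_adjoint (ampl dA dB N)) = mat_trace (ptrace_B dA dB (ampl dA dB N * \<rho> * ampl dA dB (mat_adjoint N)))"
      unfolding ampl_adjoint[OF Nc] by (rule trace_ptrace[symmetric]) (use \<rho>c in auto)
    also have "\<dots> = mat_trace (N * \<rho>A * mat_adjoint N)"
      using ptrace_ampl_mult(2)[of "ampl dA dB N * \<rho>" dA dB "mat_adjoint N"] ptrace_ampl_mult(1)[OF \<rho>c Nc] Nc \<rho>c
      by (simp add: \<rho>A_def)
    also have "\<dots> = 0" unfolding N\<rho> using Nc by (simp add: mat_trace_def left_mult_zero_mat[of _ dA dA])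
    finally show "mat_trace (ampl dA dB N * \<rho> * mat_adjoint (ampl dA dB N)) = 0" .
  qed
  moreover have "ampl dA dB N * \<rho> = \<rho> - ampl dA dB ?L * \<rho>"
    unfolding N_def ampl_minus[OF one_carrier_mat Lc] ampl_one using \<rho>c
    by (simp add: minus_mult_distrib_mat[of _ ?N ?N _ _ ?N])
  ultimately have eq: "\<rho> - ampl dA dB ?L * \<rho> = 0\<^sub>m ?N ?N" by simp
  have G\<rho>: "ampl dA dB ?L * \<rho> = \<rho>"
  proof (rule eq_matI)
    fix i j assume ij: "i < dim_row \<rho>" "j < dim_col \<rho>"
    have "(\<rho> - ampl dA dB ?L * \<rho>) $$ (i, j) = 0\<^sub>m ?N ?N $$ (i, j)" by (simp only: eq)
    then show "(ampl dA dB ?L * \<rho>) $$ (i, j) = \<rho> $$ (i, j)" using ij \<rho>c by (simp del: index_mult_mat(1))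
  qed (use \<rho>c in auto)
  have "mat_adjoint (ampl dA dB ?L * \<rho>) = \<rho> * mat_adjoint (ampl dA dB ?L)"
    using \<rho>c by (simp add: square_adjoint_mult[of _ ?N] psd_mat_adjoint[OF \<rho>])
  then show ?thesis unfolding R_def G\<rho> psd_mat_adjoint[OF \<rho>] by simp
qed

text \<open>Here \<open>L\<close> is \<open>S * mat_cpow X (\<alpha> - 1) * S\<close> at \<theta>;
  cyclicity assembles \<open>S * \<rho>A * S = X\<close>, which raises the exponent to
  \<alpha>.\<close>

lemma trace_L_\<theta>_lt:
  assumes "\<alpha> < 1" shows "mat_trace (ampl dA dB (L (of_real \<theta>)) * \<rho>) = of_real Q"
proof -
  note \<rho>c = psd_mat_carrier[OF \<rho>]
  have L: "L (of_real \<theta>) = S * (mat_cpow X (of_real (\<alpha> - 1)) * S)"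
  proof -
    have "1 / 2 * \<theta> = - r / 2" "(\<alpha> - 1) / 2 + (- \<alpha> / 2) * \<theta> = \<alpha> - 1"
      using \<theta>_lt[OF assms] r_eq by simp_all
    then show ?thesis
      unfolding L_def S_def by (simp only: add_0_left flip: of_real_mult of_real_add)
  qed
  have "mat_trace (ampl dA dB (L (of_real \<theta>)) * \<rho>) = mat_trace (L (of_real \<theta>) * \<rho>A)"
    unfolding \<rho>A_def ptrace_ampl_mult(1)[OF \<rho>c L_carrier, symmetric] by (rule trace_ptrace[symmetric]) (use \<rho>c in auto)
  also have "\<dots> = mat_trace (S * (mat_cpow X (of_real (\<alpha> - 1)) * (S * \<rho>A)))"
    unfolding L using carriers by (simp add: square_assoc[of _ dA])
  also have "\<dots> = mat_trace (mat_cpow X (of_real (\<alpha> - 1)) * X)"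
    by (subst trace_comm[of _ dA]) (use carriers in \<open>simp_all add: X_def square_assoc[of _ dA]\<close>)
  also have "mat_cpow X (of_real (\<alpha> - 1)) * X = mat_cpow X (of_real \<alpha>)"
    using mat_cpow_add[OF X, of "of_real (\<alpha> - 1)" 1] by (simp add: mat_cpow_one[OF X])
  also have "mat_trace (mat_cpow X (of_real \<alpha>)) = of_real Q"
    unfolding Q_def by (rule psd_trace_real[OF psd_mat_cpow[OF X]])
  finally show ?thesis .
qed

end

section \<open>The extension and its measured divergence\<close>

lemma powr_mult_powr_le_arith:
  fixes x y w :: real
  assumes "0 \<le> x" "0 \<le> y" "0 \<le> w" "w \<le> 1"
  shows "x powr w * y powr (1 - w) \<le> w * x + (1 - w) * y"
proof (cases "x = 0 \<or> y = 0")
  case True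
  then have "x powr w * y powr (1 - w) = 0" by auto
  then show ?thesis using assms by (simp only: add_nonneg_nonneg mult_nonneg_nonneg diff_ge_0_iff_ge)
next
  case False
  then show ?thesis using assms by (intro Youngs_inequality_0) auto
qed

text \<open>Raising the hypothesis to the power \<alpha> gives
  \<open>p powr \<alpha> \<le> a * q powr (\<alpha> - 1)\<close>, since
  \<open>(1 - \<theta>) * \<alpha> = 1\<close>. For \<open>q = 0\<close> the left-hand side is 0 by
  convention.\<close>

lemma gt_one_term_bound:
  fixes p q a \<alpha> \<theta> :: real
  assumes \<alpha>: "0 < \<alpha>" "\<alpha> * \<theta> = \<alpha> - 1" and nonneg: "0 \<le> p" "0 \<le> q" "0 \<le> a"
    and le: "p \<le> a powr (1 - \<theta>) * q powr \<theta>"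
  shows "p powr \<alpha> * q powr (1 - \<alpha>) \<le> a"
proof (cases "q = 0")
  case False
  then have q: "0 < q" using nonneg by simp
  have e: "(1 - \<theta>) * \<alpha> = 1" "\<theta> * \<alpha> = \<alpha> - 1" using \<alpha> by (simp_all add: algebra_simps)
  have "p powr \<alpha> \<le> (a powr (1 - \<theta>) * q powr \<theta>) powr \<alpha>"
    using le nonneg \<alpha> by (intro powr_mono2) auto
  also have "\<dots> = a * q powr (\<alpha> - 1)"
    using nonneg by (simp only: powr_mult powr_powr e powr_one)
  finally have "p powr \<alpha> * q powr (1 - \<alpha>) \<le> a * q powr (\<alpha> - 1) * q powr (1 - \<alpha>)"
    by (intro mult_right_mono) auto
  also have "\<dots> = a" using q by (simp add: mult.assoc flip: powr_add)
  finally show ?thesis .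
qed (use nonneg in simp)

text \<open>Weighted arithmetic-geometric mean. The weight \<open>w\<close> is dictated by the
  exponent 1/2 of \<open>p\<close>, that is \<open>\<alpha> * w = 1 / 2\<close>; the exponents of
  \<open>q\<close> and \<open>a\<close> then match. The additive form can be summed over
  outcomes.\<close>

lemma lt_one_term_bound:
  fixes p q a N \<alpha> \<theta> :: real
  assumes \<alpha>: "1 / 2 \<le> \<alpha>" "\<alpha> < 1" "\<alpha> * \<theta> = 1 - \<alpha>" and nonneg: "0 \<le> p" "0 \<le> q" "0 \<le> a"
    and le: "N \<le> (if \<theta> = 1 then q else a powr (1 - \<theta>) * q powr \<theta>)"
  defines "w \<equiv> 1 / (2 * \<alpha>)"
  shows "sqrt p * sqrt N \<le> w * (p powr \<alpha> * q powr (1 - \<alpha>)) + (1 - w) * a"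
proof (cases "\<theta> = 1")
  case True
  then have \<alpha>w: "\<alpha> = 1 / 2" "w = 1" using \<alpha> by (auto simp: w_def)
  have "sqrt p * sqrt N \<le> sqrt p * sqrt q"
    using le True nonneg by (intro mult_left_mono) auto
  then show ?thesis unfolding \<alpha>w using nonneg by (simp add: powr_half_sqrt)
next
  case False
  have \<theta>: "\<theta> = (1 - \<alpha>) / \<alpha>" using \<alpha> by (simp add: field_simps)
  have e: "\<alpha> * w = 1 / 2" "w * (1 - \<alpha>) = \<theta> * (1 / 2)" "(1 - \<alpha>) * w = \<theta> * (1 / 2)" "(1 - \<theta>) * (1 / 2) = 1 - w"
    using \<alpha> by (auto simp: w_def \<theta> field_simps)
  have w: "0 \<le> w" "w \<le> 1" using \<alpha> by (auto simp: w_def)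
  have "sqrt p * sqrt N \<le> sqrt p * sqrt (a powr (1 - \<theta>) * q powr \<theta>)"
    using le False nonneg by (intro mult_left_mono) auto
  also have "\<dots> = p powr (1 / 2) * (a powr (1 - \<theta>) * q powr \<theta>) powr (1 / 2)"
    using nonneg by (simp add: powr_half_sqrt)
  also have "\<dots> = (p powr \<alpha> * q powr (1 - \<alpha>)) powr w * a powr (1 - w)"
    by (simp only: powr_mult powr_powr e mult_ac)
  also have "\<dots> \<le> w * (p powr \<alpha> * q powr (1 - \<alpha>)) + (1 - w) * a"
    using w nonneg by (intro powr_mult_powr_le_arith) auto
  finally show ?thesis .
qed

text \<open>The witness is obtained before the measurement is quantified. The first property secures
  finiteness for \<alpha> > 1; the bounds on the sum point in opposite directions because the
  prefactor of the logarithm changes sign at \<alpha> = 1.\<close>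

lemma (in renyi_interpolation) ex_extension:
  assumes \<sigma>d: "\<sigma> \<in> density_mats dA"
  obtains \<tau> where "\<tau> \<in> extensions dA dB \<sigma>"
    and "\<And>n M x. povm (dA * dB) n M \<Longrightarrow> 1 < \<alpha> \<Longrightarrow> x < n \<Longrightarrow> Re (mat_trace (M x * \<tau>)) = 0 \<Longrightarrow> Re (mat_trace (M x * \<rho>)) = 0"
    and "\<And>n M. povm (dA * dB) n M \<Longrightarrow> 1 < \<alpha> \<Longrightarrow>
      (\<Sum>x<n. Re (mat_trace (M x * \<rho>)) powr \<alpha> * Re (mat_trace (M x * \<tau>)) powr (1 - \<alpha>)) \<le> Q"
    and "\<And>n M. povm (dA * dB) n M \<Longrightarrow> \<alpha> < 1 \<Longrightarrow>
      Q \<le> (\<Sum>x<n. Re (mat_trace (M x * \<rho>)) powr \<alpha> * Re (mat_trace (M x * \<tau>)) powr (1 - \<alpha>))"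
proof -
  let ?N = "dA * dB"
  note \<rho>c = psd_mat_carrier[OF \<rho>] and \<sigma>c = psd_mat_carrier[OF \<sigma>]
  obtain \<mu>0 \<mu>1 where \<mu>: "strip_measures \<theta> \<mu>0 \<mu>1" using ex_strip_measures[OF \<theta>_pos \<theta>_le_1] by blast
  then have \<mu>0: "prob_space \<mu>0" "sets \<mu>0 = sets borel" and \<mu>1: "prob_space \<mu>1" "sets \<mu>1 = sets borel"
    by (auto simp: strip_measures_def)
  have G: "exp_poly_mat ?N (\<lambda>z. ampl dA dB (L z))" by (rule exp_poly_mat_ampl[OF exp_poly_L])
  have Rb: "bounded_cont_mat ?N (\<lambda>t. R (of_real x + \<i> * of_real t))" for x
    unfolding R_def
    by (intro bounded_cont_mat_mult bounded_cont_mat_adjoint bounded_cont_mat_exp_poly[OF G] bounded_cont_mat_const \<rho>c)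
  define \<tau>0 where "\<tau>0 = mat_integral ?N \<mu>1 (\<lambda>t. R (of_real 1 + \<i> * of_real t))"
  have \<tau>0: "psd_mat ?N \<tau>0" unfolding \<tau>0_def by (rule psd_mat_integral[OF \<mu>1 Rb R_psd])
  have "psd_mat dA (\<sigma> - ptrace_B dA dB \<tau>0)"
  proof -
    have b: "bounded_cont_mat dA (\<lambda>t. ptrace_B dA dB (R (of_real 1 + \<i> * of_real t)))"
      unfolding ptrace_R
      by (intro bounded_cont_mat_mult bounded_cont_mat_adjoint bounded_cont_mat_exp_poly[OF exp_poly_L] bounded_cont_mat_const psd_mat_carrier[OF \<rho>A])
    show ?thesis
      unfolding \<tau>0_def ptrace_mat_integral[OF \<mu>1 Rb] mat_integral_const_minus(1)[OF \<mu>1 b \<sigma>c, symmetric]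
      by (intro psd_mat_integral \<mu>1 mat_integral_const_minus(2)[OF \<mu>1 b \<sigma>c] \<sigma>_minus_ptrace_R_right)
  qed
  from extension_completion[OF dB \<tau>0 \<sigma>d this] obtain \<tau> where \<tau>: "\<tau> \<in> extensions dA dB \<sigma>"
    and ge: "psd_mat ?N (\<tau> - \<tau>0)" by blast
  have \<tau>p: "psd_mat ?N \<tau>" using \<tau> by (simp add: extensions_def density_mats_def)
  define p q where "p = (\<lambda>M. Re (mat_trace (M * \<rho>)))" and "q = (\<lambda>M. Re (mat_trace (M * \<tau>)))"
  define f where "f = (\<lambda>M z. Re (mat_trace (M * R z)))"
  define a where "a = (\<lambda>M. LINT t|\<mu>0. f M (of_real 0 + \<i> * of_real t))"
  define b where "b = (\<lambda>M. LINT t|\<mu>1. f M (of_real 1 + \<i> * of_real t))"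
  have p_nonneg: "0 \<le> p M" and q_nonneg: "0 \<le> q M" and f_nonneg: "0 \<le> f M z" if "psd_mat ?N M" for M z
    using trace_psd_nonneg(1)[OF that] \<rho> \<tau>p R_psd by (simp_all add: p_def q_def f_def)
  have a_nonneg: "0 \<le> a M" and b_nonneg: "0 \<le> b M" if "psd_mat ?N M" for M
    unfolding a_def b_def by (intro integral_nonneg_AE AE_I2 f_nonneg that)+
  \<comment> \<open>The average over the right line is the trace against \<tau>0, and \<tau>
    dominates \<tau>0.\<close>
  have b_le: "b M \<le> q M" if M: "psd_mat ?N M" for M
  proof -
    note Mc = psd_mat_carrier[OF M] and \<tau>c = psd_mat_carrier[OF \<tau>p] and \<tau>0c = psd_mat_carrier[OF \<tau>0]
    have "b M = Re (mat_trace (M * \<tau>0))"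
      unfolding b_def f_def \<tau>0_def trace_mat_integral(2)[OF \<mu>1 Rb Mc]
      by (rule integral_Re) (rule trace_mat_integral(1)[OF \<mu>1 Rb Mc])
    moreover have "mat_trace (M * (\<tau> - \<tau>0)) = mat_trace (M * \<tau>) - mat_trace (M * \<tau>0)"
      using Mc \<tau>c \<tau>0c by (simp add: mult_minus_distrib_mat[of _ ?N ?N _ ?N] trace_minus[of _ ?N])
    ultimately show ?thesis using trace_psd_nonneg(1)[OF M ge] by (simp add: q_def)
  qed
  have key: "f M (of_real \<theta>) \<le> (if \<theta> = 1 then q M else a M powr (1 - \<theta>) * q M powr \<theta>)" if M: "psd_mat ?N M" for M
  proof -
    have "f M (of_real \<theta>) \<le> (if \<theta> = 1 then b M else a M powr (1 - \<theta>) * b M powr \<theta>)"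
      using three_lines_trace[OF \<mu> \<theta>_pos \<theta>_le_1 M \<rho> G] unfolding f_def a_def b_def R_def .
    also have "\<dots> \<le> (if \<theta> = 1 then q M else a M powr (1 - \<theta>) * q M powr \<theta>)"
      using b_le[OF M] b_nonneg[OF M] \<theta>_pos by (auto intro!: mult_left_mono powr_mono2)
    finally show ?thesis .
  qed
  \<comment> \<open>For each height the outcomes of the measurement add up to the trace of
    \<open>R\<close>, which is \<open>Q\<close> all along the left line; averaging over a
    probability measure changes nothing.\<close>
  have sum_a: "(\<Sum>x<n. a (M x)) = Q" if M: "povm ?N n M" for n M
  proof -
    interpret prob_space \<mu>0 by (rule \<mu>0(1))
    have "integrable \<mu>0 (\<lambda>t. f (M x) (of_real 0 + \<i> * of_real t))" if "x < n" for x
      unfolding f_def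
      by (rule integrable_Re[OF trace_mat_integral(1)[OF \<mu>0 Rb psd_mat_carrier[OF povm_psd[OF M that]]]])
    then have "(\<Sum>x<n. a (M x)) = (LINT t|\<mu>0. (\<Sum>x<n. f (M x) (of_real 0 + \<i> * of_real t)))"
      unfolding a_def by (intro Bochner_Integration.integral_sum[symmetric]) auto
    moreover have "(\<Sum>x<n. f (M x) (of_real 0 + \<i> * of_real t)) = Q" for t
    proof -
      have "(\<Sum>x<n. f (M x) (of_real 0 + \<i> * of_real t)) = Re (\<Sum>x<n. mat_trace (M x * R (of_real 0 + \<i> * of_real t)))"
        by (simp add: f_def)
      also have "\<dots> = Q"
        unfolding povm_trace_sum[OF M psd_mat_carrier[OF R_psd]] trace_R_left by simp
      finally show ?thesis .
    qed
    ultimately show ?thesis by (simp only: lebesgue_integral_const prob_space scaleR_one)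
  qed
  have gt: "p M \<le> a M powr (1 - \<theta>) * q M powr \<theta>" if "1 < \<alpha>" "psd_mat ?N M" for M
    using key[OF that(2)] \<theta>_gt[OF that(1)] unfolding f_def p_def R_\<theta>_gt[OF that(1)] by simp
  show ?thesis
  proof (rule that[OF \<tau>])
    \<comment> \<open>In the bound \<open>gt\<close> the factor \<open>q M powr \<theta>\<close> is
      0 when \<open>q M\<close> is, which leaves no room for a positive \<open>p M\<close>.\<close>
    fix n M x assume M: "povm ?N n M" and "1 < \<alpha>" "x < n" "Re (mat_trace (M x * \<tau>)) = 0"
    then show "Re (mat_trace (M x * \<rho>)) = 0"
      using gt[OF \<open>1 < \<alpha>\<close> povm_psd[OF M \<open>x < n\<close>]] p_nonneg[OF povm_psd[OF M \<open>x < n\<close>]]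
      by (simp add: p_def q_def)
  next
    fix n M assume M: "povm ?N n M" and \<alpha>1: "1 < \<alpha>"
    have "(\<Sum>x<n. p (M x) powr \<alpha> * q (M x) powr (1 - \<alpha>)) \<le> (\<Sum>x<n. a (M x))"
    proof (rule sum_mono)
      fix x assume "x \<in> {..<n}"
      then have Mx: "psd_mat ?N (M x)" using povm_psd[OF M] by simp
      show "p (M x) powr \<alpha> * q (M x) powr (1 - \<alpha>) \<le> a (M x)"
        by (rule gt_one_term_bound[OF \<alpha>_pos _ p_nonneg[OF Mx] q_nonneg[OF Mx] a_nonneg[OF Mx] gt[OF \<alpha>1 Mx]])
           (use \<theta>_gt[OF \<alpha>1] r_eq in simp)
    qed
    then show "(\<Sum>x<n. Re (mat_trace (M x * \<rho>)) powr \<alpha> * Re (mat_trace (M x * \<tau>)) powr (1 - \<alpha>)) \<le> Q"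
      unfolding sum_a[OF M] by (simp add: p_def q_def)
  next
    fix n M assume M: "povm ?N n M" and \<alpha>1: "\<alpha> < 1"
    define w where "w = 1 / (2 * \<alpha>)"
    let ?G = "ampl dA dB (L (of_real \<theta>))"
    let ?S = "\<Sum>x<n. p (M x) powr \<alpha> * q (M x) powr (1 - \<alpha>)"
    \<comment> \<open>\<open>Q\<close> is the trace of one matrix, so it splits over the outcomes.
      Each piece is controlled by Cauchy-Schwarz, whose second factor \<open>key\<close> bounds by
      interpolation.\<close>
    have "Q = Re (mat_trace (?G * \<rho>))" unfolding trace_L_\<theta>_lt[OF \<alpha>1] by simp
    also have "\<dots> = (\<Sum>x<n. Re (mat_trace (M x * (?G * \<rho>))))"
      by (subst povm_trace_sum[OF M, symmetric]) (use \<rho>c in auto)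
    also have "\<dots> \<le> (\<Sum>x<n. w * (p (M x) powr \<alpha> * q (M x) powr (1 - \<alpha>)) + (1 - w) * a (M x))"
    proof (rule sum_mono)
      fix x assume "x \<in> {..<n}"
      then have Mx: "psd_mat ?N (M x)" using povm_psd[OF M] by simp
      have "Re (mat_trace (M x * (?G * \<rho>))) \<le> norm (mat_trace (M x * (?G * \<rho>)))" by (rule complex_Re_le_cmod)
      also have "\<dots> \<le> sqrt (p (M x)) * sqrt (f (M x) (of_real \<theta>))"
        using trace_cauchy_schwarz[OF Mx \<rho> ampl_carrier] unfolding p_def f_def R_def .
      also have "\<dots> \<le> w * (p (M x) powr \<alpha> * q (M x) powr (1 - \<alpha>)) + (1 - w) * a (M x)"
        unfolding w_def
        by (rule lt_one_term_bound[OF \<alpha>(1) \<alpha>1 _ p_nonneg[OF Mx] q_nonneg[OF Mx] a_nonneg[OF Mx] key[OF Mx]])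
           (use \<theta>_lt[OF \<alpha>1] r_eq in simp)
      finally show "Re (mat_trace (M x * (?G * \<rho>))) \<le> w * (p (M x) powr \<alpha> * q (M x) powr (1 - \<alpha>)) + (1 - w) * a (M x)" .
    qed
    also have "\<dots> = w * ?S + (1 - w) * Q"
      by (simp only: sum.distrib sum_distrib_left[symmetric] sum_a[OF M])
    \<comment> \<open>The share \<open>(1 - w) * Q\<close> on the right is subtracted from both
      sides.\<close>
    finally have "w * Q \<le> w * ?S" by (simp add: algebra_simps)
    moreover have "0 < w" using \<alpha>_pos by (simp add: w_def)
    ultimately have "Q \<le> ?S" by (simp only: mult_le_cancel_left_pos)
    then show "Q \<le> (\<Sum>x<n. Re (mat_trace (M x * \<rho>)) powr \<alpha> * Re (mat_trace (M x * \<tau>)) powr (1 - \<alpha>))"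
      by (simp add: p_def q_def)
  qed
qed

lemma elog2_mono: "x \<le> y \<Longrightarrow> elog2 x \<le> elog2 y"
  by (auto simp: elog2_def)

lemma measured_renyi_set_real_le:
  assumes \<rho>d: "\<rho> \<in> density_mats (dA * dB)" and \<sigma>d: "\<sigma> \<in> density_mats dA" and dB: "0 < dB"
    and a: "1 / 2 \<le> a" "a \<noteq> 1"
  shows "measured_renyi_set (ereal a) \<rho> (extensions dA dB \<sigma>) \<le> renyi_real a (ptrace_B dA dB \<rho>) \<sigma>"
proof (cases "a < 1 \<or> mat_supp (ptrace_B dA dB \<rho>) \<subseteq> mat_supp \<sigma>")
  case False
  then show ?thesis by (simp add: renyi_real_def)
next
  case True
  have \<rho>p: "psd_mat (dA * dB) \<rho>" and \<sigma>p: "psd_mat dA \<sigma>" using \<rho>d \<sigma>d by (auto simp: density_mats_def)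
  interpret renyi_interpolation dA dB \<rho> \<sigma> a
  proof
    show "mat_cpow \<sigma> 0 * ptrace_B dA dB \<rho> = ptrace_B dA dB \<rho>" if "1 < a"
      using True that by (intro cpow_zero_mult_of_supp[OF psd_mat_ptrace[OF \<rho>p] \<sigma>p]) simp
  qed (use dB \<rho>p \<sigma>p a in auto)
  have "(1 - a) / (2 * a) = - r / 2" using \<alpha>_pos by (simp add: r_def field_simps)
  then have "mat_powr \<sigma> ((1 - a) / (2 * a)) = S"
    unfolding S_def mat_powr_eq_cpow[OF \<sigma>p] by (simp only:)
  then have D: "renyi_real a (ptrace_B dA dB \<rho>) \<sigma> = ereal (1 / (a - 1)) * elog2 Q"
    unfolding renyi_real_def Let_def using True
    by (simp add: Q_def X_def[symmetric] \<rho>A_def[symmetric] mat_powr_eq_cpow[OF X])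
  obtain \<tau> where \<tau>: "\<tau> \<in> extensions dA dB \<sigma>"
    and supp: "\<And>n M x. povm (dA * dB) n M \<Longrightarrow> 1 < a \<Longrightarrow> x < n \<Longrightarrow> Re (mat_trace (M x * \<tau>)) = 0 \<Longrightarrow> Re (mat_trace (M x * \<rho>)) = 0"
    and gt: "\<And>n M. povm (dA * dB) n M \<Longrightarrow> 1 < a \<Longrightarrow>
      (\<Sum>x<n. Re (mat_trace (M x * \<rho>)) powr a * Re (mat_trace (M x * \<tau>)) powr (1 - a)) \<le> Q"
    and lt: "\<And>n M. povm (dA * dB) n M \<Longrightarrow> a < 1 \<Longrightarrow>
      Q \<le> (\<Sum>x<n. Re (mat_trace (M x * \<rho>)) powr a * Re (mat_trace (M x * \<tau>)) powr (1 - a))"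
    by (rule ex_extension[OF \<sigma>d]) blast
  have \<tau>p: "psd_mat (dA * dB) \<tau>" using \<tau> by (simp add: extensions_def density_mats_def)
  have "measured_renyi (ereal a) \<rho> \<tau> \<le> renyi_real a (ptrace_B dA dB \<rho>) \<sigma>"
    unfolding measured_renyi_def D
  proof (rule Sup_least)
    fix y assume "y \<in> {renyi_div (ereal a) (povm_channel n M \<rho>) (povm_channel n M \<tau>) | n M. povm (dim_row \<rho>) n M}"
    then obtain n M where M: "povm (dA * dB) n M" and y: "y = renyi_real a (povm_channel n M \<rho>) (povm_channel n M \<tau>)"
      using psd_mat_carrier[OF \<rho>p] by (auto simp: renyi_div_def)
    let ?S = "\<Sum>x<n. Re (mat_trace (M x * \<rho>)) powr a * Re (mat_trace (M x * \<tau>)) powr (1 - a)"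
    have yS: "y = ereal (1 / (a - 1)) * elog2 ?S"
      unfolding y povm_channel_psd[OF M \<rho>p] povm_channel_psd[OF M \<tau>p]
    proof (rule renyi_real_diag[OF \<alpha>_pos])
      show "0 \<le> Re (mat_trace (M x * \<rho>))" "0 \<le> Re (mat_trace (M x * \<tau>))" if "x < n" for x
        using trace_psd_nonneg(1)[OF povm_psd[OF M that]] \<rho>p \<tau>p by auto
      show "Re (mat_trace (M x * \<rho>)) = 0" if "1 \<le> a" "x < n" "Re (mat_trace (M x * \<tau>)) = 0" for x
        using supp[OF M _ that(2,3)] that(1) a(2) by simp
    qed
    show "y \<le> ereal (1 / (a - 1)) * elog2 Q"
    proof (cases "a < 1")
      case True
      have "elog2 Q \<le> elog2 ?S" by (rule elog2_mono[OF lt[OF M True]])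
      then have "ereal (1 / (1 - a)) * elog2 Q \<le> ereal (1 / (1 - a)) * elog2 ?S"
        using True by (intro ereal_mult_left_mono) auto
      moreover have "ereal (1 / (a - 1)) = - ereal (1 / (1 - a))"
        using True by (simp add: field_simps)
      ultimately show ?thesis unfolding yS by (simp only: ereal_mult_minus_left ereal_minus_le_minus)
    next
      case False
      then have "1 < a" using a by simp
      then show ?thesis unfolding yS using elog2_mono[OF gt[OF M]] by (intro ereal_mult_left_mono) auto
    qed
  qed
  then show ?thesis unfolding measured_renyi_set_def using \<tau> by (rule INF_lower2[rotated])
qed

theorem theorem3p2:
  fixes dA dB :: nat and \<rho> \<sigma> :: "complex mat" and \<alpha> :: ereal
  assumes "\<rho> \<in> density_mats (dA * dB)"
    and "\<sigma> \<in> density_mats dA"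
    and "\<alpha> \<in> {ereal (1/2)..<1} \<union> {1<..\<infinity>}"
  shows "measured_renyi \<alpha> (ptrace_B dA dB \<rho>) \<sigma> \<le> measured_renyi_set \<alpha> \<rho> (extensions dA dB \<sigma>)
    \<and> measured_renyi_set \<alpha> \<rho> (extensions dA dB \<sigma>) \<le> renyi_div \<alpha> (ptrace_B dA dB \<rho>) \<sigma>"
proof
  have \<rho>c: "\<rho> \<in> carrier_mat (dA * dB) (dA * dB)" and tr: "mat_trace \<rho> = 1"
    using assms(1) by (auto simp: density_mats_def intro: psd_mat_carrier)
  show "measured_renyi \<alpha> (ptrace_B dA dB \<rho>) \<sigma> \<le> measured_renyi_set \<alpha> \<rho> (extensions dA dB \<sigma>)"
    unfolding measured_renyi_set_def by (intro INF_greatest measured_renyi_ptrace_le \<rho>c)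
  \<comment> \<open>Completing a marginal divides by \<open>dB\<close>. A joint matrix of size 0
    would have trace 0, so trace one excludes \<open>dB = 0\<close>.\<close>
  have dB: "0 < dB"
  proof (rule ccontr)
    assume "\<not> 0 < dB"
    then have "mat_trace \<rho> = 0" using \<rho>c by (simp add: mat_trace_def)
    then show False using tr by simp
  qed
  show "measured_renyi_set \<alpha> \<rho> (extensions dA dB \<sigma>) \<le> renyi_div \<alpha> (ptrace_B dA dB \<rho>) \<sigma>"
  proof (cases "\<alpha> = \<infinity>")
    case True
    then show ?thesis using measured_renyi_set_D_max_le[OF dB assms(1,2)] by (simp add: renyi_div_def)
  next
    case False
    with assms(3) obtain a where a: "\<alpha> = ereal a" "1 / 2 \<le> a" "a \<noteq> 1"
      by (cases \<alpha>) (auto simp: one_ereal_def)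
    then show ?thesis
      using measured_renyi_set_real_le[OF assms(1,2) dB a(2,3)] by (simp add: renyi_div_def)
  qed
qed

end
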